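(* Let $\alpha$ be an admissible frequency. The minimal decay rate $\beta_{\min}(\alpha)$ for $\alpha$ equals the minimal real number $\beta$ having the property that $W(\alpha-\mathrm{i}\beta,\theta)=0$ for at least one $\theta$ in the range $-\pi<\theta\le\pi$. Moreover, let $\omega=\alpha-\mathrm{i}\beta_{\min}(\alpha)$ be the corresponding optimal QN eigenvalue. Then for any $\theta\in(-\pi,\pi]$ such that $W(\omega,\theta)=0$, the cavity defined by $$\varepsilon(s)=\varepsilon_1+(\varepsilon_2-\varepsilon_1)\,\chi_{+}\!\left(\Psi^2(s;\omega,\theta)\right),\qquad 0<s<l, \qquad ( * )$$ is optimal for the frequency $\alpha$. Conversely, for each cavity $\varepsilon$ optimal for $\alpha$, there exists $\theta\in(-\pi,\pi]$ such that $( * )$ holds for almost every $s\in(0,l)$.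
   Context: Fixed constants: $l>0$ (cavity length), $c>0$ (speed of light), $\varepsilon_\infty\ge 1$ (permittivity of the outer medium), and $1\le\varepsilon_1<\varepsilon_2$. For $\zeta\in\mathbb{C}$, $\chi_{+}(\zeta)=1$ if $\operatorname{Im}\zeta>0$ and $\chi_{+}(\zeta)=0$ if $\operatorname{Im}\zeta\le 0$. An admissible cavity is a real function $\varepsilon\in L^\infty(0,l)$ with $\varepsilon_1\le\varepsilon(s)\le\varepsilon_2$ for almost every $s\in(0,l)$. A number $\omega\in\mathbb{C}$ is a quasi-normal (QN) eigenvalue of $\varepsilon$ if the problem $E''(s)=-\frac{\omega^2}{c^2}\varepsilon(s)E(s)$ on $(0,l)$, $E(0)=0$, $\mathrm{i}\omega\frac{\sqrt{\varepsilon_\infty}}{c}E(l)=E'(l)$ has a nontrivial complex-valued solution $E$. All differential equations are understood almost everywhere, with the solution and its first derivative absolutely continuous on $[0,l]$. If $\varepsilon$ is an admissible cavity and $\omega$ is a QN eigenvalue of $\varepsilon$, then $\{\omega,\varepsilon\}$ is called an admissible pair, and its decay rate is $\mathrm{Dr}(\omega,\varepsilon)=-\operatorname{Im}\omega$. A real number $\alpha$ is an admissible frequency if $\alpha=\operatorname{Re}\omega$ for some admissible pair $\{\omega,\varepsilon\}$. A number $\beta_{\min}(\alpha)$ is the minimal decay rate, and $\varepsilon$ is an optimal cavity, for a frequency $\alpha$ if the pair $\{\alpha-\mathrm{i}\beta_{\min}(\alpha),\varepsilon\}$ is admissible and $\beta_{\min}(\alpha)\le\mathrm{Dr}(\tilde\omega,\tilde\varepsilon)$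 for every admissible pair $\{\tilde\omega,\tilde\varepsilon\}$ with $\operatorname{Re}\tilde\omega=\alpha$. The QN eigenvalue $\alpha-\mathrm{i}\beta_{\min}(\alpha)$ is then called optimal for $\alpha$. For $z\in\mathbb{C}$ and $\theta\in(-\pi,\pi]$, $\Psi(s)=\Psi(s;z,\theta)$, $0\le s\le l$, denotes the unique complex-valued solution of the initial value problem $$\partial_s^2\Psi=-\frac{z^2}{c^2}\,\Psi\left[\varepsilon_1+(\varepsilon_2-\varepsilon_1)\chi_{+}(\Psi^2)\right],\qquad \Psi(0;z,\theta)=0,\qquad \partial_s\Psi(0;z,\theta)=e^{\mathrm{i}\theta},$$ and $$W(z,\theta)=\mathrm{i}z\frac{\sqrt{\varepsilon_\infty}}{c}\,\Psi(l;z,\theta)-\partial_s\Psi(l;z,\theta).$$ *)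

theory Defs
  imports "HOL-Analysis.Analysis"
begin

definition abs_continuous_on_interval :: "(real \<Rightarrow> complex) \<Rightarrow> real \<Rightarrow> real \<Rightarrow> bool" where
  "abs_continuous_on_interval f a b \<longleftrightarrow>
     (\<forall>e>0. \<exists>d>0. \<forall>I :: (real \<times> real) set.
        finite I \<longrightarrow> (\<forall>(u, v)\<in>I. a \<le> u \<and> u \<le> v \<and> v \<le> b) \<longrightarrow>
        disjoint_family_on (\<lambda>(u, v). {u<..<v}) I \<longrightarrow>
        (\<Sum>(u, v)\<in>I. v - u) < d \<longrightarrow>
        (\<Sum>(u, v)\<in>I. norm (f v - f u)) < e)"

(* Relative to {0..l}, so that the derivatives at the two endpoints are one-sided. *)
definition deriv_on :: "real \<Rightarrow> (real \<Rightarrow> complex) \<Rightarrow> real \<Rightarrow> complex" where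
  "deriv_on l E s = vector_derivative E (at s within {0..l})"

definition chi_plus :: "complex \<Rightarrow> real" where
  "chi_plus \<zeta> = (if Im \<zeta> > 0 then 1 else 0)"

(* Differentiability is required explicitly because vector_derivative is an arbitrary
   value where the derivative does not exist. *)
definition wave_solution ::
  "real \<Rightarrow> real \<Rightarrow> complex \<Rightarrow> (real \<Rightarrow> real) \<Rightarrow> (real \<Rightarrow> complex) \<Rightarrow> bool" where
  "wave_solution l c \<omega> \<epsilon> E \<longleftrightarrow>
     (\<forall>s\<in>{0..l}. E differentiable (at s within {0..l})) \<and>
     abs_continuous_on_interval E 0 l \<and>
     abs_continuous_on_interval (deriv_on l E) 0 l \<and>
     (AE s in lebesgue_on {0<..<l}.
        (deriv_on l E has_vector_derivative
           - (\<omega>\<^sup>2 / (of_real c)\<^sup>2) * of_real (\<epsilon> s) * E s) (at s))"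

(* Membership in L_infinity is implied by measurability and the bounds. *)
definition admissible_cavity :: "real \<Rightarrow> real \<Rightarrow> real \<Rightarrow> (real \<Rightarrow> real) \<Rightarrow> bool" where
  "admissible_cavity l \<epsilon>1 \<epsilon>2 \<epsilon> \<longleftrightarrow>
     \<epsilon> \<in> borel_measurable (lebesgue_on {0<..<l}) \<and>
     (AE s in lebesgue_on {0<..<l}. \<epsilon>1 \<le> \<epsilon> s \<and> \<epsilon> s \<le> \<epsilon>2)"

definition qn_eigenvalue ::
  "real \<Rightarrow> real \<Rightarrow> real \<Rightarrow> (real \<Rightarrow> real) \<Rightarrow> complex \<Rightarrow> bool" where
  "qn_eigenvalue l c \<epsilon>inf \<epsilon> \<omega> \<longleftrightarrow>
     (\<exists>E. wave_solution l c \<omega> \<epsilon> E \<and> E 0 = 0 \<and>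
          \<i> * \<omega> * of_real (sqrt \<epsilon>inf / c) * E l = deriv_on l E l \<and>
          (\<exists>s\<in>{0..l}. E s \<noteq> 0))"

definition admissible_pair ::
  "real \<Rightarrow> real \<Rightarrow> real \<Rightarrow> real \<Rightarrow> real \<Rightarrow> complex \<Rightarrow> (real \<Rightarrow> real) \<Rightarrow> bool" where
  "admissible_pair l c \<epsilon>inf \<epsilon>1 \<epsilon>2 \<omega> \<epsilon> \<longleftrightarrow>
     admissible_cavity l \<epsilon>1 \<epsilon>2 \<epsilon> \<and> qn_eigenvalue l c \<epsilon>inf \<epsilon> \<omega>"

definition decay_rate :: "complex \<Rightarrow> (real \<Rightarrow> real) \<Rightarrow> real" where
  "decay_rate \<omega> \<epsilon> = - Im \<omega>"

definition admissible_frequency ::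
  "real \<Rightarrow> real \<Rightarrow> real \<Rightarrow> real \<Rightarrow> real \<Rightarrow> real \<Rightarrow> bool" where
  "admissible_frequency l c \<epsilon>inf \<epsilon>1 \<epsilon>2 \<alpha> \<longleftrightarrow>
     (\<exists>\<omega> \<epsilon>. admissible_pair l c \<epsilon>inf \<epsilon>1 \<epsilon>2 \<omega> \<epsilon> \<and> \<alpha> = Re \<omega>)"

definition optimal_for ::
  "real \<Rightarrow> real \<Rightarrow> real \<Rightarrow> real \<Rightarrow> real \<Rightarrow> real \<Rightarrow> real \<Rightarrow> (real \<Rightarrow> real) \<Rightarrow> bool" where
  "optimal_for l c \<epsilon>inf \<epsilon>1 \<epsilon>2 \<alpha> \<beta> \<epsilon> \<longleftrightarrow>
     admissible_pair l c \<epsilon>inf \<epsilon>1 \<epsilon>2 (Complex \<alpha> (- \<beta>)) \<epsilon> \<and>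
     (\<forall>\<omega>' \<epsilon>'. admissible_pair l c \<epsilon>inf \<epsilon>1 \<epsilon>2 \<omega>' \<epsilon>' \<longrightarrow> Re \<omega>' = \<alpha> \<longrightarrow>
        \<beta> \<le> decay_rate \<omega>' \<epsilon>')"

definition is_minimal_decay_rate ::
  "real \<Rightarrow> real \<Rightarrow> real \<Rightarrow> real \<Rightarrow> real \<Rightarrow> real \<Rightarrow> real \<Rightarrow> bool" where
  "is_minimal_decay_rate l c \<epsilon>inf \<epsilon>1 \<epsilon>2 \<alpha> \<beta> \<longleftrightarrow> (\<exists>\<epsilon>. optimal_for l c \<epsilon>inf \<epsilon>1 \<epsilon>2 \<alpha> \<beta> \<epsilon>)"

definition beta_min :: "real \<Rightarrow> real \<Rightarrow> real \<Rightarrow> real \<Rightarrow> real \<Rightarrow> real \<Rightarrow> real" where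
  "beta_min l c \<epsilon>inf \<epsilon>1 \<epsilon>2 \<alpha> = (THE \<beta>. is_minimal_decay_rate l c \<epsilon>inf \<epsilon>1 \<epsilon>2 \<alpha> \<beta>)"

definition optimal_cavity ::
  "real \<Rightarrow> real \<Rightarrow> real \<Rightarrow> real \<Rightarrow> real \<Rightarrow> real \<Rightarrow> (real \<Rightarrow> real) \<Rightarrow> bool" where
  "optimal_cavity l c \<epsilon>inf \<epsilon>1 \<epsilon>2 \<alpha> \<epsilon> \<longleftrightarrow> (\<exists>\<beta>. optimal_for l c \<epsilon>inf \<epsilon>1 \<epsilon>2 \<alpha> \<beta> \<epsilon>)"

definition switched_cavity :: "real \<Rightarrow> real \<Rightarrow> (real \<Rightarrow> complex) \<Rightarrow> real \<Rightarrow> real" where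
  "switched_cavity \<epsilon>1 \<epsilon>2 P s = \<epsilon>1 + (\<epsilon>2 - \<epsilon>1) * chi_plus ((P s)\<^sup>2)"

(* The restriction to extensional functions makes uniqueness meaningful: the initial
   value problem says nothing about values outside {0..l}. *)
definition Psi ::
  "real \<Rightarrow> real \<Rightarrow> real \<Rightarrow> real \<Rightarrow> complex \<Rightarrow> real \<Rightarrow> real \<Rightarrow> complex" where
  "Psi l c \<epsilon>1 \<epsilon>2 z \<theta> =
     (THE P. P \<in> extensional {0..l} \<and>
             wave_solution l c z (switched_cavity \<epsilon>1 \<epsilon>2 P) P \<and>
             P 0 = 0 \<and> deriv_on l P 0 = exp (\<i> * of_real \<theta>))"

definition W ::
  "real \<Rightarrow> real \<Rightarrow> real \<Rightarrow> real \<Rightarrow> real \<Rightarrow> complex \<Rightarrow> real \<Rightarrow> complex" where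
  "W l c \<epsilon>inf \<epsilon>1 \<epsilon>2 z \<theta> =
     \<i> * z * of_real (sqrt \<epsilon>inf / c) * Psi l c \<epsilon>1 \<epsilon>2 z \<theta> l
       - deriv_on l (Psi l c \<epsilon>1 \<epsilon>2 z \<theta>) l"

end

theory Submission
  imports Defs "HOL-Complex_Analysis.Great_Picard"
begin

text \<open>
  Replace a cavity \<open>\<epsilon>\<close> by its profile \<open>G t = \<integral>\<^sub>0\<^sup>t \<epsilon>\<close>, a function whose difference quotients lie between
  \<open>\<epsilon>\<^sub>1\<close> and \<open>\<epsilon>\<^sub>2\<close>, and put \<open>a = k G\<close> with \<open>k = \<omega>\<^sup>2 / c\<^sup>2\<close>. With the quasi-derivative \<open>Q = E' + a E\<close> the wave
  equation becomes the system \<open>E' = Q - a E\<close>, \<open>Q' = a (Q - a E)\<close> with continuous coefficients, whose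
  solutions depend continuously on \<open>G\<close> in the uniform norm. Profiles form a compact set by
  Arzela-Ascoli, so a minimal decay rate exists among them, and no weak convergence is needed.

  Fix an optimal pair \<open>(\<omega>, G)\<close> with eigenfunction \<open>E\<close>. The Wronskian identity shows that the boundary
  condition varies with the profile as \<open>H \<mapsto> k \<integral> E\<^sup>2 d(H - G)\<close>. If these values covered a neighbourhood of
  0, Brouwer's theorem would produce a profile with eigenvalue \<open>\<omega> + i s\<close> for small \<open>s > 0\<close>; hence they lie in
  a half-plane, and then \<open>G\<close> must have slope \<open>\<epsilon>\<^sub>2\<close> or \<open>\<epsilon>\<^sub>1\<close> according to the sign of \<open>Im ((q E)\<^sup>2)\<close> for some
  \<open>|q| = 1\<close>, so that \<open>q E\<close> solves the nonlinear problem. For \<open>\<omega>\<close> on the imaginary axis \<open>E\<close> is positive and the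
  intermediate value theorem along constant cavities plays the role of Brouwer's theorem.

  The nonlinear problem itself is well posed because for nonreal \<open>k\<close> every solution rotates strictly
  monotonically around the origin: the coefficient switches finitely often, and each switch is
  determined by the current state. Existence is obtained by inserting a delay into the feedback.
\<close>

section \<open>Linear differential equations\<close>

text \<open>Q is built so that the density drops out: Q' = E'' + a' E + a E', and a' E cancels E''.
  A cavity that is only bounded and measurable then acts through G alone, and integrals against it
  are Stieltjes integrals taken by parts and evaluated by mean values. Almost-everywhere statements
  are confined to the passage from and to wave solutions; in between, derivatives of G off a finite
  set are enough, because switching happens at finitely many points. Profiles form a convex set and
  the first variation is affine in H, so four profiles along the coordinate axes parametrize a disc
  of first variations, on which Brouwer's theorem acts. Failing that, there is p with Re (p E^2) as
  switching function, and q^2 = i p / |p| turns it into a multiple of Im ((q E)^2); |q| = 1 makes q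
  an initial slope of the form exp (i \<theta>). On the imaginary axis k is negative and E is real,
  so all first variations are real and cannot cover a neighbourhood of 0 in the plane. There E^2 > 0
  after 0, nothing switches, and the optimal cavity is constant.\<close>

lemma mono_of_deriv_nonneg:
  fixes f :: "real \<Rightarrow> real"
  assumes der: "\<And>t. t \<in> {a..b} \<Longrightarrow> (f has_vector_derivative f' t) (at t within {a..b})"
    and nonneg: "\<And>t. t \<in> {a<..<b} \<Longrightarrow> 0 \<le> f' t"
    and st: "a \<le> s" "s \<le> t" "t \<le> b"
  shows "f s \<le> f t"
proof (cases "s < t")
  case True
  have "(f has_derivative (\<lambda>h. h * f' x)) (at x within {s..t})" if "s \<le> x" "x \<le> t" for x
    using has_vector_derivative_within_subset[OF der, of x "{s..t}"] that st
    by (auto simp: has_vector_derivative_def)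
  then obtain x where "x \<in> {s<..<t}" "f t - f s = (t - s) * f' x"
    using mvt_simple[OF True, of f "\<lambda>x h. h * f' x"] by blast
  with nonneg[of x] st True show ?thesis
    by (smt (verit, ccfv_SIG) greaterThanLessThan_iff mult_nonneg_nonneg)
qed (use st in auto)

lemma gronwall:
  fixes \<phi> :: "real \<Rightarrow> real"
  assumes der: "\<And>t. t \<in> {a..b} \<Longrightarrow> (\<phi> has_vector_derivative \<phi>' t) (at t within {a..b})"
    and bound: "\<And>t. t \<in> {a..b} \<Longrightarrow> \<phi>' t \<le> M * \<phi> t"
    and t: "a \<le> t" "t \<le> b"
  shows "\<phi> t \<le> \<phi> a * exp (M * (t - a))"
proof -
  have "- (\<phi> a * exp (- M * a)) \<le> - (\<phi> t * exp (- M * t))"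
  proof (rule mono_of_deriv_nonneg[where a = a and b = b and f = "\<lambda>t. - (\<phi> t * exp (- M * t))" and f' = "\<lambda>t. (M * \<phi> t - \<phi>' t) * exp (- M * t)"])
    show "((\<lambda>t. - (\<phi> t * exp (- M * t))) has_vector_derivative (M * \<phi> t - \<phi>' t) * exp (- M * t))
        (at t within {a..b})" if "t \<in> {a..b}" for t
      using der[OF that] unfolding has_real_derivative_iff_has_vector_derivative[symmetric]
      by (auto intro!: derivative_eq_intros simp: algebra_simps)
  qed (use bound t in \<open>auto simp: less_imp_le\<close>)
  then have "\<phi> t * exp (- M * t) * exp (M * t) \<le> \<phi> a * exp (- M * a) * exp (M * t)"
    by simp
  then show ?thesis
    by (simp add: mult.assoc right_diff_distrib flip: exp_add)
qed

lemma gronwall_backward: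
  fixes \<phi> :: "real \<Rightarrow> real"
  assumes der: "\<And>t. t \<in> {a..b} \<Longrightarrow> (\<phi> has_vector_derivative \<phi>' t) (at t within {a..b})"
    and bound: "\<And>t. t \<in> {a..b} \<Longrightarrow> - M * \<phi> t \<le> \<phi>' t"
    and st: "a \<le> s" "s \<le> t" "t \<le> b"
  shows "\<phi> s \<le> \<phi> t * exp (M * (t - s))"
proof -
  have "\<phi> s * exp (M * s) \<le> \<phi> t * exp (M * t)"
  proof (rule mono_of_deriv_nonneg[where a = a and b = b and f = "\<lambda>t. \<phi> t * exp (M * t)" and f' = "\<lambda>t. (M * \<phi> t + \<phi>' t) * exp (M * t)"])
    show "((\<lambda>t. \<phi> t * exp (M * t)) has_vector_derivative (M * \<phi> t + \<phi>' t) * exp (M * t))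
        (at t within {a..b})" if "t \<in> {a..b}" for t
      using der[OF that] unfolding has_real_derivative_iff_has_vector_derivative[symmetric]
      by (auto intro!: derivative_eq_intros simp: algebra_simps)
    show "0 \<le> (M * \<phi> t + \<phi>' t) * exp (M * t)" if "t \<in> {a<..<b}" for t
      using bound[of t] that by auto
  qed (use st in auto)
  then have "\<phi> s * exp (M * s) * exp (- M * s) \<le> \<phi> t * exp (M * t) * exp (- M * s)"
    by simp
  then show ?thesis
    by (simp add: mult.assoc right_diff_distrib flip: exp_add)
qed

text \<open>Gronwall is applied to |w|^2 + \<delta>^2, because the norm itself is not differentiable
  at 0. The 1 in the rate 2 M + 1 pays for the cross term 2 |w| \<delta> <= |w|^2 +
  \<delta>^2.\<close>

lemma norm_growth:
  fixes w :: "real \<Rightarrow> 'a::real_inner"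
  assumes der: "\<And>t. t \<in> {a..b} \<Longrightarrow> (w has_vector_derivative w' t) (at t within {a..b})"
    and bound: "\<And>t. t \<in> {a..b} \<Longrightarrow> norm (w' t) \<le> M * norm (w t) + \<delta>"
    and t: "a \<le> t" "t \<le> b" and "0 \<le> \<delta>" "0 \<le> M"
  shows "norm (w t) \<le> (norm (w a) + \<delta>) * exp ((2 * M + 1) * (t - a))"
proof -
  define X where "X = (2 * M + 1) * (t - a)"
  have "(w t \<bullet> w t + \<delta>\<^sup>2) \<le> (w a \<bullet> w a + \<delta>\<^sup>2) * exp ((2 * M + 1) * (t - a))"
  proof (rule gronwall[where \<phi>' = "\<lambda>t. 2 * (w t \<bullet> w' t)"])
    show "((\<lambda>t. w t \<bullet> w t + \<delta>\<^sup>2) has_vector_derivative 2 * (w t \<bullet> w' t)) (at t within {a..b})"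
      if "t \<in> {a..b}" for t
      using der[OF that] unfolding has_vector_derivative_def
      by (auto intro!: derivative_eq_intros simp: inner_commute algebra_simps)
    show "2 * (w t \<bullet> w' t) \<le> (2 * M + 1) * (w t \<bullet> w t + \<delta>\<^sup>2)" if "t \<in> {a..b}" for t
    proof -
      have "w t \<bullet> w' t \<le> norm (w t) * norm (w' t)"
        by (rule norm_cauchy_schwarz)
      also have "\<dots> \<le> norm (w t) * (M * norm (w t) + \<delta>)"
        by (rule mult_left_mono[OF bound[OF that]]) simp
      finally have "2 * (w t \<bullet> w' t) \<le> 2 * M * (norm (w t))\<^sup>2 + 2 * norm (w t) * \<delta>"
        by (simp add: algebra_simps power2_eq_square)
      moreover have "2 * norm (w t) * \<delta> \<le> (norm (w t))\<^sup>2 + \<delta>\<^sup>2"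
        by (rule sum_squares_bound)
      moreover have "0 \<le> M * \<delta>\<^sup>2" using \<open>0 \<le> M\<close> by simp
      ultimately show ?thesis
        by (simp add: algebra_simps power2_norm_eq_inner)
    qed
  qed (use t in auto)
  then have "(norm (w t))\<^sup>2 + \<delta>\<^sup>2 \<le> ((norm (w a))\<^sup>2 + \<delta>\<^sup>2) * exp X"
    by (simp add: power2_norm_eq_inner X_def)
  \<comment> \<open>Bounding by a full square wastes a factor \<open>exp X\<close>, but lets the
    square root be taken on both sides.\<close>
  moreover have "((norm (w a))\<^sup>2 + \<delta>\<^sup>2) * exp X \<le> (norm (w a) + \<delta>)\<^sup>2 * (exp X)\<^sup>2"
  proof (rule mult_mono)
    show "(norm (w a))\<^sup>2 + \<delta>\<^sup>2 \<le> (norm (w a) + \<delta>)\<^sup>2"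
      using \<open>0 \<le> \<delta>\<close> by (simp add: power2_sum)
    have "1 \<le> exp X" using assms(5,6) t by (simp add: X_def)
    then show "exp X \<le> (exp X)\<^sup>2" by (simp add: power2_eq_square)
  qed auto
  ultimately have "(norm (w t))\<^sup>2 \<le> ((norm (w a) + \<delta>) * exp X)\<^sup>2"
    unfolding power_mult_distrib using zero_le_power2[of \<delta>] by linarith
  then show ?thesis
    unfolding X_def by (rule power2_le_imp_le) (use \<open>0 \<le> \<delta>\<close> in auto)
qed

text \<open>Backward Gronwall for |w|^2: such a system cannot bring a nonzero state to 0 in finite
  time.\<close>

lemma norm_decay:
  fixes w :: "real \<Rightarrow> 'a::real_inner"
  assumes der: "\<And>t. t \<in> {a..b} \<Longrightarrow> (w has_vector_derivative w' t) (at t within {a..b})"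
    and bound: "\<And>t. t \<in> {a..b} \<Longrightarrow> norm (w' t) \<le> M * norm (w t)"
    and st: "a \<le> s" "s \<le> t" "t \<le> b" and "w t = 0"
  shows "w s = 0"
proof -
  have "w s \<bullet> w s \<le> w t \<bullet> w t * exp (2 * M * (t - s))"
  proof (rule gronwall_backward[where \<phi>' = "\<lambda>t. 2 * (w t \<bullet> w' t)"])
    show "((\<lambda>t. w t \<bullet> w t) has_vector_derivative 2 * (w t \<bullet> w' t)) (at t within {a..b})"
      if "t \<in> {a..b}" for t
      using der[OF that] unfolding has_vector_derivative_def
      by (auto intro!: derivative_eq_intros simp: inner_commute algebra_simps)
    show "- (2 * M) * (w t \<bullet> w t) \<le> 2 * (w t \<bullet> w' t)" if "t \<in> {a..b}" for t
    proof -
      have "\<bar>w t \<bullet> w' t\<bar> \<le> norm (w t) * norm (w' t)"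
        by (rule Cauchy_Schwarz_ineq2)
      also have "\<dots> \<le> norm (w t) * (M * norm (w t))"
        by (rule mult_left_mono[OF bound[OF that]]) simp
      finally show ?thesis
        by (simp add: algebra_simps power2_eq_square flip: power2_norm_eq_inner)
    qed
  qed (use st in auto)
  with \<open>w t = 0\<close> show ?thesis
    by (metis inner_gt_zero_iff inner_zero_left linorder_not_less mult_zero_left)
qed

text \<open>Picard iteration written as a series: \<open>p n\<close> is the n-th iterated integral,
  dominated by a term of the exponential series, and the partial sums \<open>P\<close> are the
  Picard iterates. The assumption \<open>cont\<close> asks for continuity along continuous functions
  instead of joint continuity.\<close>

lemma linear_ode_exists:
  fixes f :: "real \<Rightarrow> 'a::banach \<Rightarrow> 'a"
  assumes "0 \<le> l"
    and lin: "\<And>t. linear (f t)"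
    and bound: "\<And>t x. t \<in> {0..l} \<Longrightarrow> norm (f t x) \<le> M * norm x"
    and cont: "\<And>g. continuous_on {0..l} g \<Longrightarrow> continuous_on {0..l} (\<lambda>t. f t (g t))"
  shows "\<exists>u. u 0 = x \<and> (\<forall>t\<in>{0..l}. (u has_vector_derivative f t (u t)) (at t within {0..l}))"
proof -
  define p where "p = rec_nat (\<lambda>t. x) (\<lambda>_ q t. integral {0..t} (\<lambda>s. f s (q s)))"
  have p0: "p 0 = (\<lambda>t. x)" and pSuc: "p (Suc n) = (\<lambda>t. integral {0..t} (\<lambda>s. f s (p n s)))" for n
    by (auto simp: p_def)
  have pcont: "continuous_on {0..l} (p n)" for n
  proof (induction n)
    case (Suc n)
    show ?case unfolding pSuc
      by (intro indefinite_integral_continuous_1 integrable_continuous_real cont Suc)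
  qed (simp add: p0)
  have fint: "(\<lambda>s. f s (g s)) integrable_on {0..t}" if "continuous_on {0..l} g" "t \<le> l" for g t
    using continuous_on_subset[OF cont[OF that(1)], of "{0..t}"] that(2)
    by (auto intro!: integrable_continuous_real)
  have M0: "0 \<le> M" if "x \<noteq> 0"
    using bound[of 0 x] \<open>0 \<le> l\<close> that norm_ge_zero[of "f 0 x"]
    by (smt (verit, best) atLeastAtMost_iff mult_neg_pos zero_less_norm_iff)
  have pbound: "norm (p n t) \<le> norm x * (M * t) ^ n / fact n" if "t \<in> {0..l}" for n t
    using that
  proof (induction n arbitrary: t)
    case (Suc n)
    have M: "norm (f s (p n s)) \<le> norm x * M ^ Suc n / fact n * s ^ n" if "s \<in> {0..t}" for s
    proof -
      have s: "s \<in> {0..l}" using that Suc.prems by auto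
      have "norm (f s (p n s)) \<le> M * norm (p n s)"
        by (rule bound[OF s])
      also have "\<dots> \<le> M * (norm x * (M * s) ^ n / fact n)"
      proof (cases "x = 0")
        case True
        then show ?thesis using Suc.IH[OF s] by simp
      qed (intro mult_left_mono Suc.IH s M0)
      finally show ?thesis by (simp add: power_mult_distrib mult_ac)
    qed
    have int: "((\<lambda>s. norm x * M ^ Suc n / fact n * s ^ n) has_integral
        norm x * M ^ Suc n / fact n * (t ^ Suc n / Suc n)) {0..t}"
    proof (intro has_integral_mult_right)
      have "((\<lambda>s. s ^ n) has_integral t ^ Suc n / Suc n - 0 ^ Suc n / Suc n) {0..t}"
        by (rule fundamental_theorem_of_calculus)
          (use Suc.prems in \<open>auto intro!: derivative_eq_intros simp del: of_nat_Suc power_Suc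
             simp flip: has_real_derivative_iff_has_vector_derivative\<close>)
      then show "((\<lambda>s. s ^ n) has_integral t ^ Suc n / Suc n) {0..t}" by simp
    qed
    have "norm (p (Suc n) t) \<le> norm x * M ^ Suc n / fact n * (t ^ Suc n / Suc n)"
      unfolding pSuc integral_unique[OF int, symmetric]
      by (rule integral_norm_bound_integral)
        (use M Suc.prems has_integral_integrable[OF int] in \<open>auto intro!: fint pcont\<close>)
    then show ?case
      by (simp add: power_mult_distrib mult_ac)
  qed (simp add: p0)
  define P where "P = (\<lambda>N t. \<Sum>n<N. p n t)"
  obtain u where u: "uniform_limit {0..l} P u sequentially"
  proof
    show "uniform_limit {0..l} P (\<lambda>t. \<Sum>n. p n t) sequentially"
      unfolding P_def
    proof (rule Weierstrass_m_test)
      show "norm (p n t) \<le> norm x * (\<bar>M\<bar> * l) ^ n / fact n" if "t \<in> {0..l}" for n t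
      proof -
        have "norm (p n t) \<le> \<bar>norm x * (M * t) ^ n / fact n\<bar>" using pbound[OF that] abs_ge_self order_trans by blast
        also have "\<dots> = norm x * (\<bar>M\<bar> * t) ^ n / fact n"
          using that by (simp add: abs_mult power_abs)
        also have "\<dots> \<le> norm x * (\<bar>M\<bar> * l) ^ n / fact n"
          using that by (intro divide_right_mono mult_left_mono power_mono) auto
        finally show ?thesis .
      qed
      show "summable (\<lambda>n. norm x * (\<bar>M\<bar> * l) ^ n / fact n)"
        using summable_mult[OF summable_exp_generic[of "\<bar>M\<bar> * l"], of "norm x"]
        by (simp add: field_simps)
    qed
  qed
  have Pcont: "continuous_on {0..l} (P N)" for N
    unfolding P_def by (intro continuous_on_sum pcont)
  have ucont: "continuous_on {0..l} u"
    by (rule uniform_limit_theorem[OF _ u]) (auto simp: Pcont)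
  have PSuc: "P (Suc N) t = x + integral {0..t} (\<lambda>s. f s (P N s))" if "t \<in> {0..l}" for N t
  proof (induction N)
    case 0
    have "f s 0 = 0" for s by (simp add: lin linear_0)
    then show ?case by (simp add: P_def p0)
  next
    case (Suc N)
    have "P (Suc (Suc N)) t = P (Suc N) t + p (Suc N) t"
      by (simp add: P_def)
    also have "\<dots> = x + integral {0..t} (\<lambda>s. f s (P N s) + f s (p N s))"
      unfolding Suc pSuc using that
      by (subst integral_add) (auto intro!: fint pcont Pcont)
    also have "(\<lambda>s. f s (P N s) + f s (p N s)) = (\<lambda>s. f s (P (Suc N) s))"
      by (simp add: P_def linear_add[OF lin])
    finally show ?case .
  qed
  have ueq: "u t = x + integral {0..t} (\<lambda>s. f s (u s))" if t: "t \<in> {0..l}" for t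
  proof -
    have "uniform_limit {0..t} (\<lambda>N s. f s (P N s)) (\<lambda>s. f s (u s)) sequentially"
      unfolding uniform_limit_iff
    proof (intro allI impI)
      fix e :: real assume "e > 0"
      then have "\<forall>\<^sub>F N in sequentially. \<forall>s\<in>{0..l}. dist (P N s) (u s) < e / (\<bar>M\<bar> + 1)"
        using u by (auto simp: uniform_limit_iff)
      then show "\<forall>\<^sub>F N in sequentially. \<forall>s\<in>{0..t}. dist (f s (P N s)) (f s (u s)) < e"
      proof (rule eventually_mono, intro ballI)
        fix N s assume *: "\<forall>s\<in>{0..l}. dist (P N s) (u s) < e / (\<bar>M\<bar> + 1)" and "s \<in> {0..t}"
        then have s: "s \<in> {0..l}" using t by auto
        have "dist (f s (P N s)) (f s (u s)) = norm (f s (P N s - u s))"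
          by (simp add: dist_norm linear_diff[OF lin])
        also have "\<dots> \<le> M * norm (P N s - u s)" by (rule bound[OF s])
        also have "\<dots> \<le> (\<bar>M\<bar> + 1) * norm (P N s - u s)"
          by (intro mult_right_mono) auto
        also have "\<dots> < e" using * s by (auto simp: dist_norm field_simps)
        finally show "dist (f s (P N s)) (f s (u s)) < e" .
      qed
    qed
    then obtain I J where IJ: "\<And>N. ((\<lambda>s. f s (P N s)) has_integral I N) {0..t}"
        "((\<lambda>s. f s (u s)) has_integral J) {0..t}" "I \<longlonglongrightarrow> J"
      by (rule uniform_limit_integral)
        (use t in \<open>auto intro: continuous_on_subset[OF cont[OF Pcont]]\<close>)
    have "(\<lambda>N. P (Suc N) t) \<longlonglongrightarrow> x + integral {0..t} (\<lambda>s. f s (u s))"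
      unfolding PSuc[OF t] using IJ(3) integral_unique[OF IJ(1)] integral_unique[OF IJ(2)]
      by (auto intro: tendsto_add)
    moreover have "(\<lambda>N. P (Suc N) t) \<longlonglongrightarrow> u t"
      using tendsto_uniform_limitI[OF u t] by (rule LIMSEQ_Suc)
    ultimately show ?thesis
      using LIMSEQ_unique by blast
  qed
  have "(u has_vector_derivative f t (u t)) (at t within {0..l})" if t: "t \<in> {0..l}" for t
  proof (rule has_vector_derivative_transform[OF t])
    show "((\<lambda>t. x + integral {0..t} (\<lambda>s. f s (u s))) has_vector_derivative f t (u t)) (at t within {0..l})"
      using integral_has_vector_derivative[OF cont[OF ucont] t]
      by (auto intro!: derivative_eq_intros)
  qed (rule ueq)
  moreover have "u 0 = x" using ueq[of 0] \<open>0 \<le> l\<close> by simp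
  ultimately show ?thesis by blast
qed

section \<open>The quasi-derivative form of the wave equation\<close>

definition quasi_field :: "complex \<Rightarrow> complex \<times> complex \<Rightarrow> complex \<times> complex" where
  "quasi_field a u = (snd u - a * fst u, a * (snd u - a * fst u))"

definition quasi_sol :: "real \<Rightarrow> (real \<Rightarrow> complex) \<Rightarrow> (real \<Rightarrow> complex \<times> complex) \<Rightarrow> bool" where
  "quasi_sol l a u \<longleftrightarrow> (\<forall>t\<in>{0..l}. (u has_vector_derivative quasi_field (a t) (u t)) (at t within {0..l}))"

text \<open>This is E' recovered from the state (E, Q). It makes sense at every point, although E'
  itself need not be differentiable.\<close>

definition slope :: "(real \<Rightarrow> complex) \<Rightarrow> (real \<Rightarrow> complex \<times> complex) \<Rightarrow> real \<Rightarrow> complex" where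
  "slope a u t = snd (u t) - a t * fst (u t)"

lemma linear_quasi_field: "linear (quasi_field a)"
  by (rule linearI) (auto simp: quasi_field_def algebra_simps scaleR_conv_of_real)

lemma norm_quasi_field:
  assumes "norm a \<le> R"
  shows "norm (quasi_field a u) \<le> (1 + R)\<^sup>2 * norm u"
proof -
  have f: "norm (fst u) \<le> norm u" and s: "norm (snd u) \<le> norm u"
    using norm_fst_le[of "fst u" "snd u"] norm_snd_le[of "snd u" "fst u"] by auto
  have R: "0 \<le> R" using assms norm_ge_zero order_trans by blast
  have "norm (snd u - a * fst u) \<le> norm (snd u) + norm a * norm (fst u)"
    by (metis norm_mult norm_triangle_ineq4)
  also have "\<dots> \<le> norm u + R * norm u"
    by (intro add_mono s mult_mono assms f R) auto
  finally have 1: "norm (snd u - a * fst u) \<le> (1 + R) * norm u"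
    by (simp add: algebra_simps)
  have "norm (quasi_field a u) \<le> norm (snd u - a * fst u) + norm a * norm (snd u - a * fst u)"
    unfolding quasi_field_def using norm_Pair_le[of "snd u - a * fst u" "a * (snd u - a * fst u)"]
    by (simp only: norm_mult)
  also have "\<dots> \<le> (1 + R) * norm u + R * ((1 + R) * norm u)"
    by (intro add_mono 1 mult_mono assms R) auto
  finally show ?thesis by (simp add: power2_eq_square algebra_simps)
qed

lemma norm_quasi_field_diff:
  assumes "norm a \<le> R" "norm b \<le> R"
  shows "norm (quasi_field a u - quasi_field b u) \<le> 2 * (1 + R) * norm (a - b) * norm u"
proof -
  have f: "norm (fst u) \<le> norm u" and s: "norm (snd u) \<le> norm u"
    using norm_fst_le[of "fst u" "snd u"] norm_snd_le[of "snd u" "fst u"] by auto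
  have eq: "quasi_field a u - quasi_field b u =
      (- ((a - b) * fst u), (a - b) * (snd u - (a + b) * fst u))"
    by (simp add: quasi_field_def algebra_simps)
  have ab: "norm (a + b) \<le> 2 * R"
    using norm_triangle_ineq[of a b] assms by linarith
  have R: "0 \<le> R" using assms norm_ge_zero order_trans by blast
  have "norm (snd u - (a + b) * fst u) \<le> norm (snd u) + norm (a + b) * norm (fst u)"
    by (metis norm_mult norm_triangle_ineq4)
  also have "\<dots> \<le> norm u + 2 * R * norm u"
    by (intro add_mono s mult_mono ab f) (use R in auto)
  finally have 1: "norm (snd u - (a + b) * fst u) \<le> norm u + 2 * R * norm u" .
  have "norm (quasi_field a u - quasi_field b u) \<le>
      norm (a - b) * norm (fst u) + norm (a - b) * norm (snd u - (a + b) * fst u)"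
    unfolding eq using norm_Pair_le[of "- ((a - b) * fst u)" "(a - b) * (snd u - (a + b) * fst u)"]
    by (simp only: norm_minus_cancel norm_mult)
  also have "\<dots> \<le> norm (a - b) * norm u + norm (a - b) * (norm u + 2 * R * norm u)"
    by (intro add_mono mult_left_mono 1 f) auto
  finally show ?thesis by (simp add: algebra_simps)
qed

lemma quasi_sol_deriv:
  assumes "quasi_sol l a u" "t \<in> {0..l}"
  shows "((\<lambda>t. fst (u t)) has_vector_derivative slope a u t) (at t within {0..l})"
    and "((\<lambda>t. snd (u t)) has_vector_derivative a t * slope a u t) (at t within {0..l})"
proof -
  have "(u has_derivative (\<lambda>h. h *\<^sub>R quasi_field (a t) (u t))) (at t within {0..l})"
    using assms by (auto simp: quasi_sol_def has_vector_derivative_def)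
  from has_derivative_fst[OF this] has_derivative_snd[OF this]
  show "((\<lambda>t. fst (u t)) has_vector_derivative slope a u t) (at t within {0..l})"
    and "((\<lambda>t. snd (u t)) has_vector_derivative a t * slope a u t) (at t within {0..l})"
    by (simp_all add: has_vector_derivative_def quasi_field_def slope_def)
qed

lemma quasi_solI:
  assumes "\<And>t. t \<in> {0..l} \<Longrightarrow> ((\<lambda>t. fst (u t)) has_vector_derivative slope a u t) (at t within {0..l})"
    and "\<And>t. t \<in> {0..l} \<Longrightarrow> ((\<lambda>t. snd (u t)) has_vector_derivative a t * slope a u t) (at t within {0..l})"
  shows "quasi_sol l a u"
proof -
  have "((\<lambda>t. (fst (u t), snd (u t))) has_vector_derivative quasi_field (a t) (u t)) (at t within {0..l})"
    if "t \<in> {0..l}" for t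
    using has_vector_derivative_Pair[OF assms[OF that]]
    by (simp add: quasi_field_def slope_def)
  then show ?thesis by (simp add: quasi_sol_def)
qed

lemma quasi_sol_continuous:
  assumes "quasi_sol l a u"
  shows "continuous_on {0..l} u"
    and "continuous_on {0..l} (\<lambda>t. fst (u t))" "continuous_on {0..l} (\<lambda>t. snd (u t))"
    and "continuous_on {0..l} a \<Longrightarrow> continuous_on {0..l} (slope a u)"
proof -
  show u: "continuous_on {0..l} u"
    using assms has_vector_derivative_continuous
    unfolding quasi_sol_def continuous_on_eq_continuous_within by blast
  then show f: "continuous_on {0..l} (\<lambda>t. fst (u t))" and s: "continuous_on {0..l} (\<lambda>t. snd (u t))"
    by (auto intro: continuous_on_fst continuous_on_snd)
  show "continuous_on {0..l} (slope a u)" if "continuous_on {0..l} a"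
    unfolding slope_def by (intro continuous_intros f s that)
qed

lemma quasi_sol_subinterval:
  assumes "quasi_sol l a u" "T \<le> l"
  shows "quasi_sol T a u"
  using assms unfolding quasi_sol_def
  by (metis (full_types) atLeastAtMost_iff atLeastatMost_subset_iff
      has_vector_derivative_within_subset order.refl order_trans)

lemma quasi_sol_scale:
  assumes "quasi_sol l a u"
  shows "quasi_sol l a (\<lambda>t. (c * fst (u t), c * snd (u t)))"
proof (rule quasi_solI)
  fix t assume t: "t \<in> {0..l}"
  have eq: "slope a (\<lambda>t. (c * fst (u t), c * snd (u t))) t = c * slope a u t"
    by (simp add: slope_def algebra_simps)
  show "((\<lambda>t. fst (c * fst (u t), c * snd (u t))) has_vector_derivative
      slope a (\<lambda>t. (c * fst (u t), c * snd (u t))) t) (at t within {0..l})"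
    unfolding eq using quasi_sol_deriv(1)[OF assms t]
    by (simp add: has_vector_derivative_mult_right)
  show "((\<lambda>t. snd (c * fst (u t), c * snd (u t))) has_vector_derivative
      a t * slope a (\<lambda>t. (c * fst (u t), c * snd (u t))) t) (at t within {0..l})"
    unfolding eq using has_vector_derivative_mult_right[OF quasi_sol_deriv(2)[OF assms t], of c]
    by (simp add: mult.left_commute)
qed

lemma quasi_sol_cnj:
  assumes "quasi_sol l a u" "\<And>t. t \<in> {0..l} \<Longrightarrow> cnj (a t) = a t"
  shows "quasi_sol l a (\<lambda>t. (cnj (fst (u t)), cnj (snd (u t))))"
proof (rule quasi_solI)
  fix t assume t: "t \<in> {0..l}"
  have eq: "slope a (\<lambda>t. (cnj (fst (u t)), cnj (snd (u t)))) t = cnj (slope a u t)"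
    by (simp add: slope_def assms(2)[OF t])
  show "((\<lambda>t. fst (cnj (fst (u t)), cnj (snd (u t)))) has_vector_derivative
      slope a (\<lambda>t. (cnj (fst (u t)), cnj (snd (u t)))) t) (at t within {0..l})"
    unfolding eq using has_vector_derivative_cnj[OF quasi_sol_deriv(1)[OF assms(1) t]] by simp
  show "((\<lambda>t. snd (cnj (fst (u t)), cnj (snd (u t)))) has_vector_derivative
      a t * slope a (\<lambda>t. (cnj (fst (u t)), cnj (snd (u t)))) t) (at t within {0..l})"
    unfolding eq using has_vector_derivative_cnj[OF quasi_sol_deriv(2)[OF assms(1) t]]
    by (simp add: assms(2)[OF t])
qed

lemma continuous_on_interval_bounded:
  fixes f :: "real \<Rightarrow> 'a::real_normed_vector"
  assumes "continuous_on {a..b} f"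
  obtains R where "\<And>t. t \<in> {a..b} \<Longrightarrow> norm (f t) \<le> R"
  using compact_imp_bounded[OF compact_continuous_image[OF assms]]
  unfolding bounded_iff by (meson compact_Icc imageI)

lemma quasi_sol_exists:
  assumes "0 \<le> l" "continuous_on {0..l} a"
  shows "\<exists>u. u 0 = x \<and> quasi_sol l a u"
proof -
  obtain R where R: "\<And>t. t \<in> {0..l} \<Longrightarrow> norm (a t) \<le> R"
    using continuous_on_interval_bounded[OF assms(2)] by blast
  show ?thesis unfolding quasi_sol_def
  proof (rule linear_ode_exists[OF \<open>0 \<le> l\<close> linear_quasi_field])
    show "norm (quasi_field (a t) x) \<le> (1 + R)\<^sup>2 * norm x" if "t \<in> {0..l}" for t x
      by (rule norm_quasi_field) (rule R[OF that])
    show "continuous_on {0..l} (\<lambda>t. quasi_field (a t) (g t))" if "continuous_on {0..l} g" for g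
      unfolding quasi_field_def by (intro continuous_intros assms that)
  qed
qed

text \<open>The exponent is the rate 2 M + 1 of \<open>norm_growth\<close> over time l, where M = (1
  + R)^2 is the bound of \<open>quasi_field a\<close> for |a| <= R.\<close>

definition growth_bound :: "real \<Rightarrow> real \<Rightarrow> real" where
  "growth_bound l R = exp ((2 * (1 + R)\<^sup>2 + 1) * l)"

lemma growth_bound_mono: "t \<le> l \<Longrightarrow> exp ((2 * (1 + R)\<^sup>2 + 1) * t) \<le> growth_bound l R"
  unfolding growth_bound_def exp_le_cancel_iff by (rule mult_left_mono) simp_all

lemma quasi_sol_bound:
  assumes "quasi_sol l a u" "\<And>t. t \<in> {0..l} \<Longrightarrow> norm (a t) \<le> R" "t \<in> {0..l}"
  shows "norm (u t) \<le> norm (u 0) * growth_bound l R"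
proof -
  have "norm (u t) \<le> (norm (u 0) + 0) * exp ((2 * (1 + R)\<^sup>2 + 1) * (t - 0))"
    by (rule norm_growth[where w' = "\<lambda>t. quasi_field (a t) (u t)" and b = l])
      (use assms norm_quasi_field in \<open>auto simp: quasi_sol_def\<close>)
  also have "\<dots> \<le> norm (u 0) * growth_bound l R"
    using growth_bound_mono[of t l R] assms(3) by (auto intro!: mult_left_mono)
  finally show ?thesis .
qed

text \<open>The difference solves the system for \<open>a\<close> with the field difference at
  \<open>v\<close> as forcing, so only the supremum of |a - b| enters. Uniform convergence of
  profiles therefore suffices later on; their slopes need not converge.\<close>

lemma quasi_sol_stable:
  assumes u: "quasi_sol l a u" and v: "quasi_sol l b v" and init: "u 0 = v 0"
    and a: "\<And>t. t \<in> {0..l} \<Longrightarrow> norm (a t) \<le> R" and b: "\<And>t. t \<in> {0..l} \<Longrightarrow> norm (b t) \<le> R"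
    and d: "\<And>t. t \<in> {0..l} \<Longrightarrow> norm (a t - b t) \<le> d" and t: "t \<in> {0..l}"
  shows "norm (u t - v t) \<le> 2 * (1 + R) * (growth_bound l R)\<^sup>2 * norm (v 0) * d"
proof -
  define \<delta> where "\<delta> = 2 * (1 + R) * d * (norm (v 0) * growth_bound l R)"
  have R: "0 \<le> R" using a[OF t] norm_ge_zero order_trans by blast
  have d0: "0 \<le> d" using d[OF t] norm_ge_zero order_trans by blast
  have \<delta>: "0 \<le> \<delta>"
    using R d0 by (auto simp: \<delta>_def growth_bound_def)
  have "norm (u t - v t) \<le> (norm (u 0 - v 0) + \<delta>) * exp ((2 * (1 + R)\<^sup>2 + 1) * (t - 0))"
  proof (rule norm_growth[where w' = "\<lambda>t. quasi_field (a t) (u t) - quasi_field (b t) (v t)" and b = l])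
    show "((\<lambda>t. u t - v t) has_vector_derivative quasi_field (a s) (u s) - quasi_field (b s) (v s))
        (at s within {0..l})" if "s \<in> {0..l}" for s
      using u v that by (auto intro!: derivative_intros simp: quasi_sol_def)
    show "norm (quasi_field (a s) (u s) - quasi_field (b s) (v s))
        \<le> (1 + R)\<^sup>2 * norm (u s - v s) + \<delta>" if s: "s \<in> {0..l}" for s
    proof -
      have "quasi_field (a s) (u s) - quasi_field (b s) (v s) =
          quasi_field (a s) (u s - v s) + (quasi_field (a s) (v s) - quasi_field (b s) (v s))"
        by (simp add: linear_diff[OF linear_quasi_field])
      also have "norm \<dots> \<le> norm (quasi_field (a s) (u s - v s)) +
          norm (quasi_field (a s) (v s) - quasi_field (b s) (v s))"
        by (rule norm_triangle_ineq)
      also have "\<dots> \<le> (1 + R)\<^sup>2 * norm (u s - v s) + 2 * (1 + R) * norm (a s - b s) * norm (v s)"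
        by (intro add_mono norm_quasi_field norm_quasi_field_diff a b s)
      also have "2 * (1 + R) * norm (a s - b s) * norm (v s) \<le> \<delta>"
        unfolding \<delta>_def using R d0
        by (intro mult_mono quasi_sol_bound[OF v b s] d s) auto
      finally show ?thesis by simp
    qed
  qed (use t \<delta> in auto)
  also have "\<dots> \<le> \<delta> * growth_bound l R"
    using growth_bound_mono[of t l R] t init \<delta> by (auto intro!: mult_left_mono)
  finally show ?thesis
    by (simp add: \<delta>_def power2_eq_square mult_ac)
qed

lemma quasi_sol_unique:
  assumes "quasi_sol l a u" "quasi_sol l b v" "u 0 = v 0"
    and "continuous_on {0..l} a" "\<And>t. t \<in> {0..l} \<Longrightarrow> a t = b t" and "t \<in> {0..l}"
  shows "u t = v t"
proof -
  obtain R where R: "\<And>t. t \<in> {0..l} \<Longrightarrow> norm (a t) \<le> R"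
    using continuous_on_interval_bounded[OF assms(4)] by blast
  have "norm (u t - v t) \<le> 2 * (1 + R) * (growth_bound l R)\<^sup>2 * norm (v 0) * 0"
    by (rule quasi_sol_stable[OF assms(1-3) R]) (use assms R in auto)
  then show ?thesis by simp
qed

lemma quasi_sol_nonzero:
  assumes "quasi_sol l a u" "continuous_on {0..l} a" "t \<in> {0..l}" "u 0 \<noteq> 0"
  shows "u t \<noteq> 0" and "fst (u t) = 0 \<Longrightarrow> slope a u t \<noteq> 0"
proof -
  obtain R where R: "\<And>t. t \<in> {0..l} \<Longrightarrow> norm (a t) \<le> R"
    using continuous_on_interval_bounded[OF assms(2)] by blast
  show "u t \<noteq> 0"
  proof
    assume "u t = 0"
    then have "u 0 = 0"
      using norm_decay[of 0 l u "\<lambda>t. quasi_field (a t) (u t)" "(1 + R)\<^sup>2" 0 t] assms norm_quasi_field[OF R]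
      by (auto simp: quasi_sol_def)
    with assms show False by simp
  qed
  then show "slope a u t \<noteq> 0" if "fst (u t) = 0"
    using that by (auto simp: slope_def prod_eq_iff)
qed

section \<open>Stieltjes integrals by parts and the flux identity\<close>

text \<open>The left side is the integral of w against dN after integration by parts. The second
  mean value theorem for w' with the monotone weight N reduces it to a single value of w, so no
  Stieltjes integral has to be defined.\<close>

lemma stieltjes_mean_value:
  fixes N w w' :: "real \<Rightarrow> real"
  assumes "a \<le> b" and N: "mono_on {a..b} N"
    and w: "\<And>t. t \<in> {a..b} \<Longrightarrow> (w has_vector_derivative w' t) (at t within {a..b})"
    and w': "continuous_on {a..b} w'"
  obtains c where "c \<in> {a..b}"
    "N b * w b - N a * w a - integral {a..b} (\<lambda>t. N t * w' t) = (N b - N a) * w c"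
proof -
  have int: "integral {x..y} w' = w y - w x" if "a \<le> x" "x \<le> y" "y \<le> b" for x y
    by (rule integral_unique, rule fundamental_theorem_of_calculus)
      (use that in \<open>auto intro: has_vector_derivative_within_subset[OF w]\<close>)
  obtain c where c: "c \<in> {a..b}"
      "integral {a..b} (\<lambda>t. N t * w' t) = N a * integral {a..c} w' + N b * integral {c..b} w'"
    by (rule second_mean_value_theorem[OF integrable_continuous_real[OF w'] \<open>a \<le> b\<close>, of N])
      (use N in \<open>auto simp: mono_on_def\<close>)
  show ?thesis
    by (rule that[OF c(1)]) (use c int in \<open>simp add: algebra_simps\<close>)
qed

lemma has_vector_derivative_norm_square:
  fixes E :: "real \<Rightarrow> complex"
  assumes "(E has_vector_derivative D) (at t within S)"
  shows "((\<lambda>t. (cmod (E t))\<^sup>2) has_vector_derivative 2 * Re (D * cnj (E t))) (at t within S)"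
proof -
  have "(\<lambda>t. (cmod (E t))\<^sup>2) = (\<lambda>t. E t \<bullet> E t)"
    by (simp add: power2_norm_eq_inner)
  moreover have "((\<lambda>t. E t \<bullet> E t) has_vector_derivative 2 * Re (D * cnj (E t))) (at t within S)"
    using assms unfolding has_vector_derivative_def
    by (auto intro!: derivative_eq_intros simp: inner_complex_def algebra_simps)
  ultimately show ?thesis by simp
qed

text \<open>With a density eps this is the integral of (E' cnj E)' = |E'|^2 - k eps |E|^2. As E'
  need not be differentiable, the product Q cnj E is differentiated instead, and the integral of
  |E|^2 against dG is expressed by its mean value at \<open>c\<close>.\<close>

lemma quasi_sol_flux:
  fixes G :: "real \<Rightarrow> real"
  assumes u: "quasi_sol l (\<lambda>t. k * of_real (G t)) u"
    and G: "continuous_on {0..l} G" "mono_on {0..l} G"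
    and st: "0 \<le> s" "s \<le> t" "t \<le> l"
  obtains c where "c \<in> {s..t}"
    "slope (\<lambda>t. k * of_real (G t)) u t * cnj (fst (u t))
       - slope (\<lambda>t. k * of_real (G t)) u s * cnj (fst (u s))
     = of_real (integral {s..t} (\<lambda>r. (cmod (slope (\<lambda>t. k * of_real (G t)) u r))\<^sup>2))
       - k * of_real ((G t - G s) * (cmod (fst (u c)))\<^sup>2)"
proof -
  define D where "D = slope (\<lambda>t. k * of_real (G t)) u"
  define E where "E = (\<lambda>t. fst (u t))"
  define w' where "w' = (\<lambda>t. 2 * Re (D t * cnj (E t)))"
  have sq: "(complex_of_real (cmod z))\<^sup>2 = z * cnj z" for z
    by (metis complex_norm_square of_real_power)
  have sub: "{s..t} \<subseteq> {0..l}" using st by auto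
  have contG: "continuous_on {s..t} G" using G(1) sub continuous_on_subset by blast
  have contD: "continuous_on {s..t} D" unfolding D_def
    by (rule continuous_on_subset[OF quasi_sol_continuous(4)[OF u] sub]) (intro continuous_intros G)
  have contE: "continuous_on {s..t} E" unfolding E_def
    by (rule continuous_on_subset[OF quasi_sol_continuous(2)[OF u] sub])
  have dE: "(E has_vector_derivative D r) (at r within {s..t})" if "r \<in> {s..t}" for r
    unfolding E_def D_def
    by (rule has_vector_derivative_within_subset[OF quasi_sol_deriv(1)[OF u] sub]) (use that sub in auto)
  have dQ: "((\<lambda>t. snd (u t)) has_vector_derivative k * of_real (G r) * D r) (at r within {s..t})"
    if "r \<in> {s..t}" for r
    unfolding D_def
    by (rule has_vector_derivative_within_subset[OF quasi_sol_deriv(2)[OF u] sub]) (use that sub in auto)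
  have Q: "snd (u r) = D r + k * of_real (G r) * E r" for r
    by (simp add: D_def E_def slope_def)
  have contw': "continuous_on {s..t} w'"
    unfolding w'_def by (intro continuous_intros contD contE)
  obtain c where c: "c \<in> {s..t}" "G t * (cmod (E t))\<^sup>2 - G s * (cmod (E s))\<^sup>2
      - integral {s..t} (\<lambda>r. G r * w' r) = (G t - G s) * (cmod (E c))\<^sup>2"
  proof (rule stieltjes_mean_value[of s t G "\<lambda>r. (cmod (E r))\<^sup>2" w'])
    show "mono_on {s..t} G" using G(2) sub mono_on_subset by blast
    show "((\<lambda>r. (cmod (E r))\<^sup>2) has_vector_derivative w' r) (at r within {s..t})" if "r \<in> {s..t}" for r
      unfolding w'_def by (rule has_vector_derivative_norm_square[OF dE[OF that]])
  qed (use st contw' in auto)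
  have "((\<lambda>r. of_real ((cmod (D r))\<^sup>2) + k * of_real (G r * w' r)) has_integral
      snd (u t) * cnj (E t) - snd (u s) * cnj (E s)) {s..t}"
  proof (rule fundamental_theorem_of_calculus[OF \<open>s \<le> t\<close>])
    fix r assume r: "r \<in> {s..t}"
    have eq: "complex_of_real ((cmod (D r))\<^sup>2) + k * of_real (G r * w' r) =
       snd (u r) * cnj (D r) + k * of_real (G r) * D r * cnj (E r)"
    proof -
      have "complex_of_real (w' r) = D r * cnj (E r) + cnj (D r) * E r"
        unfolding w'_def by (simp add: complex_eq_iff)
      then show ?thesis
        unfolding Q by (simp add: sq algebra_simps)
    qed
    show "((\<lambda>t. snd (u t) * cnj (E t)) has_vector_derivative
        of_real ((cmod (D r))\<^sup>2) + k * of_real (G r * w' r)) (at r within {s..t})"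
      unfolding eq by (intro has_vector_derivative_mult dQ r has_vector_derivative_cnj dE)
  qed
  moreover have "((\<lambda>r. of_real ((cmod (D r))\<^sup>2) + k * of_real (G r * w' r)) has_integral
      of_real (integral {s..t} (\<lambda>r. (cmod (D r))\<^sup>2)) + k * of_real (integral {s..t} (\<lambda>r. G r * w' r))) {s..t}"
    by (intro has_integral_add has_integral_mult_right has_integral_of_real integrable_integral
        integrable_continuous_real continuous_intros contD contG contw')
  ultimately have "snd (u t) * cnj (E t) - snd (u s) * cnj (E s) =
      of_real (integral {s..t} (\<lambda>r. (cmod (D r))\<^sup>2)) + k * of_real (integral {s..t} (\<lambda>r. G r * w' r))"
    by (rule has_integral_unique)
  also have "integral {s..t} (\<lambda>r. G r * w' r) =
      G t * (cmod (E t))\<^sup>2 - G s * (cmod (E s))\<^sup>2 - (G t - G s) * (cmod (E c))\<^sup>2"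
    using c(2) by simp
  finally have "D t * cnj (E t) - D s * cnj (E s) =
      of_real (integral {s..t} (\<lambda>r. (cmod (D r))\<^sup>2)) - k * of_real ((G t - G s) * (cmod (E c))\<^sup>2)"
    unfolding Q by (simp add: sq algebra_simps)
  with c(1) show ?thesis
    by (intro that) (auto simp: D_def E_def)
qed

section \<open>Profiles of cavities\<close>

abbreviation coef :: "complex \<Rightarrow> (real \<Rightarrow> real) \<Rightarrow> real \<Rightarrow> complex" where
  "coef k G \<equiv> \<lambda>t. k * of_real (G t)"

lemma nonzero_near_simple_zero:
  fixes f :: "real \<Rightarrow> 'a::real_normed_vector"
  assumes "(f has_vector_derivative d) (at t within S)" "f t = 0" "d \<noteq> 0"
  shows "\<exists>\<delta>>0. \<forall>s\<in>S. 0 < \<bar>s - t\<bar> \<and> \<bar>s - t\<bar> < \<delta> \<longrightarrow> f s \<noteq> 0"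
proof -
  obtain \<delta> where \<delta>: "\<delta> > 0"
    "\<And>s. s \<in> S \<Longrightarrow> norm (s - t) < \<delta> \<Longrightarrow> norm (f s - f t - (s - t) *\<^sub>R d) \<le> norm d / 2 * norm (s - t)"
    using assms(1,3) unfolding has_vector_derivative_def has_derivative_within_alt
    by (metis half_gt_zero zero_less_norm_iff)
  have "f s \<noteq> 0" if "s \<in> S" "0 < \<bar>s - t\<bar>" "\<bar>s - t\<bar> < \<delta>" for s
  proof
    assume "f s = 0"
    then have "norm ((s - t) *\<^sub>R d) \<le> norm d / 2 * \<bar>s - t\<bar>"
      using \<delta>(2)[of s] that assms(2) by (simp only: norm_minus_cancel diff_0 diff_self real_norm_def)
    then have "norm d * \<bar>s - t\<bar> \<le> norm d * \<bar>s - t\<bar> / 2"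
      by (simp only: norm_scaleR real_norm_def mult.commute times_divide_eq_left times_divide_eq_right)
    moreover have "0 < norm d * \<bar>s - t\<bar>" using that assms(3) by simp
    ultimately show False by linarith
  qed
  with \<delta>(1) show ?thesis by blast
qed

lemma sgn_after_simple_zero:
  fixes f :: "real \<Rightarrow> real"
  assumes "(f has_vector_derivative d) (at t within S)" "f t = 0" "d \<noteq> 0"
  shows "\<exists>\<delta>>0. \<forall>s\<in>S. t < s \<and> s < t + \<delta> \<longrightarrow> sgn (f s) = sgn d"
proof -
  obtain \<delta> where \<delta>: "\<delta> > 0"
    "\<And>s. s \<in> S \<Longrightarrow> norm (s - t) < \<delta> \<Longrightarrow> norm (f s - f t - (s - t) *\<^sub>R d) \<le> norm d / 2 * norm (s - t)"
    using assms(1,3) unfolding has_vector_derivative_def has_derivative_within_alt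
    by (metis half_gt_zero zero_less_norm_iff)
  have "sgn (f s) = sgn d" if "s \<in> S" "t < s" "s < t + \<delta>" for s
  proof -
    have *: "\<bar>f s - (s - t) * d\<bar> \<le> \<bar>d\<bar> / 2 * (s - t)"
      using \<delta>(2)[of s] that assms(2) by auto
    define P where "P = (s - t) * d"
    have P: "\<bar>f s - P\<bar> \<le> \<bar>P\<bar> / 2" "sgn P = sgn d" "P \<noteq> 0"
      using * that assms(3) by (auto simp: P_def abs_mult sgn_mult mult.commute)
    then have "sgn (f s) = sgn P"
      by (auto simp: sgn_if abs_if split: if_splits)
    with P show ?thesis by simp
  qed
  with \<delta>(1) show ?thesis by blast
qed

lemma finite_isolated_zeros:
  fixes f :: "real \<Rightarrow> 'a::real_normed_vector"
  assumes cont: "continuous_on {a..b} f"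
    and isol: "\<And>t. t \<in> {a..b} \<Longrightarrow> f t = 0 \<Longrightarrow>
      \<exists>\<delta>>0. \<forall>s\<in>{a..b}. 0 < \<bar>s - t\<bar> \<and> \<bar>s - t\<bar> < \<delta> \<longrightarrow> f s \<noteq> 0"
  shows "finite {t \<in> {a..b}. f t = 0}"
proof (rule ccontr)
  assume "infinite {t \<in> {a..b}. f t = 0}"
  then obtain x where x: "x \<in> {a..b}" "x islimpt {t \<in> {a..b}. f t = 0}"
    using compact_eq_Bolzano_Weierstrass[of "{a..b}"] compact_Icc by blast
  have "closed {t \<in> {a..b}. f t = 0}"
    by (rule continuous_closed_preimage_constant[OF cont]) simp
  then have "x \<in> {t \<in> {a..b}. f t = 0}"
    using x(2) unfolding closed_limpt by blast
  then have "f x = 0" by simp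
  then obtain \<delta> where "\<delta> > 0" "\<forall>s\<in>{a..b}. 0 < \<bar>s - x\<bar> \<and> \<bar>s - x\<bar> < \<delta> \<longrightarrow> f s \<noteq> 0"
    using isol[OF x(1)] by blast
  with x(2) show False
    unfolding islimpt_approachable dist_real_def by fastforce
qed

text \<open>The sign of \<open>Im (E\<^sup>2)\<close> immediately after a point where a rotating solution has the value \<open>p\<close> and
  the derivative \<open>d\<close>.\<close>

definition exit_sign :: "complex \<Rightarrow> complex \<Rightarrow> complex \<Rightarrow> real" where
  "exit_sign k p d =
     (if p \<noteq> 0 then if Im (p\<^sup>2) \<noteq> 0 then sgn (Im (p\<^sup>2)) else sgn (Im (p * d))
      else if Im (d\<^sup>2) \<noteq> 0 then sgn (Im (d\<^sup>2)) else sgn (- Im k) * sgn (Re (d\<^sup>2)))"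

locale cavity_range =
  fixes l e1 e2 :: real
  assumes l: "0 < l" and e1: "1 \<le> e1" and e12: "e1 < e2"
begin

text \<open>Difference quotients in place of densities: this form survives pointwise limits and
  convex sums. Nothing is said off \<open>{0..l}\<close>, so later equalities of profiles hold on
  that interval only.\<close>

definition profiles :: "(real \<Rightarrow> real) set" where
  "profiles = {G. G 0 = 0 \<and> (\<forall>s t. 0 \<le> s \<longrightarrow> s \<le> t \<longrightarrow> t \<le> l \<longrightarrow>
     e1 * (t - s) \<le> G t - G s \<and> G t - G s \<le> e2 * (t - s))}"

lemma profilesI:
  assumes "G 0 = 0"
    and "\<And>s t. 0 \<le> s \<Longrightarrow> s \<le> t \<Longrightarrow> t \<le> l \<Longrightarrow> e1 * (t - s) \<le> G t - G s \<and> G t - G s \<le> e2 * (t - s)"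
  shows "G \<in> profiles"
  using assms by (auto simp: profiles_def)

lemma profile_0: "G \<in> profiles \<Longrightarrow> G 0 = 0"
  by (simp add: profiles_def)

lemma profile_slope:
  assumes "G \<in> profiles" "0 \<le> s" "s \<le> t" "t \<le> l"
  shows "e1 * (t - s) \<le> G t - G s" "G t - G s \<le> e2 * (t - s)"
  using assms by (auto simp: profiles_def)

lemma profile_lipschitz:
  assumes "G \<in> profiles" "s \<in> {0..l}" "t \<in> {0..l}"
  shows "\<bar>G t - G s\<bar> \<le> e2 * \<bar>t - s\<bar>"
proof -
  have *: "\<bar>G t - G s\<bar> \<le> e2 * \<bar>t - s\<bar>" if "0 \<le> s" "s \<le> t" "t \<le> l" for s t
  proof -
    have "0 \<le> e1 * (t - s)" using e1 that by simp
    then show ?thesis using profile_slope[OF assms(1) that] that by auto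
  qed
  show ?thesis
    using *[of s t] *[of t s] assms(2,3) by (cases "s \<le> t") (auto simp: abs_minus_commute)
qed

lemma profile_continuous: "G \<in> profiles \<Longrightarrow> continuous_on {0..l} G"
  unfolding continuous_on_iff dist_real_def
proof (intro ballI allI impI)
  fix x e :: real assume G: "G \<in> profiles" and x: "x \<in> {0..l}" and e: "0 < e"
  show "\<exists>d>0. \<forall>x'\<in>{0..l}. \<bar>x' - x\<bar> < d \<longrightarrow> \<bar>G x' - G x\<bar> < e"
  proof (intro exI[of _ "e / e2"] conjI ballI impI)
    fix x' assume "x' \<in> {0..l}" "\<bar>x' - x\<bar> < e / e2"
    then show "\<bar>G x' - G x\<bar> < e"
      using profile_lipschitz[OF G x, of x'] e1 e12
      by (auto simp: field_simps)
  qed (use e e1 e12 in auto)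
qed

lemma profile_coef_continuous: "G \<in> profiles \<Longrightarrow> continuous_on {0..l} (coef k G)"
  by (intro continuous_intros profile_continuous)

lemma profile_strict:
  assumes "G \<in> profiles" "0 \<le> s" "s < t" "t \<le> l"
  shows "G s < G t"
proof -
  have "0 < e1 * (t - s)" using e1 assms by simp
  then show ?thesis using profile_slope(1)[of G s t] assms by auto
qed

lemma profile_mono: "G \<in> profiles \<Longrightarrow> mono_on {0..l} G"
  by (rule mono_onI) (metis atLeastAtMost_iff order_le_less profile_strict)

lemma profile_bound:
  assumes "G \<in> profiles" "t \<in> {0..l}"
  shows "0 \<le> G t" "G t \<le> e2 * l"
proof -
  have "0 \<le> e1 * t" using e1 assms by simp
  then show "0 \<le> G t" using profile_slope(1)[of G 0 t] assms profile_0[of G] by auto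
  have "e2 * t \<le> e2 * l" using e1 e12 assms by simp
  then show "G t \<le> e2 * l" using profile_slope(2)[of G 0 t] assms profile_0[of G] by auto
qed

lemma profile_coef_bound:
  assumes "G \<in> profiles" "t \<in> {0..l}" "norm k \<le> K"
  shows "norm (coef k G t) \<le> K * (e2 * l)"
proof -
  have "norm (coef k G t) = norm k * G t"
    using profile_bound(1)[OF assms(1,2)] by (simp add: norm_mult)
  also have "\<dots> \<le> K * (e2 * l)"
    using assms(3) norm_ge_zero[of k] profile_bound[OF assms(1,2)] by (intro mult_mono) linarith+
  finally show ?thesis .
qed

lemma profile_linear: "e1 \<le> e \<Longrightarrow> e \<le> e2 \<Longrightarrow> (\<lambda>t. e * t) \<in> profiles"
  by (rule profilesI) (auto simp: mult_right_mono simp flip: right_diff_distrib)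

lemma profile_convex_sum:
  assumes G: "\<And>i. i \<in> I \<Longrightarrow> G i \<in> profiles" and c: "\<And>i. i \<in> I \<Longrightarrow> 0 \<le> c i" "sum c I = 1"
  shows "(\<lambda>t. \<Sum>i\<in>I. c i * G i t) \<in> profiles"
proof (rule profilesI)
  show "(\<Sum>i\<in>I. c i * G i 0) = 0" by (simp add: G profile_0)
  fix s t assume st: "0 \<le> s" "s \<le> t" "t \<le> l"
  have eq: "(\<Sum>i\<in>I. c i * G i t) - (\<Sum>i\<in>I. c i * G i s) = (\<Sum>i\<in>I. c i * (G i t - G i s))"
    by (simp add: sum_subtractf right_diff_distrib)
  have const: "(\<Sum>i\<in>I. c i * x) = x" for x
    by (simp add: c flip: sum_distrib_right)
  have "(\<Sum>i\<in>I. c i * (e1 * (t - s))) \<le> (\<Sum>i\<in>I. c i * (G i t - G i s))"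
    "(\<Sum>i\<in>I. c i * (G i t - G i s)) \<le> (\<Sum>i\<in>I. c i * (e2 * (t - s)))"
    by (auto intro!: sum_mono mult_left_mono c profile_slope[OF G] st)
  then show "e1 * (t - s) \<le> (\<Sum>i\<in>I. c i * G i t) - (\<Sum>i\<in>I. c i * G i s) \<and>
      (\<Sum>i\<in>I. c i * G i t) - (\<Sum>i\<in>I. c i * G i s) \<le> e2 * (t - s)"
    unfolding eq const by simp
qed

lemma profile_limit:
  assumes G: "\<And>n. G n \<in> profiles" and lim: "\<And>t. t \<in> {0..l} \<Longrightarrow> (\<lambda>n. G n t) \<longlonglongrightarrow> g t"
  shows "g \<in> profiles"
proof (rule profilesI)
  have "(\<lambda>n. G n 0) \<longlonglongrightarrow> g 0" by (rule lim) (use l in simp)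
  then show "g 0 = 0" by (simp add: profile_0[OF G] LIMSEQ_const_iff)
  fix s t assume st: "0 \<le> s" "s \<le> t" "t \<le> l"
  have "(\<lambda>n. G n t - G n s) \<longlonglongrightarrow> g t - g s"
    by (intro tendsto_diff lim) (use st in auto)
  then show "e1 * (t - s) \<le> g t - g s \<and> g t - g s \<le> e2 * (t - s)"
    using profile_slope[OF G st] by (auto intro: LIMSEQ_le_const LIMSEQ_le_const2)
qed

lemma profile_compact:
  assumes G: "\<And>n::nat. G n \<in> profiles"
  obtains g r where "g \<in> profiles" "strict_mono (r :: nat \<Rightarrow> nat)"
    "uniform_limit {0..l} (\<lambda>n. G (r n)) g sequentially"
proof (rule Arzela_Ascoli[of "{0..l}" G "e2 * l"])
  show "norm (G n x) \<le> e2 * l" if "x \<in> {0..l}" for n x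
    using profile_bound[OF G that] by simp
  show "\<exists>d>0. \<forall>n y. y \<in> {0..l} \<and> norm (x - y) < d \<longrightarrow> norm (G n x - G n y) < e"
    if "x \<in> {0..l}" "0 < e" for x e
  proof (intro exI[of _ "e / e2"] conjI allI impI)
    fix n y assume "y \<in> {0..l} \<and> norm (x - y) < e / e2"
    then show "norm (G n x - G n y) < e"
      using profile_lipschitz[OF G, of y x n] that e1 e12
      by (auto simp: field_simps)
  qed (use that e1 e12 in auto)
next
  fix g and r :: "nat \<Rightarrow> nat"
  assume r: "strict_mono r"
    and "\<And>e. 0 < e \<Longrightarrow> \<exists>N. \<forall>n x. N \<le> n \<and> x \<in> {0..l} \<longrightarrow> norm (G (r n) x - g x) < e"
  then have u: "uniform_limit {0..l} (\<lambda>n. G (r n)) g sequentially"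
    unfolding uniform_limit_sequentially_iff dist_norm by blast
  moreover have "g \<in> profiles"
    by (rule profile_limit[of "\<lambda>n. G (r n)"]) (use G tendsto_uniform_limitI[OF u] in auto)
  ultimately show thesis using r that by blast
qed simp

lemma quasi_sol_profile_stable:
  assumes G: "G \<in> profiles" "H \<in> profiles" and K: "norm k \<le> K" "norm m \<le> K"
    and u: "quasi_sol l (coef k G) u" "quasi_sol l (coef m H) v" "u 0 = v 0"
    and d: "\<And>t. t \<in> {0..l} \<Longrightarrow> norm (coef k G t - coef m H t) \<le> d" and t: "t \<in> {0..l}"
  shows "norm (u t - v t) \<le> 2 * (1 + K * (e2 * l)) * (growth_bound l (K * (e2 * l)))\<^sup>2 * norm (v 0) * d"
  by (rule quasi_sol_stable[OF u profile_coef_bound[OF G(1) _ K(1)] profile_coef_bound[OF G(2) _ K(2)] d t])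

lemma coef_uniform_limit:
  assumes G: "\<And>n. G n \<in> profiles" "g \<in> profiles"
    and lim: "uniform_limit {0..l} G g sequentially" "k \<longlonglongrightarrow> m"
  shows "uniform_limit {0..l} (\<lambda>n. coef (k n) (G n)) (coef m g) sequentially"
proof (rule uniform_lim_mult)
  show "uniform_limit {0..l} (\<lambda>n t. k n) (\<lambda>t. m) sequentially"
    using lim(2) by (simp add: uniform_limit_iff tendsto_iff eventually_mono)
  show "uniform_limit {0..l} (\<lambda>n t. complex_of_real (G n t)) (\<lambda>t. complex_of_real (g t)) sequentially"
    using lim(1) by (simp add: uniform_limit_iff dist_norm flip: of_real_diff)
  show "bounded ((\<lambda>t. m) ` {0..l})" by (simp add: image_constant_conv)
  show "bounded ((\<lambda>t. complex_of_real (g t)) ` {0..l})"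
    by (intro compact_imp_bounded compact_continuous_image continuous_intros profile_continuous G) simp
qed

lemma quasi_sol_tendsto:
  assumes G: "\<And>n. G n \<in> profiles" "g \<in> profiles"
    and lim: "uniform_limit {0..l} G g sequentially" "k \<longlonglongrightarrow> m"
    and u: "\<And>n. quasi_sol l (coef (k n) (G n)) (u n)" "quasi_sol l (coef m g) v"
      "\<And>n. u n 0 = v 0"
    and t: "t \<in> {0..l}"
  shows "(\<lambda>n. u n t) \<longlonglongrightarrow> v t" and "(\<lambda>n. slope (coef (k n) (G n)) (u n) t) \<longlonglongrightarrow> slope (coef m g) v t"
proof -
  obtain K where K: "\<And>n. norm (k n) \<le> K" "norm m \<le> K"
  proof -
    have "Bseq k" using lim(2) convergentI convergent_imp_Bseq by blast
    then obtain K where "\<And>n. norm (k n) \<le> K" unfolding Bseq_def by blast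
    then show ?thesis
      by (intro that[of "max K (norm m)"]) (auto simp: le_max_iff_disj)
  qed
  define C where "C = 2 * (1 + K * (e2 * l)) * (growth_bound l (K * (e2 * l)))\<^sup>2 * norm (v 0)"
  show ut: "(\<lambda>n. u n t) \<longlonglongrightarrow> v t"
  proof (rule LIMSEQ_I)
    fix e :: real assume "0 < e"
    define d where "d = e / (\<bar>C\<bar> + 1)"
    have d: "d > 0" using \<open>0 < e\<close> by (simp add: d_def)
    have "C * d \<le> \<bar>C\<bar> * d" using d by (intro mult_right_mono) auto
    also have "\<dots> < e" using \<open>0 < e\<close> by (simp add: d_def field_simps)
    finally have Cd: "C * d < e" .
    obtain N where N: "\<And>n s. n \<ge> N \<Longrightarrow> s \<in> {0..l} \<Longrightarrow> norm (coef (k n) (G n) s - coef m g s) < d"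
      using coef_uniform_limit[OF G lim] d unfolding uniform_limit_sequentially_iff dist_norm by blast
    have "norm (u n t - v t) < e" if "n \<ge> N" for n
    proof -
      have "norm (u n t - v t) \<le> C * d" unfolding C_def
        by (rule quasi_sol_profile_stable[OF G(1) G(2) K(1) K(2) u(1) u(2) u(3) _ t])
          (use N[OF that] in \<open>simp add: less_imp_le\<close>)
      with Cd show ?thesis by simp
    qed
    then show "\<exists>N. \<forall>n\<ge>N. norm (u n t - v t) < e" by blast
  qed
  show "(\<lambda>n. slope (coef (k n) (G n)) (u n) t) \<longlonglongrightarrow> slope (coef m g) v t"
    unfolding slope_def
    by (intro tendsto_intros tendsto_fst tendsto_snd ut lim(2) tendsto_uniform_limitI[OF lim(1) t])
qed

lemma profile_flux:
  assumes "G \<in> profiles" "quasi_sol l (coef k G) u" "0 \<le> s" "s \<le> t" "t \<le> l"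
  obtains c where "c \<in> {s..t}"
    "slope (coef k G) u t * cnj (fst (u t)) - slope (coef k G) u s * cnj (fst (u s))
     = of_real (integral {s..t} (\<lambda>r. (cmod (slope (coef k G) u r))\<^sup>2))
       - k * of_real ((G t - G s) * (cmod (fst (u c)))\<^sup>2)"
  using quasi_sol_flux[OF assms(2) profile_continuous[OF assms(1)] profile_mono[OF assms(1)] assms(3-5)]
  by blast

lemma slope_0: "G \<in> profiles \<Longrightarrow> slope (coef k G) u 0 = snd (u 0)"
  by (simp add: slope_def profile_0)

section \<open>Rotation of solutions and sign changes of the switching quantity\<close>

lemma nonzero_near_0:
  assumes G: "G \<in> profiles" and u: "quasi_sol l (coef k G) u" "u 0 = (0, q)" "q \<noteq> 0"
  obtains \<delta> where "0 < \<delta>" "\<delta> \<le> l" "\<And>s. 0 < s \<Longrightarrow> s < \<delta> \<Longrightarrow> fst (u s) \<noteq> 0"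
proof -
  have "\<exists>\<delta>>0. \<forall>s\<in>{0..l}. 0 < \<bar>s - 0\<bar> \<and> \<bar>s - 0\<bar> < \<delta> \<longrightarrow> fst (u s) \<noteq> 0"
    by (rule nonzero_near_simple_zero[OF quasi_sol_deriv(1)[OF u(1)]])
      (use u l slope_0[OF G] in auto)
  then obtain \<delta> where \<delta>: "\<delta> > 0" "\<And>s. s \<in> {0..l} \<Longrightarrow> 0 < \<bar>s\<bar> \<Longrightarrow> \<bar>s\<bar> < \<delta> \<Longrightarrow> fst (u s) \<noteq> 0"
    by auto
  show ?thesis
    by (rule that[of "min \<delta> l"]) (use \<delta> l in auto)
qed

text \<open>For nonreal \<open>k\<close> the solution rotates around the origin strictly monotonically.\<close>

lemma rotation:
  assumes G: "G \<in> profiles" and u: "quasi_sol l (coef k G) u" "u 0 = (0, q)" "q \<noteq> 0"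
    and k: "Im k \<noteq> 0" and t: "0 < t" "t \<le> l"
  shows "0 < - Im k * Im (slope (coef k G) u t * cnj (fst (u t)))"
proof -
  \<comment> \<open>Up to the factor - Im k this is |E|^2 times the angular velocity of E. The
    imaginary part of the flux identity gives it increments with the factor (Im k)^2, hence of one
    sign.\<close>
  define S where "S = (\<lambda>t. - Im k * Im (slope (coef k G) u t * cnj (fst (u t))))"
  have inc: "\<exists>c\<in>{s..t}. S t - S s = (Im k)\<^sup>2 * (G t - G s) * (cmod (fst (u c)))\<^sup>2"
    if st: "0 \<le> s" "s \<le> t" "t \<le> l" for s t
  proof -
    obtain c where c: "c \<in> {s..t}"
      and eq: "slope (coef k G) u t * cnj (fst (u t)) - slope (coef k G) u s * cnj (fst (u s))
        = of_real (integral {s..t} (\<lambda>r. (cmod (slope (coef k G) u r))\<^sup>2))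
       - k * of_real ((G t - G s) * (cmod (fst (u c)))\<^sup>2)"
      by (rule profile_flux[OF G u(1) st])
    have im: "Im (k * of_real x) = Im k * x" for x by simp
    have "Im (slope (coef k G) u t * cnj (fst (u t))) - Im (slope (coef k G) u s * cnj (fst (u s)))
        = - Im k * ((G t - G s) * (cmod (fst (u c)))\<^sup>2)"
      using arg_cong[OF eq, of Im]
      by (simp only: minus_complex.sel Im_complex_of_real im diff_0 mult_minus_left)
    then have "S t - S s = (Im k)\<^sup>2 * (G t - G s) * (cmod (fst (u c)))\<^sup>2"
      unfolding S_def by (simp only: right_diff_distrib[symmetric]) (simp add: power2_eq_square)
    with c show ?thesis by blast
  qed
  have mono: "S s \<le> S t" if st: "0 \<le> s" "s \<le> t" "t \<le> l" for s t
  proof -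
    have "G s \<le> G t" using profile_mono[OF G] st by (auto simp: mono_on_def)
    then have "0 \<le> (Im k)\<^sup>2 * (G t - G s) * (cmod (fst (u c)))\<^sup>2" for c by simp
    then show ?thesis using inc[OF st] by (metis diff_ge_0_iff_ge)
  qed
  obtain \<delta> where \<delta>: "0 < \<delta>" "\<delta> \<le> l" "\<And>s. 0 < s \<Longrightarrow> s < \<delta> \<Longrightarrow> fst (u s) \<noteq> 0"
    using nonzero_near_0[OF G u] by blast
  \<comment> \<open>On \<open>{r/2..r}\<close> the solution has no zero, so wherever the mean value
    point falls, the increment of \<open>S\<close> is strictly positive.\<close>
  define r where "r = min \<delta> t / 2"
  have r: "0 < r" "r < \<delta>" "r < t" using \<delta> t by (auto simp: r_def)
  obtain c where c: "c \<in> {r/2..r}" "S r - S (r/2) = (Im k)\<^sup>2 * (G r - G (r/2)) * (cmod (fst (u c)))\<^sup>2"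
    using inc[of "r/2" r] r \<delta> by auto
  have "fst (u c) \<noteq> 0" using \<delta>(3)[of c] c(1) r by auto
  moreover have "G (r/2) < G r" using profile_strict[OF G, of "r/2" r] r \<delta> by auto
  ultimately have "S (r/2) < S r" using c(2) k by (smt (verit) mult_pos_pos zero_less_norm_iff zero_less_power zero_less_power2)
  moreover have "S r \<le> S t" using mono[of r t] r t by auto
  moreover have "S 0 \<le> S (r/2)" using mono[of 0 "r/2"] r \<delta> by auto
  moreover have "S 0 = 0" by (simp add: S_def u)
  ultimately have "0 < S t" by linarith
  then show ?thesis by (simp only: S_def)
qed

lemma rotation_nonzero:
  assumes "G \<in> profiles" "quasi_sol l (coef k G) u" "u 0 = (0, q)" "q \<noteq> 0"
    and "Im k \<noteq> 0" "0 < t" "t \<le> l"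
  shows "fst (u t) \<noteq> 0"
  using rotation[OF assms] by auto

lemma Im_square_deriv:
  assumes u: "quasi_sol l a u" and t: "t \<in> {0..l}"
  shows "((\<lambda>t. Im ((fst (u t))\<^sup>2)) has_vector_derivative 2 * Im (fst (u t) * slope a u t)) (at t within {0..l})"
proof -
  note d = quasi_sol_deriv(1)[OF u t]
  have "((\<lambda>t. Im (fst (u t) * fst (u t))) has_vector_derivative
      Im (fst (u t) * slope a u t + slope a u t * fst (u t))) (at t within {0..l})"
    by (rule bounded_linear.has_vector_derivative[OF bounded_linear_Im has_vector_derivative_mult[OF d d]])
  then show ?thesis by (simp add: power2_eq_square mult.commute)
qed

text \<open>If E^2 and E E' were both real, then E' cnj E = (E E') cnj (E^2) / |E|^2 would be real,
  against \<open>rotation\<close>. Hence the zeros of Im (E^2) after 0 are simple.\<close>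

lemma Im_square_deriv_nonzero:
  assumes "G \<in> profiles" "quasi_sol l (coef k G) u" "u 0 = (0, q)" "q \<noteq> 0"
    and "Im k \<noteq> 0" "0 < t" "t \<le> l" and z: "Im ((fst (u t))\<^sup>2) = 0"
  shows "Im (fst (u t) * slope (coef k G) u t) \<noteq> 0"
proof
  define E where "E = fst (u t)"
  define D where "D = slope (coef k G) u t"
  assume "Im (fst (u t) * slope (coef k G) u t) = 0"
  then have i: "Im (E * D) = 0" by (simp only: E_def D_def)
  have E0: "E \<noteq> 0" unfolding E_def by (rule rotation_nonzero[OF assms(1-7)])
  have "D * cnj E = (E * D) * (cnj (E\<^sup>2)) / (cnj E * E)"
    using E0 by (simp add: field_simps power2_eq_square)
  moreover have "cnj (E\<^sup>2) = of_real (Re (E\<^sup>2))" "E * D = of_real (Re (E * D))"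
    using z i by (auto simp only: E_def complex_eq_iff complex_cnj Re_complex_of_real Im_complex_of_real minus_zero cnj.sel)
  moreover have "cnj E * E = of_real ((cmod E)\<^sup>2)"
    by (simp only: complex_norm_square mult.commute)
  ultimately have "D * cnj E = of_real (Re (E * D) * Re (E\<^sup>2) / (cmod E)\<^sup>2)"
    by (metis of_real_divide of_real_mult)
  then have "Im (D * cnj E) = 0" by (metis Im_complex_of_real)
  with rotation[OF assms(1-7)] show False by (simp only: D_def E_def mult_zero_right less_irrefl)
qed

lemma quotient_at_0:
  assumes G: "G \<in> profiles" and u: "quasi_sol l (coef k G) u" "u 0 = (0, q)"
  shows "((\<lambda>s. fst (u s) / of_real s) \<longlongrightarrow> q) (at_right 0)"
proof -
  have "((\<lambda>t. fst (u t)) has_vector_derivative q) (at 0 within {0..l})"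
    using quasi_sol_deriv(1)[OF u(1), of 0] l u slope_0[OF G] by auto
  then have "((\<lambda>t. fst (u t)) has_vector_derivative q) (at_right 0)"
    using l by (auto simp: has_vector_derivative_def has_derivative_within at_within_Icc_at_right)
  then have "((\<lambda>s. norm (fst (u s) - s *\<^sub>R q) / norm s) \<longlongrightarrow> 0) (at_right 0)"
    unfolding has_vector_derivative_def has_derivative_iff_norm using u by simp
  moreover have "\<forall>\<^sub>F s in at_right 0. norm (fst (u s) - s *\<^sub>R q) / norm s = norm (fst (u s) / of_real s - q)"
    using eventually_at_right_less[of 0]
  proof eventually_elim
    case (elim s)
    then have "fst (u s) / of_real s - q = (fst (u s) - s *\<^sub>R q) / of_real s"
      by (simp add: field_simps scaleR_conv_of_real)
    then show ?case by (simp add: norm_divide)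
  qed
  ultimately have "((\<lambda>s. norm (fst (u s) / of_real s - q)) \<longlongrightarrow> 0) (at_right 0)"
    by (rule Lim_transform_eventually)
  then show ?thesis
    unfolding tendsto_norm_zero_iff by (rule LIM_zero_cancel)
qed

text \<open>For real q^2 the leading term of Im (E^2) at 0 vanishes and the rotation decides.
  Writing E / q = x + i y, the ratio y / x starts at 0 and is strictly monotone, so y takes the sign
  of - Im k, and Im (E^2) = 2 x y Re (q^2).\<close>

lemma exit_sign_at_0_degenerate:
  assumes G: "G \<in> profiles" and u: "quasi_sol l (coef k G) u" "u 0 = (0, q)" "q \<noteq> 0"
    and k: "Im k \<noteq> 0" and q: "Im (q\<^sup>2) = 0"
  shows "\<forall>\<^sub>F s in at_right 0. sgn (Im ((fst (u s))\<^sup>2)) = sgn (- Im k) * sgn (Re (q\<^sup>2))"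
proof -
  define x where "x = (\<lambda>s. Re (fst (u s) / q))"
  define y where "y = (\<lambda>s. Im (fst (u s) / q))"
  \<comment> \<open>The tangent of the angle from q to E, times - Im k; with this factor
    \<open>g\<close> increases for either sign of Im k.\<close>
  define g where "g = (\<lambda>s. - Im k * (y s / x s))"
  have lim: "((\<lambda>s. fst (u s) / of_real s / q) \<longlongrightarrow> 1) (at_right 0)"
    using tendsto_divide[OF quotient_at_0[OF G u(1,2)] tendsto_const u(3)] u(3) by simp
  have eq: "fst (u s) / of_real s / q = fst (u s) / q / of_real s" for s
    by simp
  have parts: "Re (fst (u s) / of_real s / q) = x s / s" "Im (fst (u s) / of_real s / q) = y s / s" for s
    unfolding eq x_def y_def by (rule Re_divide_of_real Im_divide_of_real)+
  have limx: "((\<lambda>s. x s / s) \<longlongrightarrow> 1) (at_right 0)"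
    using tendsto_Re[OF lim] by (simp only: parts one_complex.sel)
  have limy: "((\<lambda>s. y s / s) \<longlongrightarrow> 0) (at_right 0)"
    using tendsto_Im[OF lim] by (simp only: parts one_complex.sel)
  have limg: "(g \<longlongrightarrow> 0) (at_right 0)"
  proof -
    have "((\<lambda>s. - Im k * ((y s / s) / (x s / s))) \<longlongrightarrow> - Im k * (0 / 1)) (at_right 0)"
      by (intro tendsto_intros limx limy) simp
    moreover have "\<forall>\<^sub>F s in at_right 0. - Im k * ((y s / s) / (x s / s)) = g s"
      using eventually_at_right_less[of 0] by eventually_elim (simp add: g_def)
    ultimately have "(g \<longlongrightarrow> - Im k * (0 / 1)) (at_right 0)" by (rule Lim_transform_eventually)
    then show ?thesis by simp
  qed
  have "\<forall>\<^sub>F s in at_right 0. 0 < x s / s \<and> 0 < s \<and> s < l"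
    using order_tendstoD(1)[OF limx zero_less_one] eventually_at_right_less[of 0] eventually_at_right_real[OF l]
    by eventually_elim auto
  then obtain \<delta> where \<delta>: "\<delta> > 0" "\<And>s. 0 < s \<Longrightarrow> s < \<delta> \<Longrightarrow> 0 < x s \<and> s < l"
    unfolding eventually_at_right_field by (auto simp: zero_less_divide_iff)
  have gpos: "0 < g s" if s: "0 < s" "s < \<delta>" for s
  proof -
    have der: "\<exists>d. (g has_real_derivative d) (at r) \<and> 0 < d" if r: "0 < r" "r < \<delta>" for r
    proof -
      have rl: "r < l" "0 < x r" using \<delta>(2)[OF r] by auto
      define e' where "e' = slope (coef k G) u r / q"
      have "((\<lambda>t. fst (u t)) has_vector_derivative slope (coef k G) u r) (at r)"
        using quasi_sol_deriv(1)[OF u(1), of r] rl r by (simp add: at_within_Icc_at)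
      then have e: "((\<lambda>t. fst (u t) / q) has_vector_derivative e') (at r)"
        unfolding e'_def by (rule has_vector_derivative_divide)
      have "(x has_real_derivative Re e') (at r)" "(y has_real_derivative Im e') (at r)"
        using bounded_linear.has_vector_derivative[OF bounded_linear_Re e]
          bounded_linear.has_vector_derivative[OF bounded_linear_Im e]
        by (simp_all add: x_def y_def has_real_derivative_iff_has_vector_derivative)
      then have d: "(g has_real_derivative - Im k * ((Im e' * x r - y r * Re e') / (x r * x r))) (at r)"
        unfolding g_def using rl(2) by (intro DERIV_cmult DERIV_divide) auto
      have eq: "Im e' * x r - y r * Re e' =
          Im (slope (coef k G) u r * cnj (fst (u r))) / (cmod q)\<^sup>2"
      proof -
        have "Im e' * Re p - Im p * Re e' = Im (e' * cnj p)" for p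
          by simp
        then have "Im e' * x r - y r * Re e' = Im (e' * cnj (fst (u r) / q))"
          by (simp only: x_def y_def)
        also have "e' * cnj (fst (u r) / q) = slope (coef k G) u r * cnj (fst (u r)) / (q * cnj q)"
          by (simp add: e'_def)
        also have "q * cnj q = of_real ((cmod q)\<^sup>2)" by (simp only: complex_norm_square)
        finally show ?thesis by (simp only: Im_divide_of_real)
      qed
      have pos: "0 < - Im k * (Im (slope (coef k G) u r * cnj (fst (u r))) / (cmod q)\<^sup>2 / (x r * x r))"
      proof -
        have "0 < - Im k * Im (slope (coef k G) u r * cnj (fst (u r))) / ((cmod q)\<^sup>2 * (x r * x r))"
          using r rl u(3) by (intro divide_pos_pos rotation[OF G u k] mult_pos_pos) auto
        then show ?thesis by (simp only: divide_divide_eq_left times_divide_eq_right)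
      qed
      from d show ?thesis unfolding eq using pos by blast
    qed
    have "g (s/2) < g s"
      by (rule DERIV_pos_imp_increasing) (use s in \<open>auto intro!: der simp del: minus_mult_minus\<close>)
    moreover have "0 \<le> g (s/2)"
    proof (rule tendsto_upperbound[OF limg])
      have "g r \<le> g (s/2)" if "0 < r" "r < s/2" for r
        by (rule less_imp_le, rule DERIV_pos_imp_increasing) (use s that in \<open>auto intro!: der\<close>)
      then show "\<forall>\<^sub>F r in at_right 0. g r \<le> g (s/2)"
        unfolding eventually_at_right_field using s by (intro exI[of _ "s/2"]) auto
    qed simp
    ultimately show ?thesis by simp
  qed
  have *: "sgn (Im ((fst (u s))\<^sup>2)) = sgn (- Im k) * sgn (Re (q\<^sup>2))" if s: "0 < s" "s < \<delta>" for s
  proof -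
    have x: "0 < x s" using \<delta>(2)[OF s] by simp
    have "sgn (- Im k) * sgn (y s) = 1"
      using gpos[OF s] x by (auto simp: g_def sgn_if zero_less_mult_iff mult_less_0_iff divide_simps split: if_splits)
    then have y: "sgn (y s) = sgn (- Im k)"
      by (auto simp: sgn_if split: if_splits)
    have "fst (u s) = q * Complex (x s) (y s)"
      using u(3) by (simp add: x_def y_def complex_eq_iff[symmetric])
    then have "Im ((fst (u s))\<^sup>2) = Re (q\<^sup>2) * (2 * x s * y s)"
      using q by (simp only: power_mult_distrib times_complex.sel) (simp add: power2_eq_square)
    then show ?thesis using x y by (simp add: sgn_mult)
  qed
  show ?thesis
    unfolding eventually_at_right_field by (intro exI[of _ \<delta>] conjI allI impI \<delta>(1) *)
qed

text \<open>After 0, either Im (E^2) is nonzero and keeps its sign, or it has a simple zero and its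
  derivative decides. At 0 the direction q takes over, with the rotation settling the degenerate
  case. The sign right after T is thus a function of the state at T and never 0, so solutions that
  agree up to T also switch alike after T.\<close>

lemma exit_sign_correct:
  assumes G: "G \<in> profiles" and u: "quasi_sol l (coef k G) u" "u 0 = (0, q)" "q \<noteq> 0"
    and k: "Im k \<noteq> 0" and T: "0 \<le> T" "T < l"
  obtains \<delta> where "0 < \<delta>" "T + \<delta> \<le> l"
    "\<And>s. T < s \<Longrightarrow> s < T + \<delta> \<Longrightarrow>
      sgn (Im ((fst (u s))\<^sup>2)) = exit_sign k (fst (u T)) (slope (coef k G) u T)"
    "exit_sign k (fst (u T)) (slope (coef k G) u T) \<noteq> 0"
proof -
  define E where "E = (\<lambda>t. fst (u t))"
  define D where "D = slope (coef k G) u"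
  define ex where "ex = exit_sign k (E T) (D T)"
  have contE: "continuous_on {0..l} (\<lambda>t. Im ((E t)\<^sup>2))"
    unfolding E_def
    by (intro continuous_on_Im continuous_on_power quasi_sol_continuous(2)[OF u(1)])
  have "(\<forall>\<^sub>F s in at_right T. sgn (Im ((E s)\<^sup>2)) = ex) \<and> ex \<noteq> 0"
  proof (cases "T = 0")
    case False
    then have T0: "0 < T" "T \<le> l" "T \<in> {0..l}" using T by auto
    have ET: "E T \<noteq> 0" unfolding E_def by (rule rotation_nonzero[OF G u k T0(1,2)])
    show ?thesis
    proof (cases "Im ((E T)\<^sup>2) = 0")
      case True
      have nz: "Im (E T * D T) \<noteq> 0"
        unfolding E_def D_def by (rule Im_square_deriv_nonzero[OF G u k T0(1,2)]) (use True in \<open>simp only: E_def\<close>)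
      have der: "((\<lambda>s. Im ((E s)\<^sup>2)) has_vector_derivative 2 * Im (E T * D T)) (at T within {0..l})"
        unfolding E_def D_def by (rule Im_square_deriv[OF u(1) T0(3)])
      have "\<exists>\<delta>>0. \<forall>s\<in>{0..l}. T < s \<and> s < T + \<delta> \<longrightarrow> sgn (Im ((E s)\<^sup>2)) = sgn (2 * Im (E T * D T))"
        by (rule sgn_after_simple_zero[OF der True]) (use nz in \<open>simp del: times_complex.sel\<close>)
      then obtain \<delta> where "\<delta> > 0"
          "\<And>s. s \<in> {0..l} \<Longrightarrow> T < s \<Longrightarrow> s < T + \<delta> \<Longrightarrow> sgn (Im ((E s)\<^sup>2)) = sgn (2 * Im (E T * D T))"
        by blast
      moreover have "ex = sgn (2 * Im (E T * D T))"
        using ET True by (simp only: ex_def exit_sign_def) (simp del: times_complex.sel add: sgn_mult)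
      moreover have "ex \<noteq> 0"
        using ET True nz by (simp only: ex_def exit_sign_def) (simp del: times_complex.sel add: sgn_eq_0_iff)
      ultimately show ?thesis
        unfolding eventually_at_right_field using T
        by (intro conjI exI[of _ "min l (T + \<delta>)"]) auto
    next
      case False
      have ex: "ex = sgn (Im ((E T)\<^sup>2))"
        using ET False by (simp only: ex_def exit_sign_def) simp
      have "((\<lambda>t. Im ((E t)\<^sup>2)) \<longlongrightarrow> Im ((E T)\<^sup>2)) (at T within {0..l})"
        using contE T0(3) by (auto simp: continuous_on_def)
      then have "((\<lambda>t. Im ((E t)\<^sup>2)) \<longlongrightarrow> Im ((E T)\<^sup>2)) (at T within {T..l})"
        by (rule tendsto_within_subset) (use T in auto)
      then have "((\<lambda>t. Im ((E t)\<^sup>2)) \<longlongrightarrow> Im ((E T)\<^sup>2)) (at_right T)"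
        using T by (simp add: at_within_Icc_at_right)
      then have "\<forall>\<^sub>F s in at_right T. dist (Im ((E s)\<^sup>2)) (Im ((E T)\<^sup>2)) < \<bar>Im ((E T)\<^sup>2)\<bar>"
        using False by (intro tendstoD) auto
      then have "\<forall>\<^sub>F s in at_right T. sgn (Im ((E s)\<^sup>2)) = ex"
        by eventually_elim (simp only: ex dist_real_def, auto simp: sgn_if abs_if split: if_splits)
      with ex False show ?thesis by (simp add: sgn_eq_0_iff)
    qed
  next
    case True
    have ET: "E T = 0" "D T = q"
      using True u slope_0[OF G, of k u] by (simp_all add: E_def D_def)
    show ?thesis
    proof (cases "Im (q\<^sup>2) = 0")
      case True
      then have ex: "ex = sgn (- Im k) * sgn (Re (q\<^sup>2))"
        using ET by (simp only: ex_def exit_sign_def) simp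
      have "q\<^sup>2 \<noteq> 0" using u by simp
      with True have "Re (q\<^sup>2) \<noteq> 0" by (metis complex_eq_iff zero_complex.sel)
      with ex k have "ex \<noteq> 0" by (simp only: sgn_eq_0_iff mult_eq_0_iff neg_equal_0_iff_equal) simp
      with exit_sign_at_0_degenerate[OF G u k True] \<open>T = 0\<close> ex show ?thesis
        by (simp only: E_def) simp
    next
      case False
      then have ex: "ex = sgn (Im (q\<^sup>2))"
        using ET by (simp only: ex_def exit_sign_def) simp
      \<comment> \<open>Im (E^2) vanishes to second order at 0; division by s^2 > 0 keeps its sign
        and leaves the nonzero limit Im (q^2).\<close>
      have "((\<lambda>s. Im ((E s / of_real s)\<^sup>2)) \<longlongrightarrow> Im (q\<^sup>2)) (at_right 0)"
        unfolding E_def by (intro tendsto_intros quotient_at_0[OF G u(1,2)])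
      then have "\<forall>\<^sub>F s in at_right 0. dist (Im ((E s / of_real s)\<^sup>2)) (Im (q\<^sup>2)) < \<bar>Im (q\<^sup>2)\<bar>"
        using False by (intro tendstoD) auto
      then have "\<forall>\<^sub>F s in at_right 0. sgn (Im ((E s)\<^sup>2)) = ex"
        using eventually_at_right_less[of 0]
      proof eventually_elim
        case (elim s)
        have "Im ((E s / of_real s)\<^sup>2) = Im ((E s)\<^sup>2) / s\<^sup>2"
          by (metis Im_divide_of_real of_real_power power_divide)
        then have "sgn (Im ((E s / of_real s)\<^sup>2)) = sgn (Im ((E s)\<^sup>2))"
          using elim(2) by (simp only: sgn_divide) simp
        moreover have "sgn (Im ((E s / of_real s)\<^sup>2)) = ex"
          using elim(1) by (simp only: ex dist_real_def, auto simp: sgn_if abs_if split: if_splits)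
        ultimately show ?case by simp
      qed
      with ex False \<open>T = 0\<close> show ?thesis by (simp add: sgn_eq_0_iff)
    qed
  qed
  then obtain b where b: "T < b" "\<And>s. T < s \<Longrightarrow> s < b \<Longrightarrow> sgn (Im ((E s)\<^sup>2)) = ex" "ex \<noteq> 0"
    unfolding eventually_at_right_field by blast
  show ?thesis
    by (rule that[of "min b l - T"]) (use b[unfolded ex_def E_def D_def] T in auto)
qed

end

section \<open>The switching nonlinearity\<close>

context cavity_range
begin

definition sw :: "complex \<Rightarrow> real" where
  "sw p = e1 + (e2 - e1) * chi_plus (p\<^sup>2)"

lemma switched_cavity_sw: "switched_cavity e1 e2 P s = sw (P s)"
  by (simp add: switched_cavity_def sw_def)

lemma sw_bounds: "e1 \<le> sw p" "sw p \<le> e2"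
  using e12 by (auto simp: sw_def chi_plus_def)

lemma sw_eq_sgn: "sw p = (if sgn (Im (p\<^sup>2)) = 1 then e2 else e1)"
  by (simp add: sw_def chi_plus_def sgn_1_pos del: times_complex.sel)

lemma sw_measurable: "sw \<in> borel_measurable borel"
proof -
  have "open {z. 0 < Im (z\<^sup>2)}"
    by (intro open_Collect_less continuous_intros)
  then have "(\<lambda>z. e1 + (e2 - e1) * indicator {z. 0 < Im (z\<^sup>2)} z) \<in> borel_measurable borel"
    by (intro borel_measurable_add borel_measurable_times borel_measurable_const borel_measurable_indicator) auto
  moreover have "sw = (\<lambda>z. e1 + (e2 - e1) * indicator {z. 0 < Im (z\<^sup>2)} z)"
    by (auto simp only: sw_def chi_plus_def indicator_def mem_Collect_eq of_bool_def)
  ultimately show ?thesis by simp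
qed

lemma sw_tendsto:
  assumes "(f \<longlongrightarrow> p) F" "Im (p\<^sup>2) \<noteq> 0"
  shows "((\<lambda>x. sw (f x)) \<longlongrightarrow> sw p) F"
proof -
  have lim: "((\<lambda>x. Im ((f x)\<^sup>2)) \<longlongrightarrow> Im (p\<^sup>2)) F"
    by (intro tendsto_intros assms)
  have "\<forall>\<^sub>F x in F. dist (Im ((f x)\<^sup>2)) (Im (p\<^sup>2)) < \<bar>Im (p\<^sup>2)\<bar>"
    using assms(2) by (intro tendstoD[OF lim]) simp
  then have "\<forall>\<^sub>F x in F. sgn (Im ((f x)\<^sup>2)) = sgn (Im (p\<^sup>2))"
    by eventually_elim (simp only: dist_real_def, auto simp: sgn_if abs_if split: if_splits)
  then have "\<forall>\<^sub>F x in F. sw (f x) = sw p"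
    by eventually_elim (simp only: sw_eq_sgn)
  then show ?thesis by (rule tendsto_eventually)
qed

lemma sw_measurable_on:
  fixes f :: "real \<Rightarrow> complex"
  assumes "continuous_on {a..b} f"
  shows "(\<lambda>s. sw (f s)) \<in> borel_measurable (lebesgue_on {a..b})"
  by (rule measurable_compose[OF continuous_imp_measurable_on_sets_lebesgue[OF assms] sw_measurable])
    simp

lemma sw_integrable:
  fixes f :: "real \<Rightarrow> complex"
  assumes "continuous_on {a..b} f"
  shows "(\<lambda>s. sw (f s)) integrable_on {a..b}"
proof (rule measurable_bounded_by_integrable_imp_integrable[where g = "\<lambda>_. e2"])
  show "norm (sw (f s)) \<le> e2" for s
    using sw_bounds[of "f s"] e1 by simp
qed (auto intro: sw_measurable_on[OF assms])

lemma sw_integral_deriv: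
  assumes int: "(\<lambda>r. sw (f r)) integrable_on {0..l}" and s: "s \<in> {0<..<l}"
    and cont: "continuous (at s within {0..l}) (\<lambda>r. sw (f r))"
  shows "((\<lambda>t. integral {0..t} (\<lambda>r. sw (f r))) has_vector_derivative sw (f s)) (at s)"
  using integral_has_vector_derivative_continuous_at[OF int, of s "{}"] s cont
  by (simp add: at_within_Icc_at)

text \<open>Zeros after 0 are simple, hence isolated. The zero at 0 is of higher order and is
  isolated by the nonzero exit sign instead.\<close>

lemma Im_square_zeros_finite:
  assumes G: "G \<in> profiles" and u: "quasi_sol l (coef k G) u" "u 0 = (0, q)" "q \<noteq> 0"
    and k: "Im k \<noteq> 0"
  shows "finite {t \<in> {0..l}. Im ((fst (u t))\<^sup>2) = 0}"
proof (rule finite_isolated_zeros)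
  show "continuous_on {0..l} (\<lambda>t. Im ((fst (u t))\<^sup>2))"
    by (intro continuous_on_Im continuous_on_power quasi_sol_continuous(2)[OF u(1)])
  fix t assume t: "t \<in> {0..l}" and z: "Im ((fst (u t))\<^sup>2) = 0"
  show "\<exists>\<delta>>0. \<forall>s\<in>{0..l}. 0 < \<bar>s - t\<bar> \<and> \<bar>s - t\<bar> < \<delta> \<longrightarrow> Im ((fst (u s))\<^sup>2) \<noteq> 0"
  proof (cases "t = 0")
    case True
    obtain \<delta> where \<delta>: "0 < \<delta>" "\<And>s. 0 < s \<Longrightarrow> s < 0 + \<delta> \<Longrightarrow>
        sgn (Im ((fst (u s))\<^sup>2)) = exit_sign k (fst (u 0)) (slope (coef k G) u 0)"
      "exit_sign k (fst (u 0)) (slope (coef k G) u 0) \<noteq> 0"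
      using exit_sign_correct[OF G u k, of 0] l by (metis order.refl)
    show ?thesis
      using \<delta>(1)
    proof (intro exI[of _ \<delta>] conjI ballI impI)
      fix s assume "s \<in> {0..l}" "0 < \<bar>s - t\<bar> \<and> \<bar>s - t\<bar> < \<delta>"
      then have "sgn (Im ((fst (u s))\<^sup>2)) \<noteq> 0" using \<delta>(2)[of s] \<delta>(3) True by simp
      then show "Im ((fst (u s))\<^sup>2) \<noteq> 0" using sgn_zero by metis
    qed
  next
    case False
    then have t0: "0 < t" "t \<le> l" using t by auto
    have "2 * Im (fst (u t) * slope (coef k G) u t) \<noteq> 0"
      using Im_square_deriv_nonzero[OF G u k t0 z] by linarith
    with nonzero_near_simple_zero[OF Im_square_deriv[OF u(1) t] z] show ?thesis by blast
  qed
qed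

lemma zeros_finite:
  assumes G: "G \<in> profiles" and u: "quasi_sol l (coef k G) u" "u 0 = (0, q)" "q \<noteq> 0"
  shows "finite {t \<in> {0..l}. fst (u t) = 0}"
proof (rule finite_isolated_zeros[OF quasi_sol_continuous(2)[OF u(1)]])
  fix t assume t: "t \<in> {0..l}" and z: "fst (u t) = 0"
  have "slope (coef k G) u t \<noteq> 0"
    using quasi_sol_nonzero(2)[OF u(1) profile_coef_continuous[OF G] t] u z by (simp add: zero_prod_def)
  with nonzero_near_simple_zero[OF quasi_sol_deriv(1)[OF u(1) t] z]
  show "\<exists>\<delta>>0. \<forall>s\<in>{0..l}. 0 < \<bar>s - t\<bar> \<and> \<bar>s - t\<bar> < \<delta> \<longrightarrow> fst (u s) \<noteq> 0"
    by blast
qed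

text \<open>After division by q the initial data are real, and conjugation maps solutions of a real
  equation to solutions; uniqueness makes the quotient real.\<close>

lemma real_coefficient_solution:
  assumes G: "G \<in> profiles" and u: "quasi_sol l (coef k G) u" "u 0 = (0, q)" "q \<noteq> 0"
    and k: "Im k = 0" and t: "t \<in> {0..l}"
  shows "\<exists>x y. fst (u t) = q * of_real x \<and> slope (coef k G) u t = q * of_real y"
proof -
  define v where "v = (\<lambda>t. (inverse q * fst (u t), inverse q * snd (u t)))"
  have v: "quasi_sol l (coef k G) v"
    unfolding v_def by (rule quasi_sol_scale[OF u(1)])
  have kc: "cnj k = k" using k by (simp add: complex_eq_iff)
  have "v t = (cnj (fst (v t)), cnj (snd (v t)))"
    by (rule quasi_sol_unique[OF v quasi_sol_cnj[OF v] _ profile_coef_continuous[OF G] _ t])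
      (use u kc in \<open>auto simp: v_def\<close>)
  then have "cnj (fst (v t)) = fst (v t)" "cnj (snd (v t)) = snd (v t)"
    by (metis fst_conv, metis snd_conv)
  then have r: "fst (v t) = of_real (Re (fst (v t)))" "snd (v t) = of_real (Re (snd (v t)))"
    by (simp_all add: complex_eq_iff)
  have 1: "fst (u t) = q * fst (v t)" "snd (u t) = q * snd (v t)"
    using u(3) by (simp_all add: v_def)
  have k2: "k = of_real (Re k)" using k by (simp add: complex_eq_iff)
  have "slope (coef k G) u t = q * of_real (Re (snd (v t)) - Re k * G t * Re (fst (v t)))"
    unfolding slope_def 1 by (subst r(1), subst r(2), subst k2) (simp add: algebra_simps)
  with 1(1) r(1) show ?thesis by metis
qed

text \<open>The solution moves on the line through q, so Im (E^2) is Im (q^2) times a positive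
  number and never changes sign. The borderline Im (q^2) = 0 goes to e1 by the convention in
  \<open>chi_plus\<close>.\<close>

lemma sw_real_coefficient:
  assumes G: "G \<in> profiles" and u: "quasi_sol l (coef k G) u" "u 0 = (0, q)" "q \<noteq> 0"
    and k: "Im k = 0" and s: "s \<in> {0..l}" "fst (u s) \<noteq> 0"
  shows "sw (fst (u s)) = (if Im (q\<^sup>2) > 0 then e2 else e1)"
proof -
  obtain x where x: "fst (u s) = q * of_real x"
    using real_coefficient_solution[OF G u k s(1)] by blast
  then have "x \<noteq> 0" using s by auto
  have "Im ((fst (u s))\<^sup>2) = Im (q\<^sup>2 * of_real (x\<^sup>2))"
    by (simp only: x power_mult_distrib of_real_power)
  also have "\<dots> = Im (q\<^sup>2) * x\<^sup>2"
    by (simp del: of_real_power)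
  finally show ?thesis
    using \<open>x \<noteq> 0\<close> by (simp only: sw_def chi_plus_def zero_less_mult_iff) simp
qed

section \<open>The nonlinear initial value problem: uniqueness\<close>

text \<open>The nonlinear problem in terms of profiles. The switching law is imposed on the
  derivative of G off a finite set rather than almost everywhere, so that equality of profiles
  follows from the fundamental theorem with finitely many exceptions.\<close>

definition bang :: "complex \<Rightarrow> complex \<Rightarrow> (real \<Rightarrow> real) \<Rightarrow> (real \<Rightarrow> complex \<times> complex) \<Rightarrow> bool" where
  "bang k q G u \<longleftrightarrow> G \<in> profiles \<and> quasi_sol l (coef k G) u \<and> u 0 = (0, q) \<and>
     (\<exists>X. finite X \<and> (\<forall>s\<in>{0<..<l} - X. (G has_vector_derivative sw (fst (u s))) (at s)))"

lemma profile_eqI: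
  assumes G: "G \<in> profiles" "H \<in> profiles" and ab: "0 \<le> a" "a \<le> b" "b \<le> l"
    and X: "finite X" and eq: "G a = H a"
    and d: "\<And>s. s \<in> {a<..<b} - X \<Longrightarrow> (G has_vector_derivative d s) (at s) \<and> (H has_vector_derivative d s) (at s)"
  shows "G b = H b"
proof -
  have "((\<lambda>s. 0) has_integral ((G b - H b) - (G a - H a))) {a..b}"
  proof (rule fundamental_theorem_of_calculus_interior_strong[OF X ab(2)])
    show "((\<lambda>s. G s - H s) has_vector_derivative 0) (at s)" if "s \<in> {a<..<b} - X" for s
      using d[OF that] has_vector_derivative_diff by fastforce
    show "continuous_on {a..b} (\<lambda>s. G s - H s)"
      by (rule continuous_on_subset[of "{0..l}"])
        (use ab in \<open>auto intro!: continuous_on_diff profile_continuous[OF G(1)] profile_continuous[OF G(2)]\<close>)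
  qed
  then have "(G b - H b) - (G a - H a) = 0"
    using has_integral_0_eq by blast
  with eq show ?thesis by simp
qed

lemma bang_unique_real:
  assumes b: "bang k q G u" and q: "q \<noteq> 0" and k: "Im k = 0" and t: "t \<in> {0..l}"
  shows "G t = (if Im (q\<^sup>2) > 0 then e2 else e1) * t"
proof -
  define e where "e = (if Im (q\<^sup>2) > 0 then e2 else e1)"
  from b obtain X where G: "G \<in> profiles" and u: "quasi_sol l (coef k G) u" "u 0 = (0, q)"
    and X: "finite X" "\<And>s. s \<in> {0<..<l} - X \<Longrightarrow> (G has_vector_derivative sw (fst (u s))) (at s)"
    unfolding bang_def by blast
  define Z where "Z = {t \<in> {0..l}. fst (u t) = 0}"
  have "G t = e * t"
  proof (rule profile_eqI[OF G, where a = 0 and X = "X \<union> Z"])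
    show "(\<lambda>t. e * t) \<in> profiles" by (rule profile_linear) (use e12 in \<open>auto simp: e_def\<close>)
    show "finite (X \<union> Z)" using X zeros_finite[OF G u q] by (simp add: Z_def)
    fix s assume s: "s \<in> {0<..<t} - (X \<union> Z)"
    then have sl: "s \<in> {0<..<l} - X" "s \<in> {0..l}" "fst (u s) \<noteq> 0" using t by (auto simp: Z_def)
    have "sw (fst (u s)) = e"
      unfolding e_def by (rule sw_real_coefficient[OF G u q k sl(2,3)])
    then show "(G has_vector_derivative e) (at s) \<and> ((\<lambda>t. e * t) has_vector_derivative e) (at s)"
      using X(2)[OF sl(1)] by (auto intro!: derivative_eq_intros)
  qed (use t profile_0[OF G] in auto)
  then show ?thesis by (simp only: e_def)
qed

text \<open>Let T be the end of the initial interval on which G and H agree. The states coincide at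
  T, so \<open>exit_sign_correct\<close> prescribes the same coefficient right after T, and the
  agreement would continue past T unless T = l.\<close>

lemma bang_unique_nonreal:
  assumes b: "bang k q G u" "bang k q H v" and q: "q \<noteq> 0" and k: "Im k \<noteq> 0" and t: "t \<in> {0..l}"
  shows "G t = H t"
proof -
  from b(1) obtain X where G: "G \<in> profiles" and u: "quasi_sol l (coef k G) u" "u 0 = (0, q)"
    and X: "finite X" "\<And>s. s \<in> {0<..<l} - X \<Longrightarrow> (G has_vector_derivative sw (fst (u s))) (at s)"
    unfolding bang_def by blast
  from b(2) obtain Y where H: "H \<in> profiles" and v: "quasi_sol l (coef k H) v" "v 0 = (0, q)"
    and Y: "finite Y" "\<And>s. s \<in> {0<..<l} - Y \<Longrightarrow> (H has_vector_derivative sw (fst (v s))) (at s)"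
    unfolding bang_def by blast
  define A where "A = {t \<in> {0..l}. \<forall>s\<in>{0..t}. G s = H s}"
  define T where "T = Sup A"
  have A0: "0 \<in> A" using l profile_0[OF G] profile_0[OF H] by (auto simp: A_def)
  have Abdd: "bdd_above A" by (auto simp: A_def bdd_above_def)
  have "T \<le> l" unfolding T_def by (rule cSup_least) (use A0 in \<open>auto simp: A_def\<close>)
  with cSup_upper[OF A0 Abdd] have T: "0 \<le> T" "T \<le> l" by (auto simp: T_def)
  have below: "G s = H s" if s: "0 \<le> s" "s < T" for s
  proof -
    obtain r where "r \<in> A" "s < r"
      using s(2) less_cSup_iff[OF _ Abdd, of s] A0 unfolding T_def by blast
    then show ?thesis using s by (auto simp: A_def)
  qed
  have eqT: "G s = H s" if "s \<in> {0..T}" for s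
  proof (cases "s < T")
    case False
    then have "s = T" using that by auto
    show ?thesis
    proof (cases "T = 0")
      case False
      have "closed {t \<in> {0..l}. G t - H t = 0}"
        by (rule continuous_closed_preimage_constant)
          (auto intro!: continuous_on_diff profile_continuous[OF G] profile_continuous[OF H])
      moreover have "T islimpt {0<..<T}" using False T by (simp add: islimpt_greaterThanLessThan2)
      then have "T islimpt {t \<in> {0..l}. G t - H t = 0}"
        by (rule islimpt_subset) (use below T in auto)
      ultimately show ?thesis using \<open>s = T\<close> closed_limpt by fastforce
    qed (use \<open>s = T\<close> profile_0[OF G] profile_0[OF H] in simp)
  qed (use below that in auto)
  have contT: "continuous_on {0..T} (coef k G)"
    by (rule continuous_on_subset[OF profile_coef_continuous[OF G]]) (use T in auto)
  have uv: "u s = v s" if "s \<in> {0..T}" for s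
    by (rule quasi_sol_unique[OF quasi_sol_subinterval[OF u(1) T(2)] quasi_sol_subinterval[OF v(1) T(2)] _ contT])
      (use that eqT u v in auto)
  have "T = l"
  proof (rule ccontr)
    assume "T \<noteq> l"
    then have Tl: "T < l" using T by simp
    obtain \<delta>1 where d1: "0 < \<delta>1" "T + \<delta>1 \<le> l" "\<And>s. T < s \<Longrightarrow> s < T + \<delta>1 \<Longrightarrow>
        sgn (Im ((fst (u s))\<^sup>2)) = exit_sign k (fst (u T)) (slope (coef k G) u T)"
        "exit_sign k (fst (u T)) (slope (coef k G) u T) \<noteq> 0"
      by (rule exit_sign_correct[OF G u q k T(1) Tl]) (rule that)
    obtain \<delta>2 where d2: "0 < \<delta>2" "T + \<delta>2 \<le> l" "\<And>s. T < s \<Longrightarrow> s < T + \<delta>2 \<Longrightarrow>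
        sgn (Im ((fst (v s))\<^sup>2)) = exit_sign k (fst (v T)) (slope (coef k H) v T)"
        "exit_sign k (fst (v T)) (slope (coef k H) v T) \<noteq> 0"
      by (rule exit_sign_correct[OF H v q k T(1) Tl]) (rule that)
    have exeq: "exit_sign k (fst (v T)) (slope (coef k H) v T) = exit_sign k (fst (u T)) (slope (coef k G) u T)"
      using uv[of T] eqT[of T] T by (simp add: slope_def)
    define \<delta> where "\<delta> = min \<delta>1 \<delta>2"
    have "T + \<delta> / 2 \<in> A"
      unfolding A_def
    proof (intro CollectI conjI ballI)
      fix s assume s: "s \<in> {0..T + \<delta> / 2}"
      show "G s = H s"
      proof (cases "s \<le> T")
        case False
        show ?thesis
        proof (rule profile_eqI[OF G H T(1), where X = "X \<union> Y"])
          fix r assume r: "r \<in> {T<..<s} - (X \<union> Y)"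
          have \<delta>: "\<delta> \<le> \<delta>1" "\<delta> \<le> \<delta>2" "0 < \<delta>" using d1(1) d2(1) by (auto simp: \<delta>_def)
          have rb: "T < r" "r < s" using r by auto
          then have rT: "r < T + \<delta>1" "r < T + \<delta>2" "0 < r" "r < l"
            using s \<delta> T(1) d1(2) by auto
          have "sw (fst (v r)) = sw (fst (u r))"
            using d1(3)[OF rb(1) rT(1)] d2(3)[OF rb(1) rT(2)] exeq by (simp only: sw_eq_sgn)
          then show "(G has_vector_derivative sw (fst (u r))) (at r) \<and> (H has_vector_derivative sw (fst (u r))) (at r)"
            using X(2)[of r] Y(2)[of r] r rT by auto
        qed (use False s X Y eqT[of T] T d1 d2 in \<open>auto simp: \<delta>_def\<close>)
      qed (use eqT s in auto)
    qed (use T d1 d2 in \<open>auto simp: \<delta>_def\<close>)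
    then have "T + \<delta> / 2 \<le> T" unfolding T_def by (rule cSup_upper[OF _ Abdd])
    then show False using d1(1) d2(1) by (auto simp: \<delta>_def)
  qed
  with eqT t show ?thesis by simp
qed

lemma bang_unique:
  assumes b: "bang k q G u" "bang k q H v" and q: "q \<noteq> 0" and t: "t \<in> {0..l}"
  shows "G t = H t" "u t = v t"
proof -
  have eq: "G t = H t" if "t \<in> {0..l}" for t
  proof (cases "Im k = 0")
    case True
    then show ?thesis
      using bang_unique_real[OF b(1) q True that] bang_unique_real[OF b(2) q True that] by simp
  qed (rule bang_unique_nonreal[OF b q _ that])
  then show "G t = H t" using t by blast
  show "u t = v t"
    by (rule quasi_sol_unique[of l "coef k G" u "coef k H" v])
      (use b eq t profile_coef_continuous in \<open>auto simp: bang_def\<close>)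
qed

section \<open>Existence for the nonlinear problem by delayed feedback\<close>

text \<open>The system determines the values on \<open>{0..l}\<close> only; the choice outside is
  arbitrary.\<close>

definition sol :: "complex \<Rightarrow> complex \<Rightarrow> (real \<Rightarrow> real) \<Rightarrow> real \<Rightarrow> complex \<times> complex" where
  "sol k q G = (SOME u. u 0 = (0, q) \<and> quasi_sol l (coef k G) u)"

lemma sol:
  assumes "G \<in> profiles"
  shows "sol k q G 0 = (0, q)" "quasi_sol l (coef k G) (sol k q G)"
proof -
  have "\<exists>u. u 0 = (0, q) \<and> quasi_sol l (coef k G) u"
    using quasi_sol_exists[OF _ profile_coef_continuous[OF assms]] l by simp
  from someI_ex[OF this] show "sol k q G 0 = (0, q)" "quasi_sol l (coef k G) (sol k q G)"
    by (simp_all add: sol_def)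
qed

lemma bang_exists_real:
  assumes q: "q \<noteq> 0" and k: "Im k = 0"
  shows "\<exists>G u. bang k q G u"
proof -
  define e where "e = (if Im (q\<^sup>2) > 0 then e2 else e1)"
  define G where "G = (\<lambda>t::real. e * t)"
  define u where "u = sol k q G"
  define Z where "Z = {t \<in> {0..l}. fst (u t) = 0}"
  have G: "G \<in> profiles" unfolding G_def by (rule profile_linear) (use e12 in \<open>auto simp: e_def\<close>)
  note u = sol(2)[OF G, of k q, folded u_def] sol(1)[OF G, of k q, folded u_def]
  have "(G has_vector_derivative sw (fst (u s))) (at s)" if s: "s \<in> {0<..<l} - Z" for s
  proof -
    have sl: "s \<in> {0..l}" "fst (u s) \<noteq> 0" using s by (auto simp: Z_def)
    have "sw (fst (u s)) = e"
      unfolding e_def by (rule sw_real_coefficient[OF G u q k sl])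
    then show ?thesis
      by (auto simp: G_def intro!: derivative_eq_intros)
  qed
  moreover have "finite Z" unfolding Z_def by (rule zeros_finite[OF G u q])
  ultimately have "bang k q G u"
    unfolding bang_def using G u by blast
  then show ?thesis by blast
qed

text \<open>One pass around the loop: a profile determines a solution, and the switching law along
  it determines a new profile. Fixed points on \<open>{0..l}\<close> are the profiles
  sought.\<close>

definition feedback :: "complex \<Rightarrow> complex \<Rightarrow> (real \<Rightarrow> real) \<Rightarrow> real \<Rightarrow> real" where
  "feedback k q G t = integral {0..t} (\<lambda>s. sw (fst (sol k q G s)))"

lemma sw_sol_integrable:
  assumes "G \<in> profiles" "0 \<le> s" "t \<le> l"
  shows "(\<lambda>r. sw (fst (sol k q G r))) integrable_on {s..t}"
  by (rule sw_integrable, rule continuous_on_subset[OF quasi_sol_continuous(2)[OF sol(2)[OF assms(1)]]])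
    (use assms in auto)

lemma feedback_profile:
  assumes G: "G \<in> profiles"
  shows "feedback k q G \<in> profiles"
proof (rule profilesI)
  show "feedback k q G 0 = 0" by (simp add: feedback_def)
  fix s t assume st: "0 \<le> s" "s \<le> t" "t \<le> l"
  have "feedback k q G t = feedback k q G s + integral {s..t} (\<lambda>r. sw (fst (sol k q G r)))"
    unfolding feedback_def
    by (rule Henstock_Kurzweil_Integration.integral_combine[symmetric])
      (use st G in \<open>auto intro: sw_sol_integrable\<close>)
  moreover have "integral {s..t} (\<lambda>r. e1) \<le> integral {s..t} (\<lambda>r. sw (fst (sol k q G r)))"
    "integral {s..t} (\<lambda>r. sw (fst (sol k q G r))) \<le> integral {s..t} (\<lambda>r. e2)"
    by (intro integral_le integrable_const_ivl sw_sol_integrable G st sw_bounds; fact)+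
  ultimately show "e1 * (t - s) \<le> feedback k q G t - feedback k q G s \<and>
      feedback k q G t - feedback k q G s \<le> e2 * (t - s)"
    using st by (simp add: mult.commute)
qed

lemma feedback_causal:
  assumes G: "G \<in> profiles" "H \<in> profiles" and T: "T \<le> l"
    and eq: "\<And>s. s \<in> {0..T} \<Longrightarrow> G s = H s"
  shows "feedback k q G T = feedback k q H T"
proof -
  have "sol k q G s = sol k q H s" if "s \<in> {0..T}" for s
  proof (rule quasi_sol_unique[OF quasi_sol_subinterval[OF sol(2)[OF G(1)] T]
        quasi_sol_subinterval[OF sol(2)[OF G(2)] T]])
    show "continuous_on {0..T} (coef k G)"
      by (rule continuous_on_subset[OF profile_coef_continuous[OF G(1)]]) (use T in auto)
  qed (use that eq sol(1)[OF G(1)] sol(1)[OF G(2)] in auto)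
  then show ?thesis
    unfolding feedback_def by (intro integral_cong) simp
qed

text \<open>Before time h there is no feedback yet; e1 is one admissible slope for that stretch.
  Afterwards the value at t depends on G only up to t - h.\<close>

definition delayed :: "complex \<Rightarrow> complex \<Rightarrow> real \<Rightarrow> (real \<Rightarrow> real) \<Rightarrow> real \<Rightarrow> real" where
  "delayed k q h G t = (if t \<le> h then e1 * t else e1 * h + feedback k q G (t - h))"

lemma delayed_profile:
  assumes G: "G \<in> profiles" and h: "0 < h"
  shows "delayed k q h G \<in> profiles"
proof (rule profilesI)
  show "delayed k q h G 0 = 0" using h by (simp add: delayed_def)
  note F = feedback_profile[OF G, of k q]
  fix s t assume st: "0 \<le> s" "s \<le> t" "t \<le> l"
  consider "t \<le> h" | "s \<le> h" "h < t" | "h < s" by linarith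
  then show "e1 * (t - s) \<le> delayed k q h G t - delayed k q h G s \<and>
      delayed k q h G t - delayed k q h G s \<le> e2 * (t - s)"
  proof cases
    case 1
    have "e1 * (t - s) \<le> e2 * (t - s)" using e12 st by (intro mult_right_mono) auto
    with 1 st show ?thesis by (simp add: delayed_def right_diff_distrib)
  next
    case 2
    have "e1 * (h - s) \<le> e2 * (h - s)" using e12 2 by (intro mult_right_mono) auto
    with 2 profile_slope[OF F, of 0 "t - h"] profile_0[OF F] st h show ?thesis
      by (simp add: delayed_def right_diff_distrib)
  next
    case 3
    with profile_slope[OF F, of "s - h" "t - h"] st h show ?thesis
      by (simp add: delayed_def)
  qed
qed

text \<open>The delay makes the feedback operator nilpotent up to its fixed point, so finitely many
  iterations suffice.\<close>

lemma delayed_fixpoint: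
  assumes h: "0 < h"
  obtains G where "G \<in> profiles" "\<And>t. t \<in> {0..l} \<Longrightarrow> delayed k q h G t = G t"
proof -
  define H where "H = (\<lambda>n. (delayed k q h ^^ n) (\<lambda>t. e1 * t))"
  have H: "H n \<in> profiles" for n
    by (induction n) (auto simp: H_def profile_linear e12 less_imp_le delayed_profile h)
  have HSuc: "H (Suc n) = delayed k q h (H n)" for n by (simp add: H_def)
  \<comment> \<open>By causality each iteration settles one more stretch of length h. For
    \<open>n = 0\<close> both sides are \<open>e1 * t\<close>.\<close>
  have stab: "H (Suc n) t = H n t" if "0 \<le> t" "t \<le> l" "t \<le> real (Suc n) * h" for n t
    using that
  proof (induction n arbitrary: t)
    case 0
    then show ?case by (simp add: HSuc delayed_def) (simp add: H_def)
  next
    case (Suc n)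
    have "feedback k q (H (Suc n)) (t - h) = feedback k q (H n) (t - h)" if "h < t"
    proof (rule feedback_causal[OF H H])
      fix s assume "s \<in> {0..t - h}"
      then show "H (Suc n) s = H n s"
        using Suc.prems h by (intro Suc.IH) (auto simp: algebra_simps)
    qed (use Suc.prems h in auto)
    then show ?case
      by (auto simp: HSuc[of "Suc n"] HSuc[of n] delayed_def simp del: funpow.simps)
  qed
  obtain n where "l / h \<le> real n" using real_arch_simple by blast
  then have n: "l \<le> real (Suc n) * h" using h by (simp add: field_simps)
  show ?thesis
    by (rule that[OF H[of n]]) (use stab[of _ n] n in \<open>auto simp: HSuc\<close>)
qed

lemma delayed_close:
  assumes G: "G \<in> profiles" and h: "0 < h" and t: "t \<in> {0..l}"
  shows "\<bar>delayed k q h G t - feedback k q G t\<bar> \<le> 2 * e2 * h"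
proof -
  note F = feedback_profile[OF G, of k q]
  show ?thesis
  proof (cases "t \<le> h")
    case True
    have "e1 * t \<le> e2 * h" "e2 * t \<le> e2 * h" "0 \<le> e1 * t"
      using True e1 e12 t by (auto intro!: mult_mono)
    with True profile_slope[OF F, of 0 t] profile_0[OF F] t show ?thesis
      by (simp add: delayed_def)
  next
    case False
    have "e1 * h \<le> e2 * h" "0 \<le> e1 * h" using e1 e12 h by auto
    with False profile_slope[OF F, of "t - h" t] t h show ?thesis
      by (simp add: delayed_def)
  qed
qed

text \<open>\<open>sw\<close> can jump only where Im (p^2) = 0, and the limit solution is there at
  finitely many times because k is nonreal. At all other times the integrands converge, and
  dominated convergence applies.\<close>

lemma feedback_tendsto:
  assumes G: "\<And>n. G n \<in> profiles" "g \<in> profiles" and lim: "uniform_limit {0..l} G g sequentially"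
    and q: "q \<noteq> 0" and k: "Im k \<noteq> 0" and t: "t \<in> {0..l}"
  shows "(\<lambda>n. feedback k q (G n) t) \<longlonglongrightarrow> feedback k q g t"
proof -
  define Z where "Z = {t \<in> {0..l}. Im ((fst (sol k q g t))\<^sup>2) = 0}"
  have Z: "finite Z"
    unfolding Z_def by (rule Im_square_zeros_finite[OF G(2) sol(2)[OF G(2)] sol(1)[OF G(2)] q k])
  \<comment> \<open>Putting 0 at the finitely many exceptional times leaves the integrals unchanged
    and makes the integrands converge at every point.\<close>
  define f where "f = (\<lambda>H s. if s \<in> Z then 0 else sw (fst (sol k q H s)))"
  have f: "f H integrable_on {0..t}" "integral {0..t} (f H) = feedback k q H t" if "H \<in> profiles" for H
  proof -
    have "(\<lambda>s. sw (fst (sol k q H s))) integrable_on {0..t}"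
      by (rule sw_sol_integrable[OF that]) (use t in auto)
    then show "f H integrable_on {0..t}"
      by (rule integrable_spike_finite[OF Z, rotated]) (auto simp: f_def)
    show "integral {0..t} (f H) = feedback k q H t"
      unfolding feedback_def by (rule integral_spike[of Z]) (use Z in \<open>auto simp: f_def negligible_finite\<close>)
  qed
  have "(\<lambda>n. integral {0..t} (f (G n))) \<longlonglongrightarrow> integral {0..t} (f g)"
  proof (rule dominated_convergence(2)[where h = "\<lambda>_. e2"])
    show "norm (f (G n) s) \<le> e2" for n s
      using sw_bounds[of "fst (sol k q (G n) s)"] e1 e12 by (auto simp: f_def)
    show "(\<lambda>n. f (G n) s) \<longlonglongrightarrow> f g s" if s: "s \<in> {0..t}" for s
    proof (cases "s \<in> Z")
      case False
      have sl: "s \<in> {0..l}" using s t by auto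
      have "(\<lambda>n. sol k q (G n) s) \<longlonglongrightarrow> sol k q g s"
        by (rule quasi_sol_tendsto(1)[OF G lim tendsto_const sol(2)[OF G(1)] sol(2)[OF G(2)] _ sl])
          (simp add: sol(1) G)
      then have "(\<lambda>n. sw (fst (sol k q (G n) s))) \<longlonglongrightarrow> sw (fst (sol k q g s))"
        by (intro sw_tendsto tendsto_fst) (use False sl in \<open>auto simp only: Z_def mem_Collect_eq\<close>)
      with False show ?thesis by (simp add: f_def)
    qed (simp add: f_def)
  qed (use f G in auto)
  with f G show ?thesis by simp
qed

text \<open>Each delay 1 / (n + 1) has an exact fixed point. The delayed and the undelayed operator
  differ by at most 2 e2 h, so the uniform limit of a subsequence is a fixed point of
  \<open>feedback\<close>. This takes the place of a fixed point theorem in infinite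
  dimensions.\<close>

lemma bang_exists_nonreal:
  assumes q: "q \<noteq> 0" and k: "Im k \<noteq> 0"
  shows "\<exists>G u. bang k q G u"
proof -
  define h where "h = (\<lambda>n::nat. 1 / real (Suc n))"
  have h: "h n > 0" for n by (simp add: h_def)
  have h0: "h \<longlonglongrightarrow> 0" unfolding h_def by (rule LIMSEQ_Suc[OF lim_1_over_n])
  have "\<exists>G\<in>profiles. \<forall>t\<in>{0..l}. delayed k q (h n) G t = G t" for n
    using delayed_fixpoint[OF h[of n]] by metis
  then obtain G where G: "\<And>n. G n \<in> profiles" "\<And>n t. t \<in> {0..l} \<Longrightarrow> delayed k q (h n) (G n) t = G n t"
    by metis
  obtain g r where g: "g \<in> profiles" "strict_mono (r :: nat \<Rightarrow> nat)"
      "uniform_limit {0..l} (\<lambda>n. G (r n)) g sequentially"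
    by (rule profile_compact[OF G(1)])
  have fixpt: "feedback k q g t = g t" if t: "t \<in> {0..l}" for t
  proof (rule LIMSEQ_unique)
    show "(\<lambda>n. feedback k q (G (r n)) t) \<longlonglongrightarrow> feedback k q g t"
      by (rule feedback_tendsto[OF G(1) g(1,3) q k t])
    have "(\<lambda>n. G (r n) t - feedback k q (G (r n)) t) \<longlonglongrightarrow> 0"
    proof (rule Lim_null_comparison)
      have "norm (G (r n) t - feedback k q (G (r n)) t) \<le> 2 * e2 * h (r n)" for n
        using delayed_close[OF G(1) h t] by (metis G(2)[OF t] real_norm_def)
      then show "\<forall>\<^sub>F n in sequentially. norm (G (r n) t - feedback k q (G (r n)) t) \<le> 2 * e2 * h (r n)"
        by simp
      have "(\<lambda>n. h (r n)) \<longlonglongrightarrow> 0"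
        using LIMSEQ_subseq_LIMSEQ[OF h0 g(2)] by (simp add: comp_def)
      then show "(\<lambda>n. 2 * e2 * h (r n)) \<longlonglongrightarrow> 0"
        using tendsto_mult_right_zero by blast
    qed
    from tendsto_diff[OF tendsto_uniform_limitI[OF g(3) t] this]
    show "(\<lambda>n. feedback k q (G (r n)) t) \<longlonglongrightarrow> g t" by simp
  qed
  define u where "u = sol k q g"
  note u = sol(2)[OF g(1), of k q, folded u_def] sol(1)[OF g(1), of k q, folded u_def]
  define Z where "Z = {t \<in> {0..l}. Im ((fst (u t))\<^sup>2) = 0}"
  have "(g has_vector_derivative sw (fst (u s))) (at s)" if s: "s \<in> {0<..<l} - Z" for s
  proof -
    have nz: "Im ((fst (u s))\<^sup>2) \<noteq> 0" using s by (auto simp del: times_complex.sel simp: Z_def)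
    have "((\<lambda>r. fst (u r)) \<longlongrightarrow> fst (u s)) (at s within {0..l})"
      using quasi_sol_continuous(2)[OF u(1)] s by (auto simp: continuous_on_def)
    then have "((\<lambda>r. sw (fst (u r))) \<longlongrightarrow> sw (fst (u s))) (at s within {0..l})"
      by (rule sw_tendsto[OF _ nz])
    then have "continuous (at s within {0..l}) (\<lambda>r. sw (fst (u r)))"
      by (simp add: continuous_within)
    then have "((\<lambda>t. integral {0..t} (\<lambda>r. sw (fst (u r)))) has_vector_derivative sw (fst (u s))) (at s)"
      by (rule sw_integral_deriv[rotated 2])
        (use s sw_sol_integrable[OF g(1), of 0 l k q] in \<open>auto simp: u_def\<close>)
    then show ?thesis
      by (rule has_vector_derivative_transform_within_open[where S = "{0<..<l}"])
        (use s fixpt in \<open>auto simp: feedback_def u_def\<close>)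
  qed
  moreover have "finite Z" unfolding Z_def by (rule Im_square_zeros_finite[OF g(1) u q k])
  ultimately have "bang k q g u"
    unfolding bang_def using g(1) u by blast
  then show ?thesis by blast
qed

lemma bang_exists: "q \<noteq> 0 \<Longrightarrow> \<exists>G u. bang k q G u"
  using bang_exists_real bang_exists_nonreal by blast

end

section \<open>Absolutely continuous solutions\<close>

text \<open>A gauge integral argument. At points outside N the gauge enforces the linear
  approximation by f'; at points of N it confines the cells to an open set U of small measure
  containing N, and absolute continuity bounds the total increment of f over those cells.\<close>

lemma abs_continuous_ftc:
  fixes f :: "real \<Rightarrow> complex"
  assumes ab: "a \<le> b" and ac: "abs_continuous_on_interval f a b" and N: "negligible N"
    and der: "\<And>x. x \<in> {a..b} - N \<Longrightarrow> (f has_vector_derivative f' x) (at x within {a..b})"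
  shows "(f' has_integral f b - f a) {a..b}"
proof (cases "a = b")
  case True
  then show ?thesis by (simp add: has_integral_refl)
next
  case False
  then have ab': "a < b" using ab by simp
  \<comment> \<open>With the value 0 on N, cells tagged in N contribute nothing but the increments
    of f.\<close>
  define g where "g = (\<lambda>x. if x \<in> N then 0 else f' x)"
  have "(g has_integral f b - f a) {a..b}"
    unfolding has_integral_factor_content_real
  proof (intro allI impI)
    fix e :: real assume e: "0 < e"
    then have "0 < e / 2 * (b - a)" using ab' by simp
    then obtain \<delta> where \<delta>: "\<delta> > 0" "\<And>I. finite I \<Longrightarrow> \<forall>(u, v)\<in>I. a \<le> u \<and> u \<le> v \<and> v \<le> b \<Longrightarrow>
        disjoint_family_on (\<lambda>(u, v). {u<..<v}) I \<Longrightarrow> (\<Sum>(u, v)\<in>I. v - u) < \<delta> \<Longrightarrow>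
        (\<Sum>(u, v)\<in>I. norm (f v - f u)) < e / 2 * (b - a)"
      using ac unfolding abs_continuous_on_interval_def by meson
    have Nnull: "N \<in> null_sets lebesgue" using N by (simp add: negligible_iff_null_sets)
    obtain U where U: "open U" "N \<subseteq> U" "emeasure lebesgue (U - N) < ennreal \<delta>"
      using sets_lebesgue_outer_open[OF null_setsD2[OF Nnull] \<delta>(1)] by metis
    have Usets: "U \<in> sets lebesgue" using U(1) by simp
    have Uless: "emeasure lebesgue U < ennreal \<delta>"
      using U(3) emeasure_Diff_null_set[OF Nnull Usets] by simp
    have "\<exists>d>0. (x \<in> N \<longrightarrow> ball x d \<subseteq> U) \<and> (x \<in> {a..b} - N \<longrightarrow>
        (\<forall>y\<in>{a..b}. norm (y - x) < d \<longrightarrow> norm (f y - f x - (y - x) *\<^sub>R f' x) \<le> e / 2 * norm (y - x)))" for x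
    proof (cases "x \<in> N")
      case True
      then show ?thesis using U(1,2) open_contains_ball by (metis DiffE subsetD)
    next
      case False
      show ?thesis
      proof (cases "x \<in> {a..b}")
        case True
        with der[of x] False e show ?thesis
          unfolding has_vector_derivative_def has_derivative_within_alt
          by (metis DiffI half_gt_zero)
      qed (use False in \<open>auto intro: exI[of _ 1]\<close>)
    qed
    then obtain d where d0: "\<And>x. d x > 0" and dN: "\<And>x. x \<in> N \<Longrightarrow> ball x (d x) \<subseteq> U"
      and dd: "\<And>x y. x \<in> {a..b} - N \<Longrightarrow> y \<in> {a..b} \<Longrightarrow> norm (y - x) < d x \<Longrightarrow>
        norm (f y - f x - (y - x) *\<^sub>R f' x) \<le> e / 2 * norm (y - x)"
      by metis
    show "\<exists>\<gamma>. gauge \<gamma> \<and> (\<forall>p. p tagged_division_of {a..b} \<and> \<gamma> fine p \<longrightarrow>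
        norm ((\<Sum>(x, K)\<in>p. measure lborel K *\<^sub>R g x) - (f b - f a)) \<le> e * measure lborel {a..b})"
    proof (intro exI conjI allI impI; (elim conjE)?)
      show "gauge (\<lambda>x. ball x (d x))" using d0 gauge_ball_dependent by blast
      fix p assume p: "p tagged_division_of {a..b}" and fine: "(\<lambda>x. ball x (d x)) fine p"
      have fin: "finite p" using p by (rule tagged_division_of_finite)
      have K: "x \<in> K" "K = {Inf K..Sup K}" "a \<le> Inf K" "Inf K \<le> Sup K" "Sup K \<le> b" "K \<subseteq> ball x (d x)"
        "measure lborel K = Sup K - Inf K"
        if xK: "(x, K) \<in> p" for x K
      proof -
        obtain u v where uv: "K = {u..v}" using tagged_division_ofD(4)[OF p xK] by auto
        show x: "x \<in> K" using tagged_division_ofD(2)[OF p xK] .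
        have "K \<subseteq> {a..b}" using tagged_division_ofD(3)[OF p xK] .
        then show "K = {Inf K..Sup K}" "a \<le> Inf K" "Inf K \<le> Sup K" "Sup K \<le> b"
          "measure lborel K = Sup K - Inf K"
          using uv x by auto
        show "K \<subseteq> ball x (d x)" using fine xK by (auto simp: fine_def)
      qed
      define T where "T = (\<lambda>(x, K). measure lborel K *\<^sub>R g x - (f (Sup K) - f (Inf K)))"
      define PN where "PN = {(x, K) \<in> p. x \<in> N}"
      \<comment> \<open>Degenerate cells contribute nothing. They are dropped because the
        injectivity of \<open>\<iota>\<close> below is read off from nonempty interiors.\<close>
      define PN' where "PN' = {(x, K) \<in> PN. Inf K < Sup K}"
      define \<iota> where "\<iota> = (\<lambda>(x::real, K::real set). (Inf K, Sup K))"
      have "(\<Sum>(x, K)\<in>p. measure lborel K *\<^sub>R g x) - (f b - f a) = sum T p"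
        unfolding T_def additive_tagged_division_1[OF ab p, of f, symmetric] sum_subtractf[symmetric]
        by (intro sum.cong) auto
      also have "norm \<dots> \<le> (\<Sum>z\<in>p. norm (T z))" by (rule norm_sum)
      also have "\<dots> = (\<Sum>z\<in>p - PN. norm (T z)) + (\<Sum>z\<in>PN. norm (T z))"
        by (rule sum.subset_diff) (auto simp: PN_def fin)
      finally have split: "norm ((\<Sum>(x, K)\<in>p. measure lborel K *\<^sub>R g x) - (f b - f a)) \<le>
        (\<Sum>z\<in>p - PN. norm (T z)) + (\<Sum>z\<in>PN. norm (T z))" .
      have "(\<Sum>z\<in>p - PN. norm (T z)) \<le> (\<Sum>(x, K)\<in>p - PN. e / 2 * (Sup K - Inf K))"
      proof (rule sum_mono, clarify)
        fix x K assume "(x, K) \<in> p" "(x, K) \<notin> PN"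
        then have xN: "x \<notin> N" by (auto simp: PN_def)
        note k = K[OF \<open>(x, K) \<in> p\<close>]
        have Ix: "Inf K \<le> x" "x \<le> Sup K" using k(1,2) by (metis atLeastAtMost_iff)+
        then have x: "Inf K \<le> x" "x \<le> Sup K" "x \<in> {a..b} - N" using k(3,5) xN by auto
        have in_K: "Inf K \<in> K" "Sup K \<in> K" using k(2,4) by (metis atLeastAtMost_iff order.refl)+
        then have near: "norm (Inf K - x) < d x" "norm (Sup K - x) < d x"
          using k(6) by (auto simp: dist_real_def abs_minus_commute)
        have ab_K: "Inf K \<in> {a..b}" "Sup K \<in> {a..b}" using k(3-5) by auto
        have 1: "norm (f (Inf K) - f x - (Inf K - x) *\<^sub>R f' x) \<le> e / 2 * norm (Inf K - x)"
          "norm (f (Sup K) - f x - (Sup K - x) *\<^sub>R f' x) \<le> e / 2 * norm (Sup K - x)"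
          by (fact dd[OF x(3) ab_K(1) near(1)], fact dd[OF x(3) ab_K(2) near(2)])
        have "T (x, K) = (f (Inf K) - f x - (Inf K - x) *\<^sub>R f' x) - (f (Sup K) - f x - (Sup K - x) *\<^sub>R f' x)"
          using xN by (simp add: T_def g_def k(7) algebra_simps)
        then have "norm (T (x, K)) \<le> norm (f (Inf K) - f x - (Inf K - x) *\<^sub>R f' x)
            + norm (f (Sup K) - f x - (Sup K - x) *\<^sub>R f' x)"
          by (simp only: norm_triangle_ineq4)
        also have "\<dots> \<le> e / 2 * norm (Inf K - x) + e / 2 * norm (Sup K - x)"
          by (rule add_mono[OF 1])
        also have "\<dots> = e / 2 * (Sup K - Inf K)"
          unfolding distrib_left[symmetric] using x by simp
        finally show "norm (T (x, K)) \<le> e / 2 * (Sup K - Inf K)" .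
      qed
      also have "\<dots> \<le> (\<Sum>(x, K)\<in>p. e / 2 * (Sup K - Inf K))"
        by (rule sum_mono2) (use fin K(4) e in auto)
      also have "\<dots> = e / 2 * (b - a)"
        using additive_tagged_division_1[OF ab p, of "\<lambda>x. x"]
        by (simp add: sum_distrib_left[symmetric] case_prod_unfold del: times_divide_eq_left)
      finally have regular: "(\<Sum>z\<in>p - PN. norm (T z)) \<le> e / 2 * (b - a)" .
      have "(\<Sum>z\<in>PN. norm (T z)) = (\<Sum>z\<in>PN'. norm (T z))"
      proof (rule sum.mono_neutral_right)
        show "finite PN" using fin by (auto simp: PN_def intro: finite_subset)
        show "\<forall>z\<in>PN - PN'. norm (T z) = 0"
        proof (clarify)
          fix x K assume "(x, K) \<in> PN" "(x, K) \<notin> PN'"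
          then have xK: "(x, K) \<in> p" "x \<in> N" "Inf K = Sup K"
            using K(4)[of x K] by (auto simp: PN_def PN'_def)
          then show "norm (T (x, K)) = 0" using K(7)[OF xK(1)] by (simp add: T_def g_def)
        qed
      qed (auto simp: PN'_def)
      also have "(\<Sum>z\<in>PN'. norm (T z)) = (\<Sum>(u, v)\<in>\<iota> ` PN'. norm (f v - f u))"
      proof -
        have inj: "inj_on \<iota> PN'"
        proof (rule inj_onI, clarify)
          fix x K y L assume A: "(x, K) \<in> PN'" "(y, L) \<in> PN'" "\<iota> (x, K) = \<iota> (y, L)"
          then have xy: "(x, K) \<in> p" "(y, L) \<in> p" "Inf K < Sup K" "Inf K = Inf L" "Sup K = Sup L"
            by (auto simp: PN'_def PN_def \<iota>_def)
          then have "K = L" using K(2)[OF xy(1)] K(2)[OF xy(2)] by simp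
          moreover have "interior K \<noteq> {}"
            using K(2)[OF xy(1)] xy(3) by (metis greaterThanLessThan_empty_iff interior_atLeastAtMost_real linorder_not_le)
          ultimately show "x = y \<and> K = L"
            using tagged_division_ofD(5)[OF p xy(1,2)] by auto
        qed
        show ?thesis
          unfolding sum.reindex[OF inj]
          by (rule sum.cong) (auto simp: PN'_def PN_def T_def g_def \<iota>_def norm_minus_commute)
      qed
      also have "\<dots> < e / 2 * (b - a)"
      proof (rule \<delta>(2))
        show finI: "finite (\<iota> ` PN')" using fin by (auto simp: PN_def PN'_def intro: finite_subset)
        show "\<forall>(u, v)\<in>\<iota> ` PN'. a \<le> u \<and> u \<le> v \<and> v \<le> b"
          using K(3,4,5) by (auto simp: \<iota>_def PN'_def PN_def)
        show disj: "disjoint_family_on (\<lambda>(u, v). {u<..<v}) (\<iota> ` PN')"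
          unfolding disjoint_family_on_def
        proof (intro ballI impI)
          fix i j assume ij: "i \<in> \<iota> ` PN'" "j \<in> \<iota> ` PN'" "i \<noteq> j"
          then obtain x K y L where A: "(x, K) \<in> PN'" "(y, L) \<in> PN'" "i = \<iota> (x, K)" "j = \<iota> (y, L)"
            by auto
          then have xy: "(x, K) \<in> p" "(y, L) \<in> p" "(x, K) \<noteq> (y, L)"
            using ij(3) by (auto simp: PN'_def PN_def)
          have "interior K = {Inf K<..<Sup K}" "interior L = {Inf L<..<Sup L}"
            using K(2)[OF xy(1)] K(2)[OF xy(2)] by (metis interior_atLeastAtMost_real)+
          then show "(case i of (u, v) \<Rightarrow> {u<..<v}) \<inter> (case j of (u, v) \<Rightarrow> {u<..<v}) = {}"
            using tagged_division_ofD(5)[OF p xy] by (simp add: A \<iota>_def)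
        qed
        \<comment> \<open>The open cells tagged in N are disjoint and lie in U, so their total
          length is a measure below \<open>\<delta>\<close>.\<close>
        define B where "B = (\<Union>z\<in>\<iota> ` PN'. (\<lambda>(u, v). {u<..<v}) z)"
        have BU: "B \<subseteq> U"
        proof
          fix r assume "r \<in> B"
          then obtain x K where xK: "(x, K) \<in> p" "x \<in> N" "Inf K < r" "r < Sup K"
            by (auto simp: B_def \<iota>_def PN'_def PN_def)
          then have "r \<in> K" using K(2)[OF xK(1)] by (metis atLeastAtMost_iff less_imp_le)
          then show "r \<in> U" using K(6)[OF xK(1)] dN[OF xK(2)] by blast
        qed
        have Bless: "emeasure lebesgue B < ennreal \<delta>"
          using emeasure_mono[OF BU Usets] Uless by (rule order_le_less_trans)
        then have "ennreal (measure lebesgue B) < ennreal \<delta>"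
          by (subst emeasure_eq_ennreal_measure[symmetric]) (auto simp: top_unique)
        then have "measure lebesgue B < \<delta>" by (simp add: ennreal_less_iff)
        moreover have "measure lebesgue B = (\<Sum>z\<in>\<iota> ` PN'. measure lebesgue ((\<lambda>(u, v). {u<..<v}) z))"
          unfolding B_def by (rule measure_finite_Union[OF finI _ disj]) (auto simp: \<iota>_def PN'_def)
        moreover have "\<dots> = (\<Sum>(u, v)\<in>\<iota> ` PN'. v - u)"
          by (rule sum.cong) (auto simp: \<iota>_def PN'_def)
        ultimately show "(\<Sum>(u, v)\<in>\<iota> ` PN'. v - u) < \<delta>" by simp
      qed
      finally have singular: "(\<Sum>z\<in>PN. norm (T z)) < e / 2 * (b - a)" .
      have "e * measure lborel {a..b} = e / 2 * (b - a) + e / 2 * (b - a)"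
        using ab by simp
      with split regular singular
      show "norm ((\<Sum>(x, K)\<in>p. measure lborel K *\<^sub>R g x) - (f b - f a)) \<le> e * measure lborel {a..b}"
        by linarith
    qed
  qed
  then show ?thesis
    by (rule has_integral_spike[OF N, rotated]) (simp add: g_def)
qed

lemma lipschitz_imp_abs_continuous:
  assumes lip: "\<And>s t. s \<in> {a..b} \<Longrightarrow> t \<in> {a..b} \<Longrightarrow> norm (f t - f s) \<le> L * \<bar>t - s\<bar>"
  shows "abs_continuous_on_interval f a b"
  unfolding abs_continuous_on_interval_def
proof (intro allI impI)
  fix e :: real assume e: "0 < e"
  show "\<exists>d>0. \<forall>I. finite I \<longrightarrow> (\<forall>(u, v)\<in>I. a \<le> u \<and> u \<le> v \<and> v \<le> b) \<longrightarrow>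
      disjoint_family_on (\<lambda>(u, v). {u<..<v}) I \<longrightarrow> (\<Sum>(u, v)\<in>I. v - u) < d \<longrightarrow>
      (\<Sum>(u, v)\<in>I. norm (f v - f u)) < e"
  proof (intro exI[of _ "e / (\<bar>L\<bar> + 1)"] conjI allI impI)
    fix I :: "(real \<times> real) set"
    assume I: "\<forall>(u, v)\<in>I. a \<le> u \<and> u \<le> v \<and> v \<le> b" and less: "(\<Sum>(u, v)\<in>I. v - u) < e / (\<bar>L\<bar> + 1)"
    have "(\<Sum>(u, v)\<in>I. norm (f v - f u)) \<le> (\<Sum>(u, v)\<in>I. (\<bar>L\<bar> + 1) * (v - u))"
    proof (rule sum_mono, clarify)
      fix u v assume "(u, v) \<in> I"
      then have uv: "a \<le> u" "u \<le> v" "v \<le> b" using I by auto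
      then have "norm (f v - f u) \<le> L * \<bar>v - u\<bar>" by (intro lip) auto
      also have "\<dots> \<le> (\<bar>L\<bar> + 1) * (v - u)" using uv by (auto intro!: mult_right_mono)
      finally show "norm (f v - f u) \<le> (\<bar>L\<bar> + 1) * (v - u)" .
    qed
    also have "\<dots> = (\<bar>L\<bar> + 1) * (\<Sum>(u, v)\<in>I. v - u)"
      by (simp add: sum_distrib_left case_prod_unfold)
    also have "\<dots> < e" using less by (simp add: field_simps)
    finally show "(\<Sum>(u, v)\<in>I. norm (f v - f u)) < e" .
  qed (use e in auto)
qed

lemma abs_continuous_subinterval:
  assumes "abs_continuous_on_interval f a b" "a \<le> s" "t \<le> b"
  shows "abs_continuous_on_interval f s t"
  unfolding abs_continuous_on_interval_def
proof (intro allI impI)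
  fix e :: real assume "0 < e"
  then obtain d where d: "d > 0" "\<And>I. finite I \<Longrightarrow> \<forall>(u, v)\<in>I. a \<le> u \<and> u \<le> v \<and> v \<le> b \<Longrightarrow>
        disjoint_family_on (\<lambda>(u, v). {u<..<v}) I \<Longrightarrow> (\<Sum>(u, v)\<in>I. v - u) < d \<Longrightarrow>
        (\<Sum>(u, v)\<in>I. norm (f v - f u)) < e"
    using assms(1) unfolding abs_continuous_on_interval_def by meson
  show "\<exists>d>0. \<forall>I. finite I \<longrightarrow> (\<forall>(u, v)\<in>I. s \<le> u \<and> u \<le> v \<and> v \<le> t) \<longrightarrow>
      disjoint_family_on (\<lambda>(u, v). {u<..<v}) I \<longrightarrow> (\<Sum>(u, v)\<in>I. v - u) < d \<longrightarrow>
      (\<Sum>(u, v)\<in>I. norm (f v - f u)) < e"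
    using d(1)
  proof (intro exI[of _ d] conjI allI impI)
    fix I :: "(real \<times> real) set"
    assume I: "finite I" "\<forall>(u, v)\<in>I. s \<le> u \<and> u \<le> v \<and> v \<le> t"
      "disjoint_family_on (\<lambda>(u, v). {u<..<v}) I" "(\<Sum>(u, v)\<in>I. v - u) < d"
    show "(\<Sum>(u, v)\<in>I. norm (f v - f u)) < e"
      by (rule d(2)[OF I(1) _ I(3,4)]) (use I(2) assms(2,3) in fastforce)
  qed
qed

lemma bounded_derivative_lipschitz:
  fixes f :: "real \<Rightarrow> 'a::real_normed_vector"
  assumes der: "\<And>t. t \<in> {a..b} \<Longrightarrow> (f has_vector_derivative f' t) (at t within {a..b})"
    and B: "\<And>t. t \<in> {a..b} \<Longrightarrow> norm (f' t) \<le> B" and st: "s \<in> {a..b}" "t \<in> {a..b}"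
  shows "norm (f t - f s) \<le> B * \<bar>t - s\<bar>"
proof -
  have "norm (f t - f s) \<le> B * norm (t - s)"
  proof (rule differentiable_bound[of "{a..b}" f "\<lambda>t h. h *\<^sub>R f' t"])
    show "(f has_derivative (\<lambda>h. h *\<^sub>R f' x)) (at x within {a..b})" if "x \<in> {a..b}" for x
      using der[OF that] by (simp add: has_vector_derivative_def)
    have B0: "0 \<le> B" using B[OF st(1)] norm_ge_zero order_trans by blast
    show "onorm (\<lambda>h. h *\<^sub>R f' x) \<le> B" if "x \<in> {a..b}" for x
      by (rule onorm_bound[OF B0]) (use mult_right_mono[OF B[OF that] abs_ge_zero] in \<open>simp add: mult.commute\<close>)
  qed (use st in auto)
  then show ?thesis by simp
qed

text \<open>This serves the quasi-derivative: its summands E' and a E need not be differentiable,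
  but near x it differs from a(x) E, up to a constant, by a term of second order.\<close>

lemma has_vector_derivative_quadratic_perturbation:
  fixes f g :: "real \<Rightarrow> 'a::real_normed_vector"
  assumes g: "(g has_vector_derivative d) (at x within S)"
    and C: "\<And>y. y \<in> S \<Longrightarrow> norm (f y - f x - (g y - g x)) \<le> C * (y - x)\<^sup>2"
  shows "(f has_vector_derivative d) (at x within S)"
proof -
  have "((\<lambda>y. f y - g y) has_derivative (\<lambda>h. 0)) (at x within S)"
    unfolding has_derivative_within_alt
  proof (intro conjI allI impI)
    fix e :: real assume e: "0 < e"
    show "\<exists>d>0. \<forall>y\<in>S. norm (y - x) < d \<longrightarrow> norm (f y - g y - (f x - g x) - 0) \<le> e * norm (y - x)"
    proof (intro exI[of _ "e / (\<bar>C\<bar> + 1)"] conjI ballI impI)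
      fix y assume y: "y \<in> S" "norm (y - x) < e / (\<bar>C\<bar> + 1)"
      have "norm (f y - g y - (f x - g x) - 0) = norm (f y - f x - (g y - g x))"
        by (simp add: algebra_simps)
      also have "\<dots> \<le> C * (y - x)\<^sup>2" by (rule C[OF y(1)])
      also have "\<dots> \<le> ((\<bar>C\<bar> + 1) * \<bar>y - x\<bar>) * \<bar>y - x\<bar>"
        unfolding power2_eq_square by (subst abs_mult_self_eq[symmetric]) (auto simp: mult.assoc intro!: mult_right_mono)
      also have "\<dots> \<le> e * \<bar>y - x\<bar>"
        using y(2) by (intro mult_right_mono) (auto simp: field_simps)
      finally show "norm (f y - g y - (f x - g x) - 0) \<le> e * norm (y - x)" by simp
    qed (use e in auto)
  qed (rule bounded_linear_zero)
  then have "((\<lambda>y. f y - g y) has_vector_derivative 0) (at x within S)"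
    by (simp add: has_vector_derivative_def)
  from has_vector_derivative_add[OF this g] show ?thesis by simp
qed

context cavity_range
begin

section \<open>Passage between wave solutions and profiles\<close>

lemma deriv_on_eq:
  assumes u: "quasi_sol l a u" and P: "\<And>t. t \<in> {0..l} \<Longrightarrow> P t = fst (u t)" and t: "t \<in> {0..l}"
  shows "(P has_vector_derivative slope a u t) (at t within {0..l})" and "deriv_on l P t = slope a u t"
proof -
  show d: "(P has_vector_derivative slope a u t) (at t within {0..l})"
    by (rule has_vector_derivative_transform[OF t _ quasi_sol_deriv(1)[OF u t]]) (rule P)
  show "deriv_on l P t = slope a u t"
    unfolding deriv_on_def by (rule vector_derivative_within_closed_interval[OF l t d])
qed

lemma slope_deriv:
  assumes u: "quasi_sol l (coef k G) u" and s: "s \<in> {0<..<l}"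
    and G: "(G has_vector_derivative e) (at s)"
  shows "(slope (coef k G) u has_vector_derivative - k * of_real e * fst (u s)) (at s)"
proof -
  have sl: "s \<in> {0..l}" using s by auto
  have d: "((\<lambda>t. fst (u t)) has_vector_derivative slope (coef k G) u s) (at s)"
    "((\<lambda>t. snd (u t)) has_vector_derivative k * of_real (G s) * slope (coef k G) u s) (at s)"
    using quasi_sol_deriv[OF u sl] s by (simp_all add: at_within_Icc_at)
  have "((\<lambda>t. k * of_real (G t)) has_vector_derivative k * of_real e) (at s)"
    by (intro has_vector_derivative_mult_right has_vector_derivative_of_real)
      (use G in \<open>simp add: has_real_derivative_iff_has_vector_derivative\<close>)
  from has_vector_derivative_diff[OF d(2) has_vector_derivative_mult[OF this d(1)]]
  show ?thesis unfolding slope_def by (simp add: algebra_simps)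
qed

text \<open>E, G and Q are Lipschitz, hence so is E' = Q - k G E, which gives its absolute
  continuity. The second derivative exists wherever G has one, that is, off a finite and therefore
  null set.\<close>

lemma wave_solutionI:
  assumes G: "G \<in> profiles" and u: "quasi_sol l (coef (\<omega>\<^sup>2 / (of_real c)\<^sup>2) G) u"
    and P: "\<And>t. t \<in> {0..l} \<Longrightarrow> P t = fst (u t)"
    and X: "finite X" and dG: "\<And>s. s \<in> {0<..<l} - X \<Longrightarrow> (G has_vector_derivative \<epsilon> s) (at s)"
  shows "wave_solution l c \<omega> \<epsilon> P"
proof -
  define k where "k = \<omega>\<^sup>2 / (of_real c)\<^sup>2"
  define D where "D = slope (coef k G) u"
  note u = u[folded k_def]
  have dP: "(P has_vector_derivative D t) (at t within {0..l})" "deriv_on l P t = D t"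
    if "t \<in> {0..l}" for t
    using deriv_on_eq[OF u P that] by (simp_all add: D_def)
  have contP: "continuous_on {0..l} P"
    using quasi_sol_continuous(2)[OF u] by (subst continuous_on_cong[OF refl P])
  have contD: "continuous_on {0..l} D"
    unfolding D_def by (rule quasi_sol_continuous(4)[OF u profile_coef_continuous[OF G]])
  obtain B1 where B1: "\<And>t. t \<in> {0..l} \<Longrightarrow> norm (P t) \<le> B1"
    using continuous_on_interval_bounded[OF contP] by blast
  obtain B2 where B2: "\<And>t. t \<in> {0..l} \<Longrightarrow> norm (D t) \<le> B2"
    using continuous_on_interval_bounded[OF contD] by blast
  have lipP: "norm (P t - P s) \<le> B2 * \<bar>t - s\<bar>" if "s \<in> {0..l}" "t \<in> {0..l}" for s t
    by (rule bounded_derivative_lipschitz[OF dP(1) B2 that])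
  have contQ': "continuous_on {0..l} (\<lambda>t. coef k G t * D t)"
    by (intro continuous_on_mult contD profile_coef_continuous G)
  obtain B3 where B3: "\<And>t. t \<in> {0..l} \<Longrightarrow> norm (coef k G t * D t) \<le> B3"
    using continuous_on_interval_bounded[OF contQ'] by blast
  have lipQ: "norm (snd (u t) - snd (u s)) \<le> B3 * \<bar>t - s\<bar>" if "s \<in> {0..l}" "t \<in> {0..l}" for s t
    by (rule bounded_derivative_lipschitz[OF _ B3 that]) (use quasi_sol_deriv(2)[OF u] in \<open>simp add: D_def\<close>)
  have lipD: "norm (D t - D s) \<le> (B3 + norm k * (e2 * B1 + e2 * l * B2)) * \<bar>t - s\<bar>"
    if st: "s \<in> {0..l}" "t \<in> {0..l}" for s t
  proof -
    have "D t - D s = (snd (u t) - snd (u s)) - k * (of_real (G t - G s) * P t + of_real (G s) * (P t - P s))"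
      by (simp add: D_def slope_def P[OF st(1)] P[OF st(2)] algebra_simps)
    also have "norm \<dots> \<le> norm (snd (u t) - snd (u s)) +
        norm k * (\<bar>G t - G s\<bar> * norm (P t) + \<bar>G s\<bar> * norm (P t - P s))"
      by (intro order_trans[OF norm_triangle_ineq4] add_left_mono order_trans[OF norm_mult_ineq]
          mult_left_mono order_trans[OF norm_triangle_ineq])
        (auto simp: norm_mult simp flip: of_real_diff)
    also have "\<dots> \<le> B3 * \<bar>t - s\<bar> + norm k * ((e2 * \<bar>t - s\<bar>) * B1 + (e2 * l) * (B2 * \<bar>t - s\<bar>))"
      using profile_bound[OF G st(1)] e1 e12 l
      by (intro add_mono mult_left_mono mult_mono lipQ lipP B1 st profile_lipschitz[OF G]) auto
    finally show ?thesis by (simp add: algebra_simps)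
  qed
  have lip': "norm (deriv_on l P t - deriv_on l P s) \<le> (B3 + norm k * (e2 * B1 + e2 * l * B2)) * \<bar>t - s\<bar>"
    if "s \<in> {0..l}" "t \<in> {0..l}" for s t
    using lipD[OF that] by (simp only: dP(2)[OF that(1)] dP(2)[OF that(2)])
  have "(deriv_on l P has_vector_derivative - k * of_real (\<epsilon> s) * P s) (at s)"
    if s: "s \<in> {0<..<l} - X" for s
  proof -
    have sl: "s \<in> {0<..<l}" "s \<in> {0..l}" using s by auto
    have "(D has_vector_derivative - k * of_real (\<epsilon> s) * P s) (at s)"
      unfolding D_def P[OF sl(2)] by (rule slope_deriv[OF u sl(1) dG[OF s]])
    then show ?thesis
      by (rule has_vector_derivative_transform_within_open[where S = "{0<..<l}"])
        (use sl dP(2) in auto)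
  qed
  moreover have "AE s in lebesgue_on {0<..<l}. s \<notin> X"
  proof -
    have "X \<in> null_sets lebesgue"
      using X negligible_finite negligible_iff_null_sets by blast
    then have "AE s in lebesgue. s \<notin> X" by (rule AE_not_in)
    then show ?thesis by (subst AE_restrict_space_iff) auto
  qed
  moreover have "AE s in lebesgue_on {0<..<l}. s \<in> {0<..<l}"
    by (rule AE_I2) simp
  ultimately have "AE s in lebesgue_on {0<..<l}.
      (deriv_on l P has_vector_derivative - k * of_real (\<epsilon> s) * P s) (at s)"
    by (auto elim!: eventually_elim2)
  moreover have "P differentiable (at s within {0..l})" if "s \<in> {0..l}" for s
    using dP(1)[OF that] by (rule differentiableI_vector)
  ultimately show ?thesis
    unfolding wave_solution_def k_def[symmetric]
    using lipschitz_imp_abs_continuous[OF lipP] lipschitz_imp_abs_continuous[OF lip'] by blast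
qed

text \<open>With a(x) frozen, Q(y) - Q(x) - a(x) (E(y) - E(x)) is minus the integral of k eps(r)
  (E(r) - E(y)) over r from x to y. As E is Lipschitz, this is of order (y - x)^2, so Q is
  differentiable everywhere, also where E'' does not exist.\<close>

lemma wave_solution_imp_quasi_sol:
  assumes w: "wave_solution l c \<omega> \<epsilon> P" and P0: "P 0 = 0"
    and \<epsilon>: "\<epsilon> \<in> borel_measurable (lebesgue_on {0<..<l})" "\<And>s. e1 \<le> \<epsilon> s" "\<And>s. \<epsilon> s \<le> e2"
  defines "k \<equiv> \<omega>\<^sup>2 / (of_real c)\<^sup>2" and "G \<equiv> \<lambda>t. integral {0..t} \<epsilon>"
    and "u \<equiv> \<lambda>t. (P t, deriv_on l P t + \<omega>\<^sup>2 / (of_real c)\<^sup>2 * of_real (integral {0..t} \<epsilon>) * P t)"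
  shows "G \<in> profiles" and "quasi_sol l (coef k G) u" and "u 0 = (0, deriv_on l P 0)"
    and "slope (coef k G) u t = deriv_on l P t"
proof -
  define D where "D = deriv_on l P"
  have u: "fst (u t) = P t" "snd (u t) = D t + k * of_real (G t) * P t" for t
    by (simp_all add: u_def D_def k_def G_def)
  show slope: "slope (coef k G) u t = deriv_on l P t" for t
    by (simp add: slope_def u D_def)
  show u0: "u 0 = (0, deriv_on l P 0)" by (simp add: u_def P0)
  have \<epsilon>_abs: "\<bar>\<epsilon> s\<bar> \<le> e2" for s
    using \<epsilon>(2)[of s] \<epsilon>(3)[of s] e1 by simp
  have "\<epsilon> integrable_on {0<..<l}"
    by (rule measurable_bounded_by_integrable_imp_integrable[OF \<epsilon>(1), where g = "\<lambda>_. e2"])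
      (use \<epsilon>_abs in \<open>auto simp: integrable_on_open_interval_real\<close>)
  then have \<epsilon>int0: "\<epsilon> integrable_on {0..l}"
    by (simp add: integrable_on_open_interval_real)
  have \<epsilon>int: "\<epsilon> integrable_on {s..t}" if "0 \<le> s" "t \<le> l" for s t
    by (rule integrable_on_subinterval[OF \<epsilon>int0]) (use that in auto)
  have Gdiff: "(\<epsilon> has_integral G t - G s) {s..t}" if st: "0 \<le> s" "s \<le> t" "t \<le> l" for s t
  proof -
    have "integral {0..s} \<epsilon> + integral {s..t} \<epsilon> = integral {0..t} \<epsilon>"
      by (rule Henstock_Kurzweil_Integration.integral_combine) (use st \<epsilon>int in auto)
    then have "G t - G s = integral {s..t} \<epsilon>" by (simp add: G_def)
    then show ?thesis
      using integrable_integral[OF \<epsilon>int[OF st(1,3)]] by simp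
  qed
  show G: "G \<in> profiles"
  proof (rule profilesI)
    show "G 0 = 0" by (simp add: G_def)
    fix s t assume st: "0 \<le> s" "s \<le> t" "t \<le> l"
    have "((\<lambda>_. e1) has_integral e1 * (t - s)) {s..t}" "((\<lambda>_. e2) has_integral e2 * (t - s)) {s..t}"
      using has_integral_const_real[of e1 s t] has_integral_const_real[of e2 s t] st by (simp_all add: mult.commute)
    then show "e1 * (t - s) \<le> G t - G s \<and> G t - G s \<le> e2 * (t - s)"
      using has_integral_le[OF _ Gdiff[OF st] \<epsilon>(2)] has_integral_le[OF Gdiff[OF st] _ \<epsilon>(3)] by blast
  qed
  have dP: "(P has_vector_derivative D t) (at t within {0..l})" if "t \<in> {0..l}" for t
    using w that unfolding wave_solution_def D_def deriv_on_def
    by (auto simp: vector_derivative_works)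
  have contP: "continuous_on {0..l} P"
    using dP has_vector_derivative_continuous continuous_on_eq_continuous_within by blast
  have acD: "abs_continuous_on_interval D 0 l"
    using w by (simp add: wave_solution_def D_def)
  have "AE s in lebesgue_on {0<..<l}. (D has_vector_derivative - k * of_real (\<epsilon> s) * P s) (at s)"
    using w by (simp add: wave_solution_def D_def k_def)
  then have "AE s in lebesgue. s \<in> {0<..<l} \<longrightarrow> (D has_vector_derivative - k * of_real (\<epsilon> s) * P s) (at s)"
    by (subst (asm) AE_restrict_space_iff) auto
  then obtain N0 where N0: "N0 \<in> null_sets lebesgue"
      "\<And>s. s \<in> {0<..<l} - N0 \<Longrightarrow> (D has_vector_derivative - k * of_real (\<epsilon> s) * P s) (at s)"
    unfolding eventually_ae_filter by (auto simp: subset_eq)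
  \<comment> \<open>The equation holds with two-sided derivatives inside the open interval, so the
    endpoints join the exceptional set.\<close>
  define N where "N = N0 \<union> {0, l}"
  have N: "negligible N"
    using N0(1) by (simp add: N_def negligible_iff_null_sets[symmetric])
  have Dint: "((\<lambda>r. - k * of_real (\<epsilon> r) * P r) has_integral D t - D s) {s..t}"
    if st: "0 \<le> s" "s \<le> t" "t \<le> l" for s t
  proof (rule abs_continuous_ftc[OF st(2) abs_continuous_subinterval[OF acD st(1,3)] N])
    show "(D has_vector_derivative - k * of_real (\<epsilon> x) * P x) (at x within {s..t})" if "x \<in> {s..t} - N" for x
      by (rule has_vector_derivative_at_within[OF N0(2)]) (use that st in \<open>auto simp: N_def\<close>)
  qed
  \<comment> \<open>Used twice: with \<open>v = 0\<close> to bound \<open>D\<close>, and with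
    \<open>v = P y\<close> for the quadratic estimate.\<close>
  have key: "norm (D t - D s + k * of_real (G t - G s) * v) \<le> norm k * e2 * B * (t - s)"
    if st: "0 \<le> s" "s \<le> t" "t \<le> l" and B: "\<And>r. r \<in> {s..t} \<Longrightarrow> norm (P r - v) \<le> B" for s t v B
  proof -
    have B0: "0 \<le> B" using B[of s] st norm_ge_zero order_trans by (metis atLeastAtMost_iff order.refl)
    have "((\<lambda>r. k * of_real (\<epsilon> r) * v) has_integral k * of_real (G t - G s) * v) {s..t}"
      by (intro has_integral_mult_left has_integral_mult_right has_integral_of_real Gdiff st)
    from has_integral_add[OF Dint[OF st] this]
    have "((\<lambda>r. - k * of_real (\<epsilon> r) * (P r - v)) has_integral D t - D s + k * of_real (G t - G s) * v) {s..t}"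
      by (simp add: algebra_simps)
    note integral = this
    have "norm (D t - D s + k * of_real (G t - G s) * v) \<le> norm k * e2 * B * measure lborel {s..t}"
    proof (rule has_integral_bound_real[OF _ finite.emptyI integral])
      show "0 \<le> norm k * e2 * B" using e1 e12 B0 by auto
      show "norm (- k * of_real (\<epsilon> r) * (P r - v)) \<le> norm k * e2 * B" if "r \<in> {s..t} - {}" for r
      proof -
        have "norm k * \<bar>\<epsilon> r\<bar> * norm (P r - v) \<le> norm k * e2 * B"
          using B[of r] that e1 e12 by (intro mult_mono \<epsilon>_abs) auto
        then show ?thesis by (simp add: norm_mult)
      qed
    qed
    then show ?thesis using st by simp
  qed
  obtain B1 where B1: "\<And>t. t \<in> {0..l} \<Longrightarrow> norm (P t) \<le> B1"
    using continuous_on_interval_bounded[OF contP] by blast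
  have Dbound: "norm (D t) \<le> norm (D 0) + norm k * e2 * B1 * l" if t: "t \<in> {0..l}" for t
  proof -
    have "0 \<le> B1" using B1[OF t] norm_ge_zero order_trans by blast
    have "norm (D t - D 0) \<le> norm k * e2 * B1 * t"
      using key[of 0 t 0 B1] B1 t by simp
    also have "\<dots> \<le> norm k * e2 * B1 * l"
      using t e1 e12 \<open>0 \<le> B1\<close> by (intro mult_left_mono) auto
    finally show ?thesis using norm_triangle_ineq2[of "D t" "D 0"] by linarith
  qed
  define L where "L = norm (D 0) + norm k * e2 * B1 * l"
  have lipP: "norm (P t - P s) \<le> L * \<bar>t - s\<bar>" if "s \<in> {0..l}" "t \<in> {0..l}" for s t
    unfolding L_def by (rule bounded_derivative_lipschitz[OF dP Dbound that])
  have L0: "0 \<le> L" unfolding L_def using norm_ge_zero Dbound[of 0] l order_trans by (metis atLeastAtMost_iff less_imp_le order.refl)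
  show "quasi_sol l (coef k G) u"
  proof (rule quasi_solI)
    fix x assume x: "x \<in> {0..l}"
    show "((\<lambda>t. fst (u t)) has_vector_derivative slope (coef k G) u x) (at x within {0..l})"
      using dP[OF x] by (simp add: u slope D_def)
    have "((\<lambda>t. coef k G x * P t) has_vector_derivative coef k G x * slope (coef k G) u x) (at x within {0..l})"
      using has_vector_derivative_mult_right[OF dP[OF x]] by (simp add: slope D_def)
    then show "((\<lambda>t. snd (u t)) has_vector_derivative coef k G x * slope (coef k G) u x) (at x within {0..l})"
    proof (rule has_vector_derivative_quadratic_perturbation[where C = "norm k * e2 * L"])
      fix y assume y: "y \<in> {0..l}"
      define m where "m = min x y"
      define M where "M = max x y"
      have mM: "0 \<le> m" "m \<le> M" "M \<le> l" using x y by (auto simp: m_def M_def)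
      have "norm (D M - D m + k * of_real (G M - G m) * P y) \<le> norm k * e2 * (L * (M - m)) * (M - m)"
      proof (rule key[OF mM])
        fix r assume r: "r \<in> {m..M}"
        then have "norm (P r - P y) \<le> L * \<bar>r - y\<bar>" using mM y by (intro lipP) auto
        also have "\<dots> \<le> L * (M - m)" using r L0 by (intro mult_left_mono) (auto simp: m_def M_def)
        finally show "norm (P r - P y) \<le> L * (M - m)" .
      qed
      moreover have "norm (snd (u y) - snd (u x) - (coef k G x * P y - coef k G x * P x)) =
          norm (D M - D m + k * of_real (G M - G m) * P y)"
      proof (cases "x \<le> y")
        case True
        then show ?thesis by (simp add: u m_def M_def algebra_simps)
      next
        case False
        then have "snd (u y) - snd (u x) - (coef k G x * P y - coef k G x * P x) =
            - (D M - D m + k * of_real (G M - G m) * P y)"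
          by (simp add: u m_def M_def algebra_simps)
        then show ?thesis by (simp only: norm_minus_cancel)
      qed
      moreover have "(M - m) * (M - m) = (y - x)\<^sup>2"
        by (cases "x \<le> y") (auto simp: m_def M_def power2_eq_square algebra_simps)
      ultimately show "norm (snd (u y) - snd (u x) - (coef k G x * P y - coef k G x * P x)) \<le>
          norm k * e2 * L * (y - x)\<^sup>2"
        by (simp add: mult.assoc)
    qed
  qed
qed

end

section \<open>Resonances of profiles\<close>

text \<open>The derivative of Q_u E_v - E_u Q_v is -(b - a) (E_u E_v)'. The right side is the
  integral of E_u E_v against d(b - a) after integration by parts.\<close>

lemma wronskian_identity:
  assumes u: "quasi_sol l a u" "fst (u 0) = 0" and v: "quasi_sol l b v" "fst (v 0) = 0"
    and cont: "continuous_on {0..l} a" "continuous_on {0..l} b" and l: "0 \<le> l"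
  shows "slope a u l * fst (v l) - fst (u l) * slope b v l =
    (b l - a l) * (fst (u l) * fst (v l)) -
    integral {0..l} (\<lambda>t. (b t - a t) * (slope a u t * fst (v t) + fst (u t) * slope b v t))"
proof -
  define F where "F = (\<lambda>t. snd (u t) * fst (v t) - fst (u t) * snd (v t))"
  have Q: "snd (u t) = slope a u t + a t * fst (u t)" "snd (v t) = slope b v t + b t * fst (v t)" for t
    by (simp_all add: slope_def)
  define f where "f = (\<lambda>t. (b t - a t) * (slope a u t * fst (v t) + fst (u t) * slope b v t))"
  have "((\<lambda>t. - f t) has_integral F l - F 0) {0..l}"
  proof (rule fundamental_theorem_of_calculus[OF l])
    fix t assume t: "t \<in> {0..l}"
    note du = quasi_sol_deriv[OF u(1) t] and dv = quasi_sol_deriv[OF v(1) t]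
    have "(F has_vector_derivative
        (snd (u t) * slope b v t + a t * slope a u t * fst (v t)) -
        (fst (u t) * (b t * slope b v t) + slope a u t * snd (v t))) (at t within {0..l})"
      unfolding F_def
      by (intro has_vector_derivative_diff has_vector_derivative_mult du dv)
    then show "(F has_vector_derivative - f t) (at t within {0..l})"
      unfolding Q f_def by (simp add: algebra_simps)
  qed
  from integral_unique[OF has_integral_neg[OF this]] have "integral {0..l} f = F 0 - F l"
    by simp
  then show ?thesis
    unfolding f_def[symmetric] by (simp add: F_def Q u(2) v(2) algebra_simps)
qed

lemma slope_diff_bound:
  fixes a b :: complex and x y :: "complex \<times> complex"
  assumes "norm a \<le> R" "norm (a - b) \<le> d" "norm x \<le> B" "norm (x - y) \<le> m" "norm y \<le> B"
  shows "norm ((snd x - a * fst x) - (snd y - b * fst y)) \<le> m + R * m + d * B"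
proof -
  have f: "norm (fst x) \<le> norm x" "norm (snd x) \<le> norm x" for x :: "complex \<times> complex"
    using norm_fst_le[of "fst x" "snd x"] norm_snd_le[of "snd x" "fst x"] by auto
  have "(snd x - a * fst x) - (snd y - b * fst y) = snd (x - y) - a * fst (x - y) - (a - b) * fst y"
    by (simp add: algebra_simps)
  also have "norm \<dots> \<le> norm (snd (x - y)) + norm a * norm (fst (x - y)) + norm (a - b) * norm (fst y)"
    using norm_triangle_ineq4[of "snd (x - y) - a * fst (x - y)" "(a - b) * fst y"]
      norm_triangle_ineq4[of "snd (x - y)" "a * fst (x - y)"] by (simp only: norm_mult)
  also have "\<dots> \<le> m + R * m + d * B"
  proof (intro add_mono mult_mono assms)
    show "norm (snd (x - y)) \<le> m" "norm (fst (x - y)) \<le> m" "norm (fst y) \<le> B"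
      using f[of "x - y"] f[of y] assms by linarith+
    show "0 \<le> R" "0 \<le> d" using assms(1,2) norm_ge_zero order_trans by blast+
  qed auto
  finally show ?thesis .
qed

text \<open>In the Wronskian identity v is replaced by u. Both v - u and b - a are of order d, so
  the error is quadratic. \<open>C\<close> is fixed before b, so that one constant serves all nearby
  coefficients.\<close>

lemma wronskian_linearization:
  assumes u: "quasi_sol l a u" "u 0 = (0, 1)" and a: "continuous_on {0..l} a"
    "\<And>t. t \<in> {0..l} \<Longrightarrow> norm (a t) \<le> R" and l: "0 \<le> l"
  obtains C where "0 \<le> C"
    "\<And>b v d. quasi_sol l b v \<Longrightarrow> v 0 = (0, 1) \<Longrightarrow> continuous_on {0..l} b \<Longrightarrow>
      (\<And>t. t \<in> {0..l} \<Longrightarrow> norm (b t) \<le> R) \<Longrightarrow> (\<And>t. t \<in> {0..l} \<Longrightarrow> norm (a t - b t) \<le> d) \<Longrightarrow>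
      norm ((slope a u l * fst (v l) - fst (u l) * slope b v l) -
        ((b l - a l) * (fst (u l))\<^sup>2 - integral {0..l} (\<lambda>t. (b t - a t) * (2 * fst (u t) * slope a u t))))
      \<le> C * d\<^sup>2"
proof -
  have R0: "0 \<le> R" using a(2)[of 0] l norm_ge_zero order_trans by (metis atLeastAtMost_iff order.refl)
  \<comment> \<open>\<open>B\<close> bounds both solutions and \<open>S\<close> the slope of u;
    \<open>m\<close> and \<open>n\<close> are Lipschitz constants of the solution and of its slope
    with respect to the coefficient.\<close>
  define B where "B = growth_bound l R"
  have B0: "0 \<le> B" by (simp add: B_def growth_bound_def)
  define m where "m = 2 * (1 + R) * B\<^sup>2"
  have m0: "0 \<le> m" using R0 by (simp add: m_def)
  define n where "n = m + R * m + B"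
  have n0: "0 \<le> n" using R0 B0 m0 by (simp add: n_def)
  define S where "S = (1 + R) * B"
  have S0: "0 \<le> S" using R0 B0 by (simp add: S_def)
  have f: "norm (fst x) \<le> norm x" "norm (snd x) \<le> norm x" for x :: "complex \<times> complex"
    using norm_fst_le[of "fst x" "snd x"] norm_snd_le[of "snd x" "fst x"] by auto
  have uB: "norm (u t) \<le> B" if "t \<in> {0..l}" for t
    using quasi_sol_bound[OF u(1) a(2) that] u(2) by (simp add: B_def norm_Pair)
  have SB: "norm (slope a u t) \<le> S" if t: "t \<in> {0..l}" for t
  proof -
    have "norm (slope a u t) \<le> norm (snd (u t)) + norm (a t) * norm (fst (u t))"
      unfolding slope_def by (metis norm_mult norm_triangle_ineq4)
    also have "\<dots> \<le> B + R * B"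
      by (intro add_mono mult_mono a(2)[OF t] order_trans[OF f(1) uB[OF t]] order_trans[OF f(2) uB[OF t]] R0) auto
    finally show ?thesis by (simp add: S_def algebra_simps)
  qed
  show ?thesis
  proof (rule that[of "B * m + (S * m + B * n) * l"])
    show "0 \<le> B * m + (S * m + B * n) * l" using B0 m0 n0 S0 l by simp
    fix b v d
    assume v: "quasi_sol l b v" "v 0 = (0, 1)" and b: "continuous_on {0..l} b"
      "\<And>t. t \<in> {0..l} \<Longrightarrow> norm (b t) \<le> R" and d: "\<And>t. t \<in> {0..l} \<Longrightarrow> norm (a t - b t) \<le> d"
    have d0: "0 \<le> d" using d[of 0] l norm_ge_zero order_trans by (metis atLeastAtMost_iff order.refl)
    have vB: "norm (v t) \<le> B" if "t \<in> {0..l}" for t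
      using quasi_sol_bound[OF v(1) b(2) that] v(2) by (simp add: B_def norm_Pair)
    have uv: "norm (u t - v t) \<le> m * d" if t: "t \<in> {0..l}" for t
      using quasi_sol_stable[OF u(1) v(1) _ a(2) b(2) d t] u(2) v(2) by (simp add: m_def B_def norm_Pair)
    have E: "norm (fst (v t) - fst (u t)) \<le> m * d" if t: "t \<in> {0..l}" for t
      using order_trans[OF f(1) uv[OF t]] by (simp add: norm_minus_commute)
    have D: "norm (slope b v t - slope a u t) \<le> n * d" if t: "t \<in> {0..l}" for t
      using slope_diff_bound[OF a(2)[OF t] d[OF t] uB[OF t] uv[OF t] vB[OF t]]
      by (simp add: slope_def n_def algebra_simps norm_minus_commute)
    note contu = quasi_sol_continuous(2)[OF u(1)] quasi_sol_continuous(4)[OF u(1) a(1)]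
    note contv = quasi_sol_continuous(2)[OF v(1)] quasi_sol_continuous(4)[OF v(1) b(1)]
    let ?f = "\<lambda>t. (b t - a t) * (slope a u t * (fst (v t) - fst (u t)) + fst (u t) * (slope b v t - slope a u t))"
    have eq: "(slope a u l * fst (v l) - fst (u l) * slope b v l) -
        ((b l - a l) * (fst (u l))\<^sup>2 - integral {0..l} (\<lambda>t. (b t - a t) * (2 * fst (u t) * slope a u t))) =
        (b l - a l) * (fst (u l) * (fst (v l) - fst (u l))) - integral {0..l} ?f"
    proof -
      define f1 where "f1 = (\<lambda>t. (b t - a t) * (slope a u t * fst (v t) + fst (u t) * slope b v t))"
      define f2 where "f2 = (\<lambda>t. (b t - a t) * (2 * fst (u t) * slope a u t))"
      have "integral {0..l} (\<lambda>t. f1 t - f2 t) = integral {0..l} f1 - integral {0..l} f2"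
        unfolding f1_def f2_def
        by (intro integral_diff integrable_continuous_real continuous_on_mult continuous_on_add
            continuous_on_diff continuous_on_const contu contv a(1) b(1))
      moreover have "(\<lambda>t. f1 t - f2 t) = ?f"
        unfolding f1_def f2_def by (rule ext) (simp add: ring_distribs mult_ac)
      ultimately have diff: "integral {0..l} f1 - integral {0..l} f2 = integral {0..l} ?f"
        by (simp only:)
      have wronskian: "slope a u l * fst (v l) - fst (u l) * slope b v l =
        (b l - a l) * (fst (u l) * fst (v l)) -
        integral {0..l} (\<lambda>t. (b t - a t) * (slope a u t * fst (v t) + fst (u t) * slope b v t))"
        by (rule wronskian_identity[OF u(1) _ v(1) _ a(1) b(1) l]) (simp_all add: u v)
      have "W - (x * e\<^sup>2 - J2) = x * (e * (y - e)) - J"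
        if "J1 - J2 = J" "W = x * (e * y) - J1" for W x e y J1 J2 J :: complex
        using that by (auto simp: power2_eq_square algebra_simps)
      from this[OF diff[unfolded f1_def f2_def] wronskian] show ?thesis .
    qed
    have ll: "l \<in> {0..l}" using l by simp
    have boundary: "norm ((b l - a l) * (fst (u l) * (fst (v l) - fst (u l)))) \<le> d * (B * (m * d))"
      unfolding norm_mult using d[OF ll] order_trans[OF f(1) uB[OF ll]] E[OF ll] d0 B0 m0
      by (intro mult_mono) (auto simp: norm_minus_commute)
    have inner: "norm (integral {0..l} ?f) \<le> d * (S * (m * d) + B * (n * d)) * (l - 0)"
    proof (rule integral_bound[OF l])
      show "continuous_on {0..l} ?f"
        by (intro continuous_intros contu contv a(1) b(1))
      fix t assume t: "t \<in> {0..l}"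
      have "norm (slope a u t * (fst (v t) - fst (u t)) + fst (u t) * (slope b v t - slope a u t)) \<le>
          norm (slope a u t) * norm (fst (v t) - fst (u t)) + norm (fst (u t)) * norm (slope b v t - slope a u t)"
        by (metis norm_mult norm_triangle_ineq)
      also have "\<dots> \<le> S * (m * d) + B * (n * d)"
        by (intro add_mono mult_mono SB E D t order_trans[OF f(1) uB] S0 B0) auto
      finally show "norm (?f t) \<le> d * (S * (m * d) + B * (n * d))"
        unfolding norm_mult using d[OF t] d0
        by (intro mult_mono) (auto simp: norm_minus_commute)
    qed
    have "norm ((b l - a l) * (fst (u l) * (fst (v l) - fst (u l))) - integral {0..l} ?f)
        \<le> d * (B * (m * d)) + d * (S * (m * d) + B * (n * d)) * (l - 0)"
      by (rule order_trans[OF norm_triangle_ineq4 add_mono[OF boundary inner]])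
    then show "norm ((slope a u l * fst (v l) - fst (u l) * slope b v l) -
        ((b l - a l) * (fst (u l))\<^sup>2 - integral {0..l} (\<lambda>t. (b t - a t) * (2 * fst (u t) * slope a u t))))
      \<le> (B * m + (S * m + B * n) * l) * d\<^sup>2"
      unfolding eq by (simp add: algebra_simps power2_eq_square)
  qed
qed

text \<open>The final theorem takes \<open>sqrt \<epsilon>inf / c\<close> for
  \<open>\<kappa>\<close>.\<close>

locale resonator = cavity_range +
  fixes c \<kappa> :: real
  assumes c: "0 < c" and \<kappa>: "0 < \<kappa>"
begin

definition wavenum :: "complex \<Rightarrow> complex" where
  "wavenum z = z\<^sup>2 / (of_real c)\<^sup>2"

text \<open>The mismatch in the boundary condition at l for the solution with E(0) = 0 and E'(0) =
  1. Every eigenfunction is a multiple of this solution, so its zeros are exactly the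
  eigenvalues.\<close>

definition bc :: "complex \<Rightarrow> (real \<Rightarrow> real) \<Rightarrow> complex" where
  "bc z G = \<i> * z * of_real \<kappa> * fst (sol (wavenum z) 1 G l)
     - slope (coef (wavenum z) G) (sol (wavenum z) 1 G) l"

definition resonance :: "complex \<Rightarrow> (real \<Rightarrow> real) \<Rightarrow> bool" where
  "resonance z G \<longleftrightarrow> G \<in> profiles \<and> bc z G = 0"

lemma sol_unique:
  assumes G: "G \<in> profiles" and u: "quasi_sol l (coef k G) u" "u 0 = (0, q)" and t: "t \<in> {0..l}"
  shows "fst (u t) = q * fst (sol k 1 G t)" "slope (coef k G) u t = q * slope (coef k G) (sol k 1 G) t"
proof -
  have "u t = (q * fst (sol k 1 G t), q * snd (sol k 1 G t))"
    by (rule quasi_sol_unique[OF u(1) quasi_sol_scale[OF sol(2)[OF G]] _ profile_coef_continuous[OF G] _ t])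
      (simp_all add: u sol(1)[OF G])
  then show "fst (u t) = q * fst (sol k 1 G t)" "slope (coef k G) u t = q * slope (coef k G) (sol k 1 G) t"
    by (simp_all add: slope_def algebra_simps)
qed

lemma bc_scale:
  assumes G: "G \<in> profiles" and u: "quasi_sol l (coef (wavenum z) G) u" "u 0 = (0, q)"
  shows "\<i> * z * of_real \<kappa> * fst (u l) - slope (coef (wavenum z) G) u l = q * bc z G"
proof -
  have ll: "l \<in> {0..l}" using l by simp
  show ?thesis
    unfolding sol_unique[OF G u ll] bc_def by (simp add: algebra_simps)
qed

lemma bc_tendsto:
  assumes G: "\<And>n. G n \<in> profiles" "g \<in> profiles"
    and lim: "uniform_limit {0..l} G g sequentially" "z \<longlonglongrightarrow> z0"
  shows "(\<lambda>n. bc (z n) (G n)) \<longlonglongrightarrow> bc z0 g"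
proof -
  have k: "(\<lambda>n. wavenum (z n)) \<longlonglongrightarrow> wavenum z0"
    unfolding wavenum_def by (intro tendsto_intros lim(2)) (use c in simp)
  have ll: "l \<in> {0..l}" using l by simp
  have "(\<lambda>n. sol (wavenum (z n)) 1 (G n) l) \<longlonglongrightarrow> sol (wavenum z0) 1 g l"
    "(\<lambda>n. slope (coef (wavenum (z n)) (G n)) (sol (wavenum (z n)) 1 (G n)) l)
      \<longlonglongrightarrow> slope (coef (wavenum z0) g) (sol (wavenum z0) 1 g) l"
    by (rule quasi_sol_tendsto[OF G lim(1) k sol(2)[OF G(1)] sol(2)[OF G(2)] _ ll]; simp add: sol(1) G)+
  then show ?thesis
    unfolding bc_def by (intro tendsto_intros tendsto_fst lim(2))
qed

lemma resonance_end_nonzero: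
  assumes r: "resonance z G"
  shows "fst (sol (wavenum z) 1 G l) \<noteq> 0"
    and "slope (coef (wavenum z) G) (sol (wavenum z) 1 G) l = \<i> * z * of_real \<kappa> * fst (sol (wavenum z) 1 G l)"
proof -
  have G: "G \<in> profiles" and b: "bc z G = 0" using r by (auto simp: resonance_def)
  show eq: "slope (coef (wavenum z) G) (sol (wavenum z) 1 G) l = \<i> * z * of_real \<kappa> * fst (sol (wavenum z) 1 G l)"
    using b by (simp add: bc_def)
  show "fst (sol (wavenum z) 1 G l) \<noteq> 0"
    using quasi_sol_nonzero(2)[OF sol(2)[OF G] profile_coef_continuous[OF G], of l "wavenum z" 1] eq l
    by (auto simp: sol(1)[OF G] zero_prod_def)
qed

text \<open>The flux identity on [0, l] reads i z n = I - z^2 m with n > 0 and I, m >= 0. If Re z is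
  nonzero, the imaginary part gives n = - 2 m Im z. If Re z = 0 and Im z >= 0, the real part leaves
  only z = 0.\<close>

lemma resonance_Im_neg:
  assumes r: "resonance z G"
  shows "Im z < 0"
proof (rule ccontr)
  assume "\<not> Im z < 0"
  then have \<tau>: "0 \<le> Im z" by simp
  have G: "G \<in> profiles" using r by (auto simp: resonance_def)
  define k where "k = wavenum z"
  define u where "u = sol k 1 G"
  note u = sol(2)[OF G, of k 1, folded u_def] sol(1)[OF G, of k 1, folded u_def]
  note e = resonance_end_nonzero[OF r, folded k_def, folded u_def]
  define I where "I = integral {0..l} (\<lambda>r. (cmod (slope (coef k G) u r))\<^sup>2)"
  obtain x where "x \<in> {0..l}"
    and flux: "slope (coef k G) u l * cnj (fst (u l)) - slope (coef k G) u 0 * cnj (fst (u 0))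
      = of_real I - k * of_real ((G l - G 0) * (cmod (fst (u x)))\<^sup>2)"
    unfolding I_def using profile_flux[OF G u(1), of 0 l] l by (metis less_imp_le order.refl)
  define m where "m = G l * (cmod (fst (u x)))\<^sup>2 / c\<^sup>2"
  have m: "0 \<le> m" using profile_bound(1)[OF G, of l] l by (simp add: m_def)
  have I: "0 \<le> I" unfolding I_def by (rule integral_nonneg)
      (auto intro!: integrable_continuous_real continuous_intros quasi_sol_continuous(4)[OF u(1)] profile_coef_continuous[OF G])
  define n where "n = \<kappa> * (cmod (fst (u l)))\<^sup>2"
  have n: "0 < n" using \<kappa> e(1) by (simp add: n_def)
  have "slope (coef k G) u l * cnj (fst (u l)) = \<i> * z * of_real \<kappa> * (fst (u l) * cnj (fst (u l)))"
    by (simp add: e(2))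
  also have "fst (u l) * cnj (fst (u l)) = of_real ((cmod (fst (u l)))\<^sup>2)"
    by (simp only: complex_norm_square)
  finally have "\<i> * z * of_real n = of_real I - k * of_real (G l * (cmod (fst (u x)))\<^sup>2)"
    using flux u(2) profile_0[OF G] by (simp add: n_def mult.assoc)
  also have "k * of_real (G l * (cmod (fst (u x)))\<^sup>2) = z\<^sup>2 * of_real m"
    by (simp add: k_def wavenum_def m_def)
  finally have eq: "\<i> * z * of_real n = of_real I - z\<^sup>2 * of_real m" .
  have re: "- Im z * n = I - ((Re z)\<^sup>2 - (Im z)\<^sup>2) * m" and im: "Re z * n = - 2 * Re z * Im z * m"
    using arg_cong[OF eq, of Re] arg_cong[OF eq, of Im] by (simp_all add: power2_eq_square)
  show False
  proof (cases "Re z = 0")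
    case False
    have "Re z * n = Re z * (- 2 * (Im z * m))" using im by (simp add: mult_ac)
    with False have "n = - 2 * (Im z * m)" using mult_left_cancel by blast
    moreover have "0 \<le> Im z * m" using \<tau> m by simp
    ultimately show False using n by simp
  next
    case True
    then have "- Im z * n = I + (Im z)\<^sup>2 * m" using re by simp
    moreover have "0 \<le> Im z * n" "0 \<le> (Im z)\<^sup>2 * m" using \<tau> m n by auto
    ultimately have "Im z * n = 0" using I by linarith
    then have "z = 0" using n True by (simp add: complex_eq_iff)
    \<comment> \<open>For z = 0 the solution is E(t) = t, whose slope 1 at l contradicts the
      boundary condition E'(l) = 0.\<close>
    have v: "quasi_sol l (coef 0 G) (\<lambda>t. (of_real t, 1))"
      by (rule quasi_solI) (auto simp: slope_def intro!: derivative_eq_intros)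
    have "slope (coef 0 G) (\<lambda>t. (of_real t, 1)) l = 1 * slope (coef 0 G) (sol 0 1 G) l"
      by (rule sol_unique(2)[OF G v]) (use l in auto)
    with e(2) \<open>z = 0\<close> show False by (simp add: u_def k_def wavenum_def) (simp add: slope_def)
  qed
qed

text \<open>The rates are bounded below by \<open>resonance_Im_neg\<close>, and they form a closed
  set: profiles of resonances with converging rates subconverge uniformly, and \<open>bc\<close>
  passes to the limit. So the infimum is attained.\<close>

lemma minimal_resonance_exists:
  assumes "\<exists>\<beta> G. resonance (Complex \<alpha> (- \<beta>)) G"
  obtains \<beta>0 G where "resonance (Complex \<alpha> (- \<beta>0)) G"
    "\<And>\<beta> G. resonance (Complex \<alpha> (- \<beta>)) G \<Longrightarrow> \<beta>0 \<le> \<beta>"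
proof -
  define B where "B = {\<beta>. \<exists>G. resonance (Complex \<alpha> (- \<beta>)) G}"
  have bdd: "bdd_below B"
    unfolding bdd_below_def B_def using resonance_Im_neg by (force intro!: exI[of _ 0])
  have "closed B"
    unfolding closed_sequential_limits
  proof (intro allI impI; elim conjE)
    fix \<beta> \<beta>l assume \<beta>: "\<forall>n. \<beta> n \<in> B" and lim: "\<beta> \<longlonglongrightarrow> \<beta>l"
    then have "\<forall>n. \<exists>G. resonance (Complex \<alpha> (- \<beta> n)) G" by (auto simp: B_def)
    then obtain G where G: "\<And>n. resonance (Complex \<alpha> (- \<beta> n)) (G n)" by metis
    have Gp: "G n \<in> profiles" for n using G[of n] by (simp add: resonance_def)
    obtain g r where g: "g \<in> profiles" "strict_mono (r :: nat \<Rightarrow> nat)"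
        "uniform_limit {0..l} (\<lambda>n. G (r n)) g sequentially"
      by (rule profile_compact[OF Gp])
    have "(\<lambda>n. \<beta> (r n)) \<longlonglongrightarrow> \<beta>l" using LIMSEQ_subseq_LIMSEQ[OF lim g(2)] by (simp add: comp_def)
    then have "(\<lambda>n. Complex \<alpha> (- \<beta> (r n))) \<longlonglongrightarrow> Complex \<alpha> (- \<beta>l)"
      by (intro tendsto_Complex tendsto_intros)
    from bc_tendsto[OF Gp g(1,3) this]
    have "bc (Complex \<alpha> (- \<beta>l)) g = 0"
      using G by (simp add: resonance_def LIMSEQ_const_iff)
    then show "\<beta>l \<in> B" using g(1) by (auto simp: B_def resonance_def)
  qed
  then have "Inf B \<in> B"
    using assms bdd by (intro closed_contains_Inf) (auto simp: B_def)
  then obtain G where "resonance (Complex \<alpha> (- Inf B)) G" by (auto simp: B_def)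
  then show ?thesis
    by (rule that) (auto simp: B_def intro!: cInf_lower bdd[unfolded B_def])
qed

end

text \<open>If the interior is empty, S lies in a hyperplane, which passes through 0. Otherwise the
  interior is separated from 0 and its closure contains S. Thus S may fail to be closed.\<close>

lemma separation_from_non_interior:
  fixes S :: "'a::euclidean_space set"
  assumes "convex S" "0 \<in> S" "0 \<notin> interior S"
  obtains a where "a \<noteq> 0" "\<And>x. x \<in> S \<Longrightarrow> 0 \<le> inner a x"
proof (cases "interior S = {}")
  case True
  then obtain a b where a: "a \<noteq> 0" "S \<subseteq> {x. inner a x = b}"
    using empty_interior_subset_hyperplane[OF assms(1)] by blast
  then have "b = 0" using assms(2) by auto
  with a show ?thesis by (intro that[of a]) auto
next
  case False
  obtain a where a: "a \<noteq> 0" "\<And>x. x \<in> interior S \<Longrightarrow> 0 \<le> inner a x"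
    using separating_hyperplane_set_0[OF convex_interior[OF assms(1)] assms(3)] by auto
  have "closure (interior S) \<subseteq> {x. 0 \<le> inner a x}"
    by (rule closure_minimal) (use a(2) closed_halfspace_ge[of 0 a] in \<open>auto simp: inner_commute\<close>)
  moreover have "S \<subseteq> closure (interior S)"
    using convex_closure_interior[OF assms(1) False] closure_subset by blast
  ultimately show ?thesis by (intro that[OF a(1)]) auto
qed

context resonator
begin

section \<open>First variation of the boundary condition\<close>

text \<open>The integral of E^2 against dH, taken by parts. E belongs to the fixed profile G, so the
  expression is linear in H.\<close>

definition energy :: "complex \<Rightarrow> (real \<Rightarrow> real) \<Rightarrow> (real \<Rightarrow> real) \<Rightarrow> complex" where
  "energy k G H = of_real (H l) * (fst (sol k 1 G l))\<^sup>2
     - integral {0..l} (\<lambda>t. of_real (H t) * (2 * fst (sol k 1 G t) * slope (coef k G) (sol k 1 G) t))"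

lemma energy_integrable:
  assumes "G \<in> profiles" "continuous_on {0..l} H"
  shows "(\<lambda>t. of_real (H t) * (2 * fst (sol k 1 G t) * slope (coef k G) (sol k 1 G) t)) integrable_on {0..l}"
  by (intro integrable_continuous_real continuous_intros assms(2) quasi_sol_continuous(2)[OF sol(2)[OF assms(1)]]
      quasi_sol_continuous(4)[OF sol(2)[OF assms(1)]] profile_coef_continuous assms(1))

lemma energy_sum:
  assumes G: "G \<in> profiles" and H: "\<And>i. i \<in> I \<Longrightarrow> continuous_on {0..l} (H i)" and I: "finite I"
  shows "energy k G (\<lambda>t. \<Sum>i\<in>I. w i * H i t) = (\<Sum>i\<in>I. of_real (w i) * energy k G (H i))"
proof -
  let ?g = "\<lambda>t. 2 * fst (sol k 1 G t) * slope (coef k G) (sol k 1 G) t"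
  have "integral {0..l} (\<lambda>t. of_real (\<Sum>i\<in>I. w i * H i t) * ?g t) =
      integral {0..l} (\<lambda>t. \<Sum>i\<in>I. of_real (w i) * (of_real (H i t) * ?g t))"
    by (simp add: sum_distrib_right mult.assoc)
  also have "\<dots> = (\<Sum>i\<in>I. integral {0..l} (\<lambda>t. of_real (w i) * (of_real (H i t) * ?g t)))"
    by (intro integral_sum I integrable_on_mult_right energy_integrable G H)
  also have "\<dots> = (\<Sum>i\<in>I. of_real (w i) * integral {0..l} (\<lambda>t. of_real (H i t) * ?g t))"
    by simp
  finally show ?thesis
    by (simp add: energy_def sum_distrib_right sum_subtractf right_diff_distrib mult.assoc)
qed

lemma energy_bound:
  assumes G: "G \<in> profiles"
  obtains M where "0 \<le> M" "\<And>H. H \<in> profiles \<Longrightarrow> norm (energy k G H) \<le> M"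
proof -
  let ?g = "\<lambda>t. 2 * fst (sol k 1 G t) * slope (coef k G) (sol k 1 G) t"
  have cont: "continuous_on {0..l} ?g"
    by (intro continuous_intros quasi_sol_continuous(2)[OF sol(2)[OF G]]
      quasi_sol_continuous(4)[OF sol(2)[OF G]] profile_coef_continuous G)
  obtain N where N: "\<And>t. t \<in> {0..l} \<Longrightarrow> norm (?g t) \<le> N"
    using continuous_on_interval_bounded[OF cont] by blast
  have N0: "0 \<le> N" using N[of 0] l norm_ge_zero order_trans by (metis atLeastAtMost_iff less_imp_le order.refl)
  define e where "e = norm ((fst (sol k 1 G l))\<^sup>2)"
  show ?thesis
  proof (rule that[of "e2 * l * e + e2 * l * N * (l - 0)"])
    have el: "0 \<le> e2 * l" using e1 e12 l by simp
    show "0 \<le> e2 * l * e + e2 * l * N * (l - 0)" using el N0 l by (simp add: e_def)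
    fix H assume H: "H \<in> profiles"
    have "norm (of_real (H l) * (fst (sol k 1 G l))\<^sup>2) \<le> e2 * l * e"
      using profile_bound[OF H, of l] l by (simp add: norm_mult e_def mult_right_mono)
    moreover have "norm (integral {0..l} (\<lambda>t. of_real (H t) * ?g t)) \<le> e2 * l * N * (l - 0)"
    proof (rule integral_bound)
      show "continuous_on {0..l} (\<lambda>t. of_real (H t) * ?g t)"
        by (intro continuous_on_mult cont continuous_on_of_real profile_continuous H)
      show "norm (of_real (H t) * ?g t) \<le> e2 * l * N" if t: "t \<in> {0..l}" for t
      proof -
        have "norm (complex_of_real (H t) * ?g t) = \<bar>H t\<bar> * norm (?g t)" by (simp only: norm_mult norm_of_real)
        also have "\<dots> \<le> e2 * l * N"
          using profile_bound[OF H t] by (intro mult_mono N t el) auto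
        finally show ?thesis .
      qed
    qed (use l in simp)
    ultimately show "norm (energy k G H) \<le> e2 * l * e + e2 * l * N * (l - 0)"
      unfolding energy_def by (rule order_trans[OF norm_triangle_ineq4 add_mono])
  qed
qed

text \<open>If the first variations of the boundary condition cover a neighbourhood of 0, Brouwer's theorem
  restores the boundary condition after a small change of the frequency.\<close>

lemma resonance_open:
  assumes res: "resonance z G0" and k0: "wavenum z \<noteq> 0" and r0: "0 < r0"
    and G: "\<And>i. i < 5 \<Longrightarrow> G i \<in> profiles" "G (0::nat) = G0"
    and dir: "energy (wavenum z) G0 (G 1) - energy (wavenum z) G0 G0 = of_real r0"
      "energy (wavenum z) G0 (G 2) - energy (wavenum z) G0 G0 = - of_real r0"
      "energy (wavenum z) G0 (G 3) - energy (wavenum z) G0 G0 = \<i> * of_real r0"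
      "energy (wavenum z) G0 (G 4) - energy (wavenum z) G0 G0 = - \<i> * of_real r0"
  shows "\<exists>\<delta>>0. \<forall>z'. norm (z' - z) < \<delta> \<longrightarrow> (\<exists>G'. resonance z' G')"
proof -
  define k where "k = wavenum z"
  have k: "k \<noteq> 0" using k0 by (simp add: k_def)
  have G0: "G0 \<in> profiles" using res by (simp add: resonance_def)
  define u where "u = sol k 1 G0"
  note u = sol(2)[OF G0, of k 1, folded u_def] sol(1)[OF G0, of k 1, folded u_def]
  define \<Lambda> where "\<Lambda> = energy k G0"
  \<comment> \<open>Piecewise linear coordinates: positive and negative parts of Re x and Im x
    weight the four axis directions, and the remaining weight goes to \<open>G0\<close>. The profile
    \<open>Gx x\<close> then has first variation exactly x, and the weights are nonnegative for |x|
    <= r0 / 2.\<close>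
  define w where "w = (\<lambda>(i::nat) x::complex. if i = 1 then max (Re x) 0 / r0 else if i = 2 then max (- Re x) 0 / r0
     else if i = 3 then max (Im x) 0 / r0 else if i = 4 then max (- Im x) 0 / r0
     else 1 - (\<bar>Re x\<bar> + \<bar>Im x\<bar>) / r0)"
  define Gx where "Gx = (\<lambda>x t. \<Sum>i<5. w i x * G i t)"
  have sum5: "(\<Sum>i<5. f i) = f 0 + f 1 + f 2 + f 3 + f (4::nat)" for f :: "nat \<Rightarrow> 'b::ab_group_add"
    by (simp add: eval_nat_numeral lessThan_Suc algebra_simps)
  have maxabs: "max r 0 + max (- r) 0 = \<bar>r\<bar>" "max r 0 - max (- r) 0 = r" for r :: real by auto
  have w_sum: "(\<Sum>i<5. w i x) = 1" for x
    unfolding sum5 w_def using maxabs(1)[of "Re x"] maxabs(1)[of "Im x"]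
    by (simp add: add_divide_distrib[symmetric] diff_divide_distrib[symmetric] algebra_simps)
  have abs2: "\<bar>Re x\<bar> + \<bar>Im x\<bar> \<le> 2 * norm x" for x
    using abs_Re_le_cmod[of x] abs_Im_le_cmod[of x] by linarith
  have w_nonneg: "0 \<le> w i x" if "norm x \<le> r0 / 2" for i x
  proof -
    have "(\<bar>Re x\<bar> + \<bar>Im x\<bar>) / r0 \<le> 1" using abs2[of x] that r0 by (simp add: divide_simps)
    then show ?thesis using r0 by (simp add: w_def)
  qed
  have Gxp: "Gx x \<in> profiles" if "norm x \<le> r0 / 2" for x
    unfolding Gx_def by (rule profile_convex_sum) (use G w_nonneg[OF that] w_sum in auto)
  have \<Lambda>x: "\<Lambda> (Gx x) - \<Lambda> G0 = x" for x
  proof -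
    have "\<Lambda> (Gx x) = (\<Sum>i<5. of_real (w i x) * \<Lambda> (G i))"
      unfolding \<Lambda>_def Gx_def by (rule energy_sum[OF G0]) (use G(1) profile_continuous in auto)
    also have "\<dots> = (\<Sum>i<5. of_real (w i x) * (\<Lambda> (G i) - \<Lambda> G0)) + of_real (\<Sum>i<5. w i x) * \<Lambda> G0"
      by (simp add: right_diff_distrib sum_subtractf sum_distrib_right)
    also have "(\<Sum>i<5. of_real (w i x) * (\<Lambda> (G i) - \<Lambda> G0)) =
        of_real (max (Re x) 0 - max (- Re x) 0) + \<i> * of_real (max (Im x) 0 - max (- Im x) 0)"
      unfolding sum5 G(2) dir[folded k_def, folded \<Lambda>_def] using r0
      by (simp add: w_def algebra_simps)
    also have "\<dots> = x" unfolding maxabs by (simp add: complex_eq_iff)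
    finally show ?thesis by (simp add: w_sum)
  qed
  define M where "M = 2 * (e2 * l) / r0"
  have M0: "0 \<le> M" using e1 e12 l r0 by (simp add: M_def)
  have Gdist: "\<bar>Gx x t - G0 t\<bar> \<le> M * norm x" if t: "t \<in> {0..l}" for x t
  proof -
    have "Gx x t - G0 t = (\<Sum>i<5. w i x * (G i t - G0 t))"
      using w_sum[of x] by (simp add: Gx_def right_diff_distrib sum_subtractf flip: sum_distrib_right)
    also have "\<dots> = w 1 x * (G 1 t - G0 t) + w 2 x * (G 2 t - G0 t) + w 3 x * (G 3 t - G0 t) + w 4 x * (G 4 t - G0 t)"
      unfolding sum5 by (simp add: G)
    also have "\<bar>\<dots>\<bar> \<le> w 1 x * (e2 * l) + w 2 x * (e2 * l) + w 3 x * (e2 * l) + w 4 x * (e2 * l)"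
    proof -
      have 1: "\<bar>w i x * (G i t - G0 t)\<bar> \<le> w i x * (e2 * l)" if "i \<in> {1,2,3,4}" for i
      proof -
        have "0 \<le> w i x" using that r0 by (auto simp: w_def)
        moreover have "\<bar>G i t - G0 t\<bar> \<le> e2 * l"
          using that profile_bound[OF G(1) t, of i] profile_bound[OF G0 t] by auto
        ultimately show ?thesis by (simp add: abs_mult mult_left_mono)
      qed
      show ?thesis using 1[of 1] 1[of 2] 1[of 3] 1[of 4] by simp
    qed
    also have "\<dots> = ((max (Re x) 0 + max (- Re x) 0) + (max (Im x) 0 + max (- Im x) 0)) / r0 * (e2 * l)"
      using r0 by (simp add: w_def field_simps)
    also have "\<dots> \<le> 2 * norm x / r0 * (e2 * l)"
      unfolding maxabs using abs2[of x] e1 e12 l r0 by (intro mult_right_mono divide_right_mono) auto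
    finally show ?thesis by (simp add: M_def mult_ac)
  qed
  define R where "R = (norm k + 1) * (e2 * l)"
  define B where "B = growth_bound l R"
  have aR: "norm (coef k' H t) \<le> R" if "t \<in> {0..l}" "H \<in> profiles" "norm k' \<le> norm k + 1" for k' H t
    unfolding R_def by (rule profile_coef_bound[OF that(2,1,3)])
  have solB: "norm (fst (sol k' 1 H l)) \<le> B" if "H \<in> profiles" "norm k' \<le> norm k + 1" for k' H
  proof -
    have "norm (sol k' 1 H l) \<le> norm (sol k' 1 H 0) * B"
      unfolding B_def by (rule quasi_sol_bound[OF sol(2)[OF that(1)]]) (use aR that l in auto)
    then have "norm (sol k' 1 H l) \<le> B" by (simp add: sol(1)[OF that(1)] norm_Pair)
    then show ?thesis using norm_fst_le[of "fst (sol k' 1 H l)" "snd (sol k' 1 H l)"] by simp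
  qed
  obtain C where C0: "0 \<le> C" and C: "\<And>b v d. quasi_sol l b v \<Longrightarrow> v 0 = (0, 1) \<Longrightarrow> continuous_on {0..l} b \<Longrightarrow>
      (\<And>t. t \<in> {0..l} \<Longrightarrow> norm (b t) \<le> R) \<Longrightarrow> (\<And>t. t \<in> {0..l} \<Longrightarrow> norm (coef k G0 t - b t) \<le> d) \<Longrightarrow>
      norm ((slope (coef k G0) u l * fst (v l) - fst (u l) * slope b v l) -
        ((b l - coef k G0 l) * (fst (u l))\<^sup>2
          - integral {0..l} (\<lambda>t. (b t - coef k G0 t) * (2 * fst (u t) * slope (coef k G0) u t))))
      \<le> C * d\<^sup>2"
    by (rule wronskian_linearization[OF u profile_coef_continuous[OF G0] aR[OF _ G0]])
      (use l in \<open>auto simp only: less_imp_le norm_ge_zero le_add_same_cancel1 zero_le_one\<close>)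
  obtain N where N: "0 \<le> N" "\<And>H. H \<in> profiles \<Longrightarrow> norm (\<Lambda> H) \<le> N"
    using energy_bound[OF G0] unfolding \<Lambda>_def by metis
  \<comment> \<open>Multiplication by E(l), which is nonzero, turns the mismatch into a Wronskian
    plus a term in z' - z, because the base solution satisfies its own boundary condition.\<close>
  define F where "F = (\<lambda>z' x. fst (u l) * bc z' (Gx x))"
  define A where "A = norm k * M + e2 * l"
  \<comment> \<open>To leading order \<open>F\<close> is k x. The errors come from the quadratic
    remainder, from the change of k, and from z' - z in the boundary condition, in this
    order.\<close>
  have estimate: "norm (F z' x - k * x) \<le> C * (A * r)\<^sup>2 + s * N + \<kappa> * s * B\<^sup>2"
    if x: "norm x \<le> r" "norm x \<le> r0 / 2" and z': "norm (z' - z) \<le> s" "norm (wavenum z' - k) \<le> s"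
      and s: "s \<le> 1" "s \<le> r" for z' x r s
  proof -
    define k' where "k' = wavenum z'"
    define v where "v = sol k' 1 (Gx x)"
    note Gx = Gxp[OF x(2)]
    note v = sol(2)[OF Gx, of k' 1, folded v_def] sol(1)[OF Gx, of k' 1, folded v_def]
    have s0: "0 \<le> s" "0 \<le> r" using z'(1) x(1) norm_ge_zero order_trans by blast+
    have kk': "norm (k' - k) \<le> s" using z'(2) by (simp add: k'_def)
    then have k'n: "norm k' \<le> norm k + 1" using norm_triangle_ineq2[of k' k] s(1) by linarith
    have diff: "coef k' (Gx x) t - coef k G0 t = k * of_real (Gx x t - G0 t) + (k' - k) * of_real (Gx x t)" for t
      by (simp add: algebra_simps)
    have d: "norm (coef k G0 t - coef k' (Gx x) t) \<le> A * r" if t: "t \<in> {0..l}" for t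
    proof -
      have "norm (coef k G0 t - coef k' (Gx x) t) \<le> norm k * \<bar>Gx x t - G0 t\<bar> + norm (k' - k) * \<bar>Gx x t\<bar>"
        unfolding norm_minus_commute[of "coef k G0 t"] diff
        by (rule order_trans[OF norm_triangle_ineq]) (simp only: norm_mult norm_of_real order.refl)
      also have "\<dots> \<le> norm k * (M * r) + r * (e2 * l)"
        using profile_bound[OF Gx t] kk' s s0 Gdist[OF t, of x] mult_left_mono[OF x(1) M0]
        by (intro add_mono mult_left_mono mult_mono) auto
      finally show ?thesis by (simp add: A_def algebra_simps)
    qed
    define W where "W = slope (coef k G0) u l * fst (v l) - fst (u l) * slope (coef k' (Gx x)) v l"
    have lin: "(coef k' (Gx x) l - coef k G0 l) * (fst (u l))\<^sup>2
          - integral {0..l} (\<lambda>t. (coef k' (Gx x) t - coef k G0 t) * (2 * fst (u t) * slope (coef k G0) u t))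
        = k * x + (k' - k) * \<Lambda> (Gx x)"
    proof -
      let ?g = "\<lambda>t. 2 * fst (u t) * slope (coef k G0) u t"
      have int: "(\<lambda>t. of_real (H t) * ?g t) integrable_on {0..l}" if "H \<in> profiles" for H
        unfolding u_def by (rule energy_integrable[OF G0 profile_continuous[OF that]])
      have "(\<lambda>t. (coef k' (Gx x) t - coef k G0 t) * ?g t) =
          (\<lambda>t. k' * (of_real (Gx x t) * ?g t) - k * (of_real (G0 t) * ?g t))"
        by (simp add: algebra_simps)
      then have "integral {0..l} (\<lambda>t. (coef k' (Gx x) t - coef k G0 t) * ?g t) =
          k' * integral {0..l} (\<lambda>t. of_real (Gx x t) * ?g t) - k * integral {0..l} (\<lambda>t. of_real (G0 t) * ?g t)"
        using int[OF Gx] int[OF G0] by (simp add: integral_diff integrable_on_mult_right)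
      then have "(coef k' (Gx x) l - coef k G0 l) * (fst (u l))\<^sup>2
          - integral {0..l} (\<lambda>t. (coef k' (Gx x) t - coef k G0 t) * ?g t) = k' * \<Lambda> (Gx x) - k * \<Lambda> G0"
        unfolding \<Lambda>_def energy_def u_def by (simp add: algebra_simps)
      also have "\<dots> = k * (\<Lambda> (Gx x) - \<Lambda> G0) + (k' - k) * \<Lambda> (Gx x)"
        by (simp add: algebra_simps)
      finally show ?thesis unfolding \<Lambda>x .
    qed
    have W: "norm (W - (k * x + (k' - k) * \<Lambda> (Gx x))) \<le> C * (A * r)\<^sup>2"
      unfolding lin[symmetric] W_def
      by (rule C[OF v profile_coef_continuous[OF Gx] aR[OF _ Gx k'n] d])
    have "F z' x = W + \<i> * (z' - z) * of_real \<kappa> * (fst (u l) * fst (v l))"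
      unfolding F_def W_def bc_def resonance_end_nonzero(2)[OF res, folded k_def, folded u_def]
        k'_def[symmetric] v_def[symmetric]
      by (simp add: algebra_simps)
    then have "F z' x - k * x = (W - (k * x + (k' - k) * \<Lambda> (Gx x))) + (k' - k) * \<Lambda> (Gx x)
        + \<i> * (z' - z) * of_real \<kappa> * (fst (u l) * fst (v l))"
      by simp
    also have "norm \<dots> \<le> norm (W - (k * x + (k' - k) * \<Lambda> (Gx x))) + norm ((k' - k) * \<Lambda> (Gx x))
        + norm (\<i> * (z' - z) * of_real \<kappa> * (fst (u l) * fst (v l)))"
      by (intro order_trans[OF norm_triangle_ineq] add_right_mono norm_triangle_ineq)
    also have "\<dots> \<le> C * (A * r)\<^sup>2 + s * N + s * \<kappa> * (B * B)"
    proof (intro add_mono W)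
      show "norm ((k' - k) * \<Lambda> (Gx x)) \<le> s * N"
        unfolding norm_mult using kk' N(2)[OF Gx] s0 by (intro mult_mono) auto
      have "norm (fst (u l)) \<le> B" "norm (fst (v l)) \<le> B"
        unfolding u_def v_def by (auto intro!: solB G0 Gx k'n)
      then have BB: "norm (fst (u l)) * norm (fst (v l)) \<le> B * B"
        by (intro mult_mono) (auto intro: order_trans[OF norm_ge_zero])
      have zk: "norm (z' - z) * \<kappa> \<le> s * \<kappa>" using z'(1) \<kappa> by (intro mult_right_mono) auto
      have "(norm (z' - z) * \<kappa>) * (norm (fst (u l)) * norm (fst (v l))) \<le> s * \<kappa> * (B * B)"
        by (rule mult_mono[OF zk BB]) (use s0 \<kappa> in auto)
      then show "norm (\<i> * (z' - z) * of_real \<kappa> * (fst (u l) * fst (v l))) \<le> s * \<kappa> * (B * B)"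
        using \<kappa> by (simp add: norm_mult)
    qed
    finally show ?thesis by (simp add: power2_eq_square mult_ac)
  qed
  \<comment> \<open>\<open>r\<close> makes the quadratic error at most |k| r / 2; afterwards
    \<open>s\<close> does the same for the two errors caused by the change of frequency.\<close>
  define r where "r = min (r0 / 2) (norm k / (2 * (C * A\<^sup>2 + 1)))"
  have CA: "0 < C * A\<^sup>2 + 1" "0 < N + \<kappa> * B\<^sup>2 + 1" using C0 N(1) \<kappa> by (auto intro!: add_nonneg_pos)
  have "0 < norm k / (2 * (C * A\<^sup>2 + 1))"
    by (intro divide_pos_pos mult_pos_pos CA) (use k in auto)
  then have r: "0 < r" "r \<le> r0 / 2"
    unfolding r_def using r0 by (simp only: min_less_iff_conj, simp) (rule min.cobounded1)
  define s where "s = min (min 1 r) (norm k * r / (2 * (N + \<kappa> * B\<^sup>2 + 1)))"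
  have "0 < norm k * r / (2 * (N + \<kappa> * B\<^sup>2 + 1))"
    by (intro divide_pos_pos mult_pos_pos CA r) (use k in auto)
  then have s: "0 < s" "s \<le> 1" "s \<le> r"
    unfolding s_def using r(1) by (simp only: min_less_iff_conj, simp) (auto simp only: min_le_iff_disj order.refl)
  have small: "C * (A * r)\<^sup>2 + s * N + \<kappa> * s * B\<^sup>2 \<le> norm k * r"
  proof -
    have "r * (C * A\<^sup>2 + 1) \<le> norm k / 2"
    proof -
      have "r \<le> norm k / (2 * (C * A\<^sup>2 + 1))" by (simp add: r_def)
      then show ?thesis using CA by (simp add: field_simps)
    qed
    then have "r * (r * (C * A\<^sup>2 + 1)) \<le> r * (norm k / 2)" using r by (intro mult_left_mono) auto
    moreover have "C * (A * r)\<^sup>2 \<le> r * (r * (C * A\<^sup>2 + 1))"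
      by (simp add: power2_eq_square algebra_simps)
    moreover have "s * (N + \<kappa> * B\<^sup>2 + 1) \<le> norm k * r / 2"
    proof -
      have "s \<le> norm k * r / (2 * (N + \<kappa> * B\<^sup>2 + 1))" by (simp add: s_def)
      then show ?thesis using CA by (simp add: field_simps)
    qed
    moreover have "s * N + \<kappa> * s * B\<^sup>2 \<le> s * (N + \<kappa> * B\<^sup>2 + 1)"
      using s by (simp add: algebra_simps)
    ultimately show ?thesis by (simp add: mult.commute)
  qed
  have "isCont wavenum z" unfolding wavenum_def using c by (intro continuous_intros) auto
  then obtain \<delta> where \<delta>: "0 < \<delta>" "\<And>z'. norm (z' - z) < \<delta> \<Longrightarrow> norm (wavenum z' - k) < s"
    unfolding continuous_at_eps_delta using s(1) by (auto simp: dist_norm k_def)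
  have "\<exists>G'. resonance z' G'" if z': "norm (z' - z) < min \<delta> s" for z'
  proof -
    \<comment> \<open>Its fixed points are the zeros of \<open>F\<close>, and the estimate says that
      it maps the disc of radius r into itself.\<close>
    define \<Phi> where "\<Phi> = (\<lambda>x. x - F z' x / k)"
    have kz: "norm (z' - z) \<le> s" "norm (wavenum z' - k) \<le> s" using z' \<delta>(2)[of z'] by auto
    have maps: "\<Phi> \<in> cball 0 r \<rightarrow> cball 0 r"
    proof
      fix x :: complex assume "x \<in> cball 0 r"
      then have x: "norm x \<le> r" by simp
      have "norm (F z' x - k * x) \<le> norm k * r"
        using estimate[OF x order_trans[OF x r(2)] kz s(2,3)] small by linarith
      moreover have "\<Phi> x = (k * x - F z' x) / k" using k by (simp add: \<Phi>_def field_simps)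
      ultimately have "norm (\<Phi> x) \<le> r" using k by (simp add: norm_divide divide_le_eq mult.commute norm_minus_commute)
      then show "\<Phi> x \<in> cball 0 r" by simp
    qed
    have "continuous_on (cball 0 r) (\<lambda>x. bc z' (Gx x))"
      unfolding continuous_on_sequentially
    proof (intro allI ballI impI; elim conjE)
      fix x and y :: complex
      assume y: "y \<in> cball 0 r" and x: "\<forall>n. x n \<in> cball 0 r" and lim: "x \<longlonglongrightarrow> y"
      have xr: "norm (x n) \<le> r0 / 2" for n using x r(2) by (metis dist_0_norm mem_cball order_trans)
      have yr: "norm y \<le> r0 / 2" using y r(2) by simp
      have wlim: "(\<lambda>n. w i (x n)) \<longlonglongrightarrow> w i y" for i
        unfolding w_def using r0 by (auto intro!: tendsto_intros lim)
      have "uniform_limit {0..l} (\<lambda>n. Gx (x n)) (Gx y) sequentially"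
        unfolding uniform_limit_iff
      proof (intro allI impI)
        fix e :: real assume e: "0 < e"
        have "(\<lambda>n. \<Sum>i<5. \<bar>w i (x n) - w i y\<bar> * (e2 * l)) \<longlonglongrightarrow> (\<Sum>i<5. \<bar>w i y - w i y\<bar> * (e2 * l))"
          by (intro tendsto_intros wlim)
        then have "\<forall>\<^sub>F n in sequentially. (\<Sum>i<5. \<bar>w i (x n) - w i y\<bar> * (e2 * l)) < e"
          using e order_tendstoD(2) by fastforce
        then show "\<forall>\<^sub>F n in sequentially. \<forall>t\<in>{0..l}. dist (Gx (x n) t) (Gx y t) < e"
        proof eventually_elim
          case (elim n)
          show ?case
          proof
            fix t assume t: "t \<in> {0..l}"
            have "dist (Gx (x n) t) (Gx y t) = \<bar>\<Sum>i<5. (w i (x n) - w i y) * G i t\<bar>"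
              by (simp add: dist_real_def Gx_def left_diff_distrib sum_subtractf)
            also have "\<dots> \<le> (\<Sum>i<5. \<bar>w i (x n) - w i y\<bar> * (e2 * l))"
            proof (rule order_trans[OF sum_abs], rule sum_mono)
              fix i :: nat assume "i \<in> {..<5}"
              then have "\<bar>G i t\<bar> \<le> e2 * l" using profile_bound[OF G(1) t, of i] by simp
              then show "\<bar>(w i (x n) - w i y) * G i t\<bar> \<le> \<bar>w i (x n) - w i y\<bar> * (e2 * l)"
                by (simp add: abs_mult mult_left_mono)
            qed
            finally show "dist (Gx (x n) t) (Gx y t) < e" using elim by linarith
          qed
        qed
      qed
      from bc_tendsto[OF Gxp[OF xr] Gxp[OF yr] this tendsto_const]
      show "((\<lambda>x. bc z' (Gx x)) \<circ> x) \<longlonglongrightarrow> bc z' (Gx y)" by (simp add: comp_def)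
    qed
    then have "continuous_on (cball 0 r) \<Phi>"
      unfolding \<Phi>_def F_def by (intro continuous_intros) (use k in auto)
    then obtain x where x: "x \<in> cball 0 r" "\<Phi> x = x"
      using brouwer_ball[OF r(1) _ maps] by blast
    have "fst (u l) \<noteq> 0" using resonance_end_nonzero(1)[OF res] by (simp add: u_def k_def)
    then have "bc z' (Gx x) = 0" using x(2) k by (simp add: \<Phi>_def F_def)
    moreover have "Gx x \<in> profiles" using x(1) r(2) by (intro Gxp) auto
    ultimately show ?thesis unfolding resonance_def by blast
  qed
  with \<delta>(1) s(1) show ?thesis by (intro exI[of _ "min \<delta> s"]) auto
qed

end

section \<open>Extremal profiles\<close>

text \<open>A single mean value might be taken at 0, where w vanishes. Splitting at a point d where
  N has half its final value leaves a positive contribution from [d, l], where w > 0.\<close>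

lemma stieltjes_positive:
  fixes N w w' :: "real \<Rightarrow> real"
  assumes l: "0 < l" and N: "mono_on {0..l} N" "continuous_on {0..l} N" "N 0 = 0" "0 < N l"
    and w: "\<And>t. t \<in> {0..l} \<Longrightarrow> (w has_vector_derivative w' t) (at t within {0..l})"
      "continuous_on {0..l} w'" "\<And>t. 0 < t \<Longrightarrow> t \<le> l \<Longrightarrow> 0 < w t" "w 0 = 0"
  shows "0 < N l * w l - integral {0..l} (\<lambda>t. N t * w' t)"
proof -
  obtain d where d: "d \<in> {0..l}" "N d = N l / 2"
    using IVT'[of N 0 "N l / 2" l] N l by auto
  have d0: "0 < d" "d < l" using d N(3,4) by (cases "d = 0"; cases "d = l"; auto)+
  have Nm: "mono_on {a..b} N" if "0 \<le> a" "b \<le> l" for a b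
    using N(1) that by (auto intro: mono_on_subset)
  have wd: "(w has_vector_derivative w' t) (at t within {a..b})" if "0 \<le> a" "b \<le> l" "t \<in> {a..b}" for a b t
    by (rule has_vector_derivative_within_subset[OF w(1)]) (use that in auto)
  have wc: "continuous_on {a..b} w'" if "0 \<le> a" "b \<le> l" for a b
    using w(2) that by (auto intro: continuous_on_subset)
  obtain c1 where c1: "c1 \<in> {0..d}"
      "N d * w d - N 0 * w 0 - integral {0..d} (\<lambda>t. N t * w' t) = (N d - N 0) * w c1"
    by (rule stieltjes_mean_value[of 0 d N w w', OF _ Nm wd wc]) (use d0 in auto)
  obtain c2 where c2: "c2 \<in> {d..l}"
      "N l * w l - N d * w d - integral {d..l} (\<lambda>t. N t * w' t) = (N l - N d) * w c2"
    by (rule stieltjes_mean_value[of d l N w w', OF _ Nm wd wc]) (use d0 in auto)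
  have "0 \<le> w c1" using w(3)[of c1] w(4) c1(1) d0 by (cases "c1 = 0") auto
  moreover have "0 < w c2" using w(3)[of c2] c2(1) d0 by auto
  ultimately have "0 < (N d - N 0) * w c1 + (N l - N d) * w c2"
    using d(2) N(3,4) by (auto intro!: add_nonneg_pos)
  also have "\<dots> = N l * w l - (integral {0..d} (\<lambda>t. N t * w' t) + integral {d..l} (\<lambda>t. N t * w' t))"
    using c1(2) c2(2) N(3) by simp
  also have "integral {0..d} (\<lambda>t. N t * w' t) + integral {d..l} (\<lambda>t. N t * w' t) = integral {0..l} (\<lambda>t. N t * w' t)"
    by (rule Henstock_Kurzweil_Integration.integral_combine)
      (use d0 N(2) w(2) in \<open>auto intro!: integrable_continuous_real continuous_intros\<close>)
  finally show ?thesis .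
qed

context resonator
begin

lemma Re_energy:
  assumes G: "G \<in> profiles" and H: "continuous_on {0..l} H"
  shows "Re (p * energy k G H) = H l * Re (p * (fst (sol k 1 G l))\<^sup>2)
    - integral {0..l} (\<lambda>t. H t * Re (p * (2 * fst (sol k 1 G t) * slope (coef k G) (sol k 1 G) t)))"
proof -
  let ?g = "\<lambda>t. 2 * fst (sol k 1 G t) * slope (coef k G) (sol k 1 G) t"
  have "integral {0..l} (\<lambda>t. Re (p * (of_real (H t) * ?g t))) = Re (p * integral {0..l} (\<lambda>t. of_real (H t) * ?g t))"
    using integral_linear[OF energy_integrable[OF G H, of k]
        bounded_linear_compose[OF bounded_linear_Re bounded_linear_mult_right[of p]]]
    by (simp only: comp_def)
  moreover have "Re (p * (of_real h * y)) = h * Re (p * y)" for h y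
    by (simp add: algebra_simps)
  ultimately show ?thesis
    unfolding energy_def by (simp only: right_diff_distrib minus_complex.sel)
qed

text \<open>If G had another increment on [s, t], replacing it there by a line of slope e would give
  a profile H with a larger functional: the change is (H - G)(t) w(c) for some c in [s, t], and e is
  chosen to make this positive.\<close>

lemma extremal_slope:
  fixes p k :: complex and G :: "real \<Rightarrow> real"
  defines "w \<equiv> \<lambda>t. Re (p * (fst (sol k 1 G t))\<^sup>2)"
  assumes G: "G \<in> profiles"
    and ext: "\<And>H. H \<in> profiles \<Longrightarrow> Re (p * (energy k G H - energy k G G)) \<le> 0"
    and st: "0 \<le> s" "s \<le> t" "t \<le> l"
    and sg: "(e = e2 \<and> (\<forall>r\<in>{s..t}. 0 < w r)) \<or> (e = e1 \<and> (\<forall>r\<in>{s..t}. w r < 0))"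
  shows "G t - G s = e * (t - s)"
proof -
  define w' where "w' = (\<lambda>t. Re (p * (2 * fst (sol k 1 G t) * slope (coef k G) (sol k 1 G) t)))"
  note u = sol(2)[OF G, of k 1]
  have dw: "(w has_vector_derivative w' r) (at r within {0..l})" if r: "r \<in> {0..l}" for r
  proof -
    note d = quasi_sol_deriv(1)[OF u r]
    have "((\<lambda>t. Re (p * (fst (sol k 1 G t) * fst (sol k 1 G t)))) has_vector_derivative
        Re (p * (fst (sol k 1 G r) * slope (coef k G) (sol k 1 G) r + slope (coef k G) (sol k 1 G) r * fst (sol k 1 G r))))
        (at r within {0..l})"
      by (rule bounded_linear.has_vector_derivative[OF bounded_linear_Re
          has_vector_derivative_mult_right[OF has_vector_derivative_mult[OF d d]]])
    then show ?thesis by (simp add: w_def w'_def power2_eq_square mult_ac)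
  qed
  have cw': "continuous_on {0..l} w'"
    unfolding w'_def by (intro continuous_intros quasi_sol_continuous(2)[OF u]
      quasi_sol_continuous(4)[OF u] profile_coef_continuous G)
  have ee: "e1 \<le> e" "e \<le> e2" using sg e12 by auto
  \<comment> \<open>Clamping to [s, t]: \<open>\<Delta>\<close> vanishes before s, corrects the
    slope to e on [s, t], and stays constant after t.\<close>
  define \<rho> where "\<rho> = (\<lambda>r. max s (min t r))"
  define \<Delta> where "\<Delta> = (\<lambda>r. e * (\<rho> r - s) - (G (\<rho> r) - G s))"
  define H where "H = (\<lambda>r. G r + \<Delta> r)"
  have mul: "e1 * x \<le> e * x" "e * x \<le> e2 * x" if "0 \<le> x" for x
    using ee that by (auto intro: mult_right_mono)
  have H: "H \<in> profiles"
  proof (rule profilesI)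
    show "H 0 = 0" using st profile_0[OF G] by (simp add: H_def \<Delta>_def \<rho>_def)
    fix a b assume ab: "0 \<le> a" "a \<le> b" "b \<le> l"
    have Hdiff: "H b - H a = (G b - G a) - (G (\<rho> b) - G (\<rho> a)) + e * (\<rho> b - \<rho> a)"
      by (simp add: H_def \<Delta>_def algebra_simps)
    consider "b \<le> s" | "t \<le> a" | "a \<le> s" "s \<le> b" "b \<le> t" | "a \<le> s" "t \<le> b"
      | "s \<le> a" "b \<le> t" | "s \<le> a" "a \<le> t" "t \<le> b" by linarith
    then show "e1 * (b - a) \<le> H b - H a \<and> H b - H a \<le> e2 * (b - a)"
    proof cases
      case 1
      then have "\<rho> b = s" "\<rho> a = s" using ab st by (auto simp: \<rho>_def)
      then show ?thesis using Hdiff profile_slope[OF G ab] by simp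
    next
      case 2
      then have "\<rho> b = t" "\<rho> a = t" using ab st by (auto simp: \<rho>_def)
      then show ?thesis using Hdiff profile_slope[OF G ab] by simp
    next
      case 3
      then have "\<rho> b = b" "\<rho> a = s" using ab st by (auto simp: \<rho>_def)
      then show ?thesis using Hdiff profile_slope[OF G, of a s] mul[of "b - s"] ab st 3
        by (simp add: right_diff_distrib)
    next
      case 4
      then have "\<rho> b = t" "\<rho> a = s" using ab st by (auto simp: \<rho>_def)
      then show ?thesis using Hdiff profile_slope[OF G, of a s] profile_slope[OF G, of t b] mul[of "t - s"] ab st 4
        by (simp add: right_diff_distrib)
    next
      case 5
      then have "\<rho> b = b" "\<rho> a = a" using ab st by (auto simp: \<rho>_def)
      then show ?thesis using Hdiff mul[of "b - a"] ab by simp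
    next
      case 6
      then have "\<rho> b = t" "\<rho> a = a" using ab st by (auto simp: \<rho>_def)
      then show ?thesis using Hdiff profile_slope[OF G, of t b] mul[of "t - a"] ab st 6
        by (simp add: right_diff_distrib)
    qed
  qed
  have \<Delta>eq: "\<Delta> r = H r - G r" for r by (simp add: H_def)
  have c\<Delta>: "continuous_on {0..l} \<Delta>"
    unfolding \<Delta>eq by (intro continuous_on_diff profile_continuous H G)
  have \<Delta>int: "(\<lambda>r. \<Delta> r * w' r) integrable_on {a..b}" if "0 \<le> a" "b \<le> l" for a b
    by (rule integrable_continuous_real, rule continuous_on_subset[of "{0..l}"])
      (use that in \<open>auto intro!: continuous_on_mult c\<Delta> cw'\<close>)
  \<comment> \<open>Both signs of w at once: on [s, t] the function
    \<open>\<sigma> * \<Delta>\<close> is nondecreasing and \<open>\<sigma> * w\<close> is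
    positive.\<close>
  obtain \<sigma> :: real where \<sigma>: "\<sigma> = 1 \<or> \<sigma> = -1" "\<And>r. r \<in> {s..t} \<Longrightarrow> 0 < \<sigma> * w r"
    "mono_on {s..t} (\<lambda>r. \<sigma> * \<Delta> r)"
  proof (cases "e = e2 \<and> (\<forall>r\<in>{s..t}. 0 < w r)")
    case True
    have "mono_on {s..t} \<Delta>"
    proof (rule mono_onI)
      fix x y assume xy: "x \<in> {s..t}" "y \<in> {s..t}" "x \<le> y"
      then have "\<rho> x = x" "\<rho> y = y" by (auto simp: \<rho>_def)
      then show "\<Delta> x \<le> \<Delta> y"
        using profile_slope(2)[OF G, of x y] xy st True by (simp add: \<Delta>_def right_diff_distrib)
    qed
    then show ?thesis using True by (intro that[of 1]) auto
  next
    case False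
    then have e: "e = e1" "\<forall>r\<in>{s..t}. w r < 0" using sg by auto
    have "mono_on {s..t} (\<lambda>r. - \<Delta> r)"
    proof (rule mono_onI)
      fix x y assume xy: "x \<in> {s..t}" "y \<in> {s..t}" "x \<le> y"
      then have "\<rho> x = x" "\<rho> y = y" by (auto simp: \<rho>_def)
      then show "- \<Delta> x \<le> - \<Delta> y"
        using profile_slope(1)[OF G, of x y] xy st e by (simp add: \<Delta>_def right_diff_distrib)
    qed
    then show ?thesis using e by (intro that[of "-1"]) auto
  qed
  have \<sigma>2: "\<sigma> * \<sigma> = 1" using \<sigma>(1) by auto
  obtain c where c: "c \<in> {s..t}"
      "\<sigma> * \<Delta> t * w t - \<sigma> * \<Delta> s * w s - integral {s..t} (\<lambda>r. \<sigma> * \<Delta> r * w' r) = (\<sigma> * \<Delta> t - \<sigma> * \<Delta> s) * w c"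
  proof (rule stieltjes_mean_value[OF st(2) \<sigma>(3)])
    show "(w has_vector_derivative w' r) (at r within {s..t})" if "r \<in> {s..t}" for r
      by (rule has_vector_derivative_within_subset[OF dw]) (use that st in auto)
    show "continuous_on {s..t} w'" using cw' st by (auto intro: continuous_on_subset)
  qed
  have \<Delta>s: "\<Delta> r = 0" if "r \<le> s" for r using that st by (simp add: \<Delta>_def \<rho>_def)
  have \<Delta>t: "\<Delta> r = \<Delta> t" if "t \<le> r" for r using that st by (simp add: \<Delta>_def \<rho>_def)
  have "integral {s..t} (\<lambda>r. \<sigma> * \<Delta> r * w' r) = \<sigma> * integral {s..t} (\<lambda>r. \<Delta> r * w' r)"
    by (simp add: mult.assoc)
  then have "\<sigma> * (\<Delta> t * w t - integral {s..t} (\<lambda>r. \<Delta> r * w' r)) = \<sigma> * (\<Delta> t * w c)"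
    using c(2) \<Delta>s[of s] by (simp add: algebra_simps)
  then have mid: "\<Delta> t * w t - integral {s..t} (\<lambda>r. \<Delta> r * w' r) = \<Delta> t * w c"
    using \<sigma>2 by (metis mult.left_commute mult_1 mult.assoc)
  have "Re (p * (energy k G H - energy k G G)) = \<Delta> l * w l - integral {0..l} (\<lambda>r. \<Delta> r * w' r)"
  proof -
    have int: "(\<lambda>r. F r * w' r) integrable_on {0..l}" if "F \<in> profiles" for F
      by (intro integrable_continuous_real continuous_on_mult profile_continuous that cw')
    have "integral {0..l} (\<lambda>r. \<Delta> r * w' r) = integral {0..l} (\<lambda>r. H r * w' r) - integral {0..l} (\<lambda>r. G r * w' r)"
      unfolding \<Delta>eq left_diff_distrib by (rule integral_diff[OF int[OF H] int[OF G]])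
    moreover have "Re (p * energy k G F) = F l * w l - integral {0..l} (\<lambda>r. F r * w' r)" if "F \<in> profiles" for F
      unfolding w_def w'_def by (rule Re_energy[OF G profile_continuous[OF that]])
    ultimately show ?thesis
      unfolding right_diff_distrib minus_complex.sel using H G by (simp add: \<Delta>eq left_diff_distrib)
  qed
  also have "integral {0..l} (\<lambda>r. \<Delta> r * w' r) =
      integral {0..s} (\<lambda>r. \<Delta> r * w' r) + integral {s..t} (\<lambda>r. \<Delta> r * w' r) + integral {t..l} (\<lambda>r. \<Delta> r * w' r)"
    using Henstock_Kurzweil_Integration.integral_combine[of 0 t l "\<lambda>r. \<Delta> r * w' r"]
      Henstock_Kurzweil_Integration.integral_combine[of 0 s t "\<lambda>r. \<Delta> r * w' r"] st \<Delta>int by simp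
  also have "integral {0..s} (\<lambda>r. \<Delta> r * w' r) = integral {0..s} (\<lambda>r. 0)"
    by (rule integral_cong) (simp add: \<Delta>s)
  also have "integral {t..l} (\<lambda>r. \<Delta> r * w' r) = integral {t..l} (\<lambda>r. \<Delta> t * w' r)"
    by (intro integral_cong arg_cong2[where f = "(*)"] \<Delta>t refl) simp
  also have "\<dots> = \<Delta> t * (w l - w t)"
  proof -
    have "(w' has_integral w l - w t) {t..l}"
      by (rule fundamental_theorem_of_calculus[OF st(3)], rule has_vector_derivative_within_subset[OF dw])
        (use st in auto)
    then show ?thesis by (simp add: integral_unique)
  qed
  also have "\<Delta> l * w l - (integral {0..s} (\<lambda>r. 0) + integral {s..t} (\<lambda>r. \<Delta> r * w' r) + \<Delta> t * (w l - w t)) = \<Delta> t * w c"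
    using mid \<Delta>t[OF st(3)] by (simp add: algebra_simps)
  also have "\<dots> = (\<sigma> * \<Delta> t) * (\<sigma> * w c)"
    using \<sigma>2 by (metis mult.left_commute mult_1 mult.assoc)
  finally have le: "(\<sigma> * \<Delta> t) * (\<sigma> * w c) \<le> 0" using ext[OF H] by simp
  have "\<sigma> * \<Delta> s \<le> \<sigma> * \<Delta> t"
    using \<sigma>(3) st by (auto simp: mono_on_def)
  then have "0 \<le> \<sigma> * \<Delta> t" using \<Delta>s[of s] by simp
  with le \<sigma>(2)[OF c(1)] have "\<sigma> * \<Delta> t = 0"
    by (metis mult_pos_pos not_le order_le_less)
  then have "\<Delta> t = 0" using \<sigma>(1) by auto
  moreover have "\<rho> t = t" using st by (simp add: \<rho>_def)
  ultimately show ?thesis by (simp add: \<Delta>_def)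
qed

text \<open>Optimality enters through \<open>opt\<close>: frequencies without resonance accumulate
  at z. By \<open>resonance_open\<close> the convex set of first variations then has no
  neighbourhood of 0 inside.\<close>

lemma optimal_bang_nonreal:
  assumes res: "resonance z G" and k: "Im (wavenum z) \<noteq> 0"
    and opt: "\<And>\<delta>. 0 < \<delta> \<Longrightarrow> \<exists>z'. norm (z' - z) < \<delta> \<and> (\<forall>G'. \<not> resonance z' G')"
  shows "\<exists>q u. norm q = 1 \<and> bang (wavenum z) q G u"
proof -
  define k where "k = wavenum z"
  have k: "Im k \<noteq> 0" using k by (simp add: k_def)
  have G: "G \<in> profiles" using res by (simp add: resonance_def)
  define S where "S = (\<lambda>H. energy k G H - energy k G G) ` profiles"
  have "convex S"
  proof (rule convexI)
    fix x y and a b :: real assume "x \<in> S" "y \<in> S" and ab: "0 \<le> a" "0 \<le> b" "a + b = 1"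
    then obtain H F where H: "H \<in> profiles" "x = energy k G H - energy k G G"
      and F: "F \<in> profiles" "y = energy k G F - energy k G G" by (auto simp: S_def)
    define P where "P = (\<lambda>t. \<Sum>i\<in>UNIV. (if i then a else b) * (if i then H else F) t)"
    have "P \<in> profiles" unfolding P_def
      by (rule profile_convex_sum) (use H F ab in \<open>auto simp: UNIV_bool\<close>)
    moreover have "energy k G P = (\<Sum>i\<in>UNIV. of_real (if i then a else b) * energy k G (if i then H else F))"
      unfolding P_def by (rule energy_sum[OF G]) (use H F profile_continuous in auto)
    then have "energy k G P = of_real a * energy k G H + of_real b * energy k G F"
      by (simp add: UNIV_bool add.commute)
    moreover have "of_real a * energy k G G + of_real b * energy k G G = energy k G G"
      using ab(3) by (metis distrib_right mult_1 of_real_1 of_real_add)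
    ultimately have "a *\<^sub>R x + b *\<^sub>R y = energy k G P - energy k G G"
      by (simp add: H F scaleR_conv_of_real algebra_simps)
    with \<open>P \<in> profiles\<close> show "a *\<^sub>R x + b *\<^sub>R y \<in> S" by (auto simp: S_def)
  qed
  moreover have "0 \<in> S" using G by (auto simp: S_def)
  moreover have "0 \<notin> interior S"
  proof
    assume "0 \<in> interior S"
    then obtain \<rho> where \<rho>: "0 < \<rho>" "ball 0 \<rho> \<subseteq> S" by (auto simp: mem_interior)
    \<comment> \<open>Halved so that the four test points of this modulus lie in the open
      ball.\<close>
    define r0 where "r0 = \<rho> / 2"
    have r0: "0 < r0" using \<rho> by (simp add: r0_def)
    have "\<exists>H\<in>profiles. energy k G H - energy k G G = x" if "norm x = r0" for x
    proof -
      have "x \<in> S" using \<rho> that by (auto simp: r0_def)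
      then show ?thesis by (auto simp: S_def)
    qed
    then obtain h where h: "\<And>x. norm x = r0 \<Longrightarrow> h x \<in> profiles \<and> energy k G (h x) - energy k G G = x"
      by metis
    define g where "g = (\<lambda>i::nat. if i = 1 then h (of_real r0) else if i = 2 then h (- of_real r0)
      else if i = 3 then h (\<i> * of_real r0) else if i = 4 then h (- \<i> * of_real r0) else G)"
    have n: "norm (of_real r0 :: complex) = r0" "norm (- of_real r0 :: complex) = r0"
      "norm (\<i> * of_real r0 :: complex) = r0" "norm (- \<i> * of_real r0 :: complex) = r0"
      using r0 by (auto simp: norm_mult)
    have "\<exists>\<delta>>0. \<forall>z'. norm (z' - z) < \<delta> \<longrightarrow> (\<exists>G'. resonance z' G')"
      by (rule resonance_open[OF res _ r0, of g, folded k_def])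
        (use k G h n in \<open>auto simp: g_def\<close>)
    then show False using opt by blast
  qed
  ultimately obtain a where a: "a \<noteq> 0" "\<And>x. x \<in> S \<Longrightarrow> 0 \<le> inner a x"
    by (rule separation_from_non_interior) (rule that)
  \<comment> \<open>\<open>inner a x\<close> is Re (cnj a x), so this p writes the half-plane as Re
    (p x) <= 0.\<close>
  define p where "p = - cnj a"
  have p: "p \<noteq> 0" using a by (simp add: p_def)
  have ext: "Re (p * (energy k G H - energy k G G)) \<le> 0" if "H \<in> profiles" for H
  proof -
    have "Re (p * x) = - inner a x" for x by (simp add: p_def inner_complex_def)
    moreover have "0 \<le> inner a (energy k G H - energy k G G)" by (rule a(2)) (use that in \<open>simp add: S_def\<close>)
    ultimately show ?thesis by (simp only: neg_le_0_iff_le)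
  qed
  \<comment> \<open>Chosen so that Im ((q E)^2) = Re (p E^2) / |p|: the sign in the extremality
    condition becomes the one tested by \<open>chi_plus\<close>. Moreover |q| = 1.\<close>
  define q where "q = csqrt (\<i> * p / of_real (norm p))"
  have q2: "q\<^sup>2 = \<i> * p / of_real (norm p)" by (simp add: q_def)
  have "norm q ^ 2 = norm (\<i> * p / of_real (norm p))" by (simp only: q2 flip: norm_power)
  also have "\<dots> = 1" using p by (simp add: norm_divide norm_mult)
  finally have "norm q ^ 2 = 1" .
  then have q1: "norm q = 1" using norm_ge_zero[of q] by (simp add: power2_eq_1_iff)
  then have q0: "q \<noteq> 0" by auto
  define u where "u = (\<lambda>t. (q * fst (sol k 1 G t), q * snd (sol k 1 G t)))"
  have u: "quasi_sol l (coef k G) u" "u 0 = (0, q)"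
    using quasi_sol_scale[OF sol(2)[OF G, of k 1], of q] sol(1)[OF G, of k 1] by (simp_all add: u_def)
  define w where "w = (\<lambda>t. Re (p * (fst (sol k 1 G t))\<^sup>2))"
  have uw: "Im ((fst (u t))\<^sup>2) = w t / norm p" for t
  proof -
    have "(fst (u t))\<^sup>2 = \<i> * (p * (fst (sol k 1 G t))\<^sup>2) / of_real (norm p)"
      by (simp add: u_def power_mult_distrib q2)
    then show ?thesis by (simp only: w_def Im_divide_of_real) simp
  qed
  have wc: "continuous_on {0..l} w"
    unfolding w_def by (intro continuous_intros quasi_sol_continuous(2)[OF sol(2)[OF G]])
  define X where "X = {t \<in> {0..l}. Im ((fst (u t))\<^sup>2) = 0}"
  have "finite X" unfolding X_def by (rule Im_square_zeros_finite[OF G u q0 k])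
  moreover have "(G has_vector_derivative sw (fst (u s))) (at s)" if s: "s \<in> {0<..<l} - X" for s
  proof -
    define e where "e = sw (fst (u s))"
    have ws: "w s \<noteq> 0" using s p by (auto simp only: X_def uw Diff_iff mem_Collect_eq) auto
    have e_eq: "e = (if 0 < w s then e2 else e1)"
      unfolding e_def sw_def chi_plus_def uw using p by (simp add: zero_less_divide_iff)
    obtain \<delta>0 where \<delta>0: "\<delta>0 > 0" "\<And>r. r \<in> {0..l} \<Longrightarrow> \<bar>r - s\<bar> < \<delta>0 \<Longrightarrow> \<bar>w r - w s\<bar> < \<bar>w s\<bar>"
      using wc s ws unfolding continuous_on_iff dist_real_def by (metis DiffD1 atLeastAtMost_iff greaterThanLessThan_iff less_imp_le zero_less_abs_iff)
    define \<delta> where "\<delta> = min \<delta>0 (min s (l - s))"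
    have \<delta>: "\<delta> > 0" using \<delta>0 s by (auto simp: \<delta>_def)
    have near: "r \<in> {0..l} \<and> \<bar>w r - w s\<bar> < \<bar>w s\<bar>" if "\<bar>r - s\<bar> < \<delta>" for r
    proof -
      have "\<bar>r - s\<bar> < \<delta>0" "r \<in> {0..l}" using that by (auto simp: \<delta>_def)
      then show ?thesis using \<delta>0(2) by blast
    qed
    have lin: "G b - G a = e * (b - a)" if ab: "a \<le> b" "\<bar>a - s\<bar> < \<delta>" "\<bar>b - s\<bar> < \<delta>" for a b
    proof (rule extremal_slope[OF G ext])
      show "0 \<le> a" "b \<le> l" using near[OF ab(2)] near[OF ab(3)] by auto
      have sgn: "\<bar>w r - w s\<bar> < \<bar>w s\<bar>" if "r \<in> {a..b}" for r
        using near[of r] that ab by auto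
      have "(e = e2 \<and> (\<forall>r\<in>{a..b}. 0 < w r)) \<or> (e = e1 \<and> (\<forall>r\<in>{a..b}. w r < 0))"
      proof (cases "0 < w s")
        case True
        then show ?thesis using sgn e_eq by fastforce
      next
        case False
        then show ?thesis using sgn e_eq ws by fastforce
      qed
      then show "e = e2 \<and> (\<forall>r\<in>{a..b}. 0 < Re (p * (fst (sol k 1 G r))\<^sup>2)) \<or>
          e = e1 \<and> (\<forall>r\<in>{a..b}. Re (p * (fst (sol k 1 G r))\<^sup>2) < 0)"
        by (simp only: w_def)
    qed (use ab in auto)
    have "((\<lambda>r. G s + e * (r - s)) has_vector_derivative e) (at s)"
      by (auto intro!: derivative_eq_intros)
    then have "(G has_vector_derivative e) (at s)"
    proof (rule has_vector_derivative_transform_within_open[where S = "ball s \<delta>"])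
      fix r assume "r \<in> ball s \<delta>"
      then have r: "\<bar>r - s\<bar> < \<delta>" by (simp add: dist_real_def abs_minus_commute)
      show "G s + e * (r - s) = G r"
        using lin[of s r] lin[of r s] r \<delta> by (cases "s \<le> r") (auto simp: algebra_simps)
    qed (use \<delta> in auto)
    then show ?thesis by (simp add: e_def)
  qed
  ultimately have "bang k q G u" unfolding bang_def using G u by blast
  with q1 show ?thesis by (auto simp: k_def)
qed

section \<open>Optimal profiles for real wave numbers\<close>

lemma real_solution:
  assumes G: "G \<in> profiles" and k: "Im k = 0" and t: "t \<in> {0..l}"
  shows "fst (sol k 1 G t) = of_real (Re (fst (sol k 1 G t)))"
    and "slope (coef k G) (sol k 1 G) t = of_real (Re (slope (coef k G) (sol k 1 G) t))"
  using real_coefficient_solution[OF G sol(2)[OF G] sol(1)[OF G] one_neq_zero k t] by auto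

text \<open>For k <= 0 the real part of the flux identity makes Re (E' cnj E) nonnegative, so |E|
  never decreases and E has no zero after 0. Being real and positive near 0, it stays
  positive.\<close>

lemma real_solution_positive:
  assumes G: "G \<in> profiles" and k: "Im k = 0" "Re k \<le> 0" and t: "0 < t" "t \<le> l"
  shows "0 < Re (fst (sol k 1 G t))"
proof -
  define u where "u = sol k 1 G"
  note u = sol(2)[OF G, of k 1, folded u_def] sol(1)[OF G, of k 1, folded u_def]
  define h where "h = (\<lambda>t. Re (slope (coef k G) u t * cnj (fst (u t))))"
  have contD: "continuous_on {0..l} (slope (coef k G) u)"
    by (rule quasi_sol_continuous(4)[OF u(1) profile_coef_continuous[OF G]])
  have h: "0 \<le> h t" if t: "t \<in> {0..l}" for t
  proof -
    have t': "0 \<le> t" "t \<le> l" using t by auto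
    obtain c where c: "c \<in> {0..t}"
      and eq: "slope (coef k G) u t * cnj (fst (u t)) - slope (coef k G) u 0 * cnj (fst (u 0))
        = of_real (integral {0..t} (\<lambda>r. (cmod (slope (coef k G) u r))\<^sup>2))
       - k * of_real ((G t - G 0) * (cmod (fst (u c)))\<^sup>2)"
      by (rule profile_flux[OF G u(1) order.refl t'])
    define I where "I = integral {0..t} (\<lambda>r. (cmod (slope (coef k G) u r))\<^sup>2)"
    define m where "m = (G t - G 0) * (cmod (fst (u c)))\<^sup>2"
    have "0 \<le> I" unfolding I_def
      by (rule integral_nonneg)
        (use t in \<open>auto intro!: integrable_continuous_real continuous_intros continuous_on_subset[OF contD]\<close>)
    moreover have "0 \<le> m" using profile_bound(1)[OF G t] profile_0[OF G] by (simp add: m_def)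
    then have "0 \<le> - Re k * m" by (rule mult_nonneg_nonneg[rotated]) (use k in simp)
    moreover have "h t = I - Re k * m"
      using arg_cong[OF eq, of Re] u(2) by (simp add: h_def I_def[symmetric] m_def[symmetric])
    ultimately show ?thesis by simp
  qed
  have mono: "(cmod (fst (u s)))\<^sup>2 \<le> (cmod (fst (u t)))\<^sup>2" if "0 \<le> s" "s \<le> t" "t \<le> l" for s t
  proof (rule mono_of_deriv_nonneg[of 0 l "\<lambda>t. (cmod (fst (u t)))\<^sup>2" "\<lambda>t. 2 * h t"])
    show "((\<lambda>t. (cmod (fst (u t)))\<^sup>2) has_vector_derivative 2 * h r) (at r within {0..l})" if "r \<in> {0..l}" for r
      unfolding h_def by (rule has_vector_derivative_norm_square[OF quasi_sol_deriv(1)[OF u(1) that]])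
  qed (use h that in auto)
  obtain \<delta> where \<delta>: "0 < \<delta>" "\<delta> \<le> l" "\<And>s. 0 < s \<Longrightarrow> s < \<delta> \<Longrightarrow> fst (u s) \<noteq> 0"
    by (rule nonzero_near_0[OF G u one_neq_zero]) (rule that)
  have nz: "fst (u t) \<noteq> 0" if t: "0 < t" "t \<le> l" for t
  proof -
    define s where "s = min t \<delta> / 2"
    have s: "0 < s" "s < \<delta>" "s \<le> t" using t \<delta> by (auto simp: s_def)
    have "0 < (cmod (fst (u s)))\<^sup>2" using \<delta>(3)[OF s(1,2)] by simp
    then show ?thesis using mono[of s t] s t by auto
  qed
  define x where "x = (\<lambda>t. Re (fst (u t)))"
  have xnz: "x t \<noteq> 0" if "0 < t" "t \<le> l" for t
    using nz[OF that] real_solution(1)[OF G k(1), of t] that by (auto simp: x_def u_def)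
  have "((\<lambda>s. Re (fst (u s) / of_real s)) \<longlongrightarrow> Re 1) (at_right 0)"
    by (intro tendsto_Re quotient_at_0[OF G u])
  then have "((\<lambda>s. x s / s) \<longlongrightarrow> 1) (at_right 0)" by (simp add: x_def Re_divide_of_real)
  then have "\<forall>\<^sub>F s in at_right 0. 0 < x s / s \<and> 0 < s"
    by (intro eventually_conj order_tendstoD(1)[OF _ zero_less_one] eventually_at_right_less)
  then obtain b where b: "0 < b" "\<And>s. 0 < s \<Longrightarrow> s < b \<Longrightarrow> 0 < x s"
    unfolding eventually_at_right_field by (auto simp: zero_less_divide_iff)
  define s where "s = min t b / 2"
  have s: "0 < s" "s < b" "s \<le> t" using t b by (auto simp: s_def)
  have "0 < x t"
  proof (rule ccontr)
    assume "\<not> 0 < x t"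
    then have "x t \<le> 0" by simp
    moreover have "0 \<le> x s" using b(2)[OF s(1,2)] by simp
    moreover have "continuous_on {s..t} x"
      unfolding x_def by (rule continuous_on_subset[of "{0..l}"])
        (use s t in \<open>auto intro!: continuous_intros quasi_sol_continuous(2)[OF u(1)]\<close>)
    ultimately obtain r where "s \<le> r" "r \<le> t" "x r = 0"
      using IVT2'[of x t 0 s] s by auto
    then show False using xnz[of r] s t by auto
  qed
  then show ?thesis by (simp add: x_def u_def)
qed

text \<open>With the positive solutions x for G and x1 for H, the Wronskian identity and the
  boundary condition for G give x(l) bc(H) = k times the integral of x x1 against d(H - G). Here k <
  0, and \<open>\<sigma>\<close> records in which direction H - G is monotone.\<close>

lemma bc_real_compare:
  assumes res: "resonance z G" and H: "H \<in> profiles" and k: "Im (wavenum z) = 0" "Re (wavenum z) < 0"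
    and z: "Re z = 0"
    and \<sigma>: "mono_on {0..l} (\<lambda>t. \<sigma> * (H t - G t))" "0 < \<sigma> * (H l - G l)" "\<sigma> = 1 \<or> \<sigma> = (-1 :: real)"
  shows "\<sigma> * Re (bc z H) < 0"
proof -
  define k where "k = wavenum z"
  note k = k[folded k_def]
  have G: "G \<in> profiles" using res by (simp add: resonance_def)
  have ll: "l \<in> {0..l}" using l by simp
  define x where "x = (\<lambda>t. Re (fst (sol k 1 G t)))"
  define y where "y = (\<lambda>t. Re (slope (coef k G) (sol k 1 G) t))"
  define x1 where "x1 = (\<lambda>t. Re (fst (sol k 1 H t)))"
  define y1 where "y1 = (\<lambda>t. Re (slope (coef k H) (sol k 1 H) t))"
  have E: "fst (sol k 1 G t) = of_real (x t)" "slope (coef k G) (sol k 1 G) t = of_real (y t)"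
    "fst (sol k 1 H t) = of_real (x1 t)" "slope (coef k H) (sol k 1 H) t = of_real (y1 t)" if "t \<in> {0..l}" for t
    unfolding x_def y_def x1_def y1_def
    by (rule real_solution(1)[OF G k(1) that] real_solution(2)[OF G k(1) that]
        real_solution(1)[OF H k(1) that] real_solution(2)[OF H k(1) that])+
  have cont: "continuous_on {0..l} x" "continuous_on {0..l} y" "continuous_on {0..l} x1" "continuous_on {0..l} y1"
    unfolding x_def y_def x1_def y1_def
    by (intro continuous_on_Re quasi_sol_continuous(2)[OF sol(2)] quasi_sol_continuous(4)[OF sol(2)]
        profile_coef_continuous G H)+
  have dx: "(x has_vector_derivative y t) (at t within {0..l})" "(x1 has_vector_derivative y1 t) (at t within {0..l})"
    if "t \<in> {0..l}" for t
    unfolding x_def y_def x1_def y1_def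
    by (intro bounded_linear.has_vector_derivative[OF bounded_linear_Re] quasi_sol_deriv(1)[OF sol(2)] G H that)+
  define w where "w = (\<lambda>t. x t * x1 t)"
  define w' where "w' = (\<lambda>t. x t * y1 t + y t * x1 t)"
  define N where "N = (\<lambda>t. \<sigma> * (H t - G t))"
  have pos: "0 < N l * w l - integral {0..l} (\<lambda>t. N t * w' t)"
  proof (rule stieltjes_positive[OF l])
    show "mono_on {0..l} N" "0 < N l" using \<sigma> by (simp_all add: N_def)
    show "continuous_on {0..l} N" unfolding N_def
      by (intro continuous_on_mult continuous_on_const continuous_on_diff profile_continuous G H)
    show "N 0 = 0" by (simp add: N_def profile_0 G H)
    show "(w has_vector_derivative w' t) (at t within {0..l})" if "t \<in> {0..l}" for t
      unfolding w_def w'_def by (rule has_vector_derivative_mult[OF dx[OF that]])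
    show "continuous_on {0..l} w'" unfolding w'_def by (intro continuous_intros cont)
    show "0 < w t" if "0 < t" "t \<le> l" for t
      unfolding w_def x_def x1_def using k that by (intro mult_pos_pos real_solution_positive G H) auto
    show "w 0 = 0" by (simp add: w_def x_def sol(1)[OF G])
  qed
  have "slope (coef k G) (sol k 1 G) l * fst (sol k 1 H l) - fst (sol k 1 G l) * slope (coef k H) (sol k 1 H) l =
    (coef k H l - coef k G l) * (fst (sol k 1 G l) * fst (sol k 1 H l)) -
    integral {0..l} (\<lambda>t. (coef k H t - coef k G t) *
      (slope (coef k G) (sol k 1 G) t * fst (sol k 1 H t) + fst (sol k 1 G t) * slope (coef k H) (sol k 1 H) t))"
    by (rule wronskian_identity[OF sol(2)[OF G] _ sol(2)[OF H] _ profile_coef_continuous[OF G] profile_coef_continuous[OF H]])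
      (use l in \<open>simp_all add: sol(1) G H\<close>)
  also have "integral {0..l} (\<lambda>t. (coef k H t - coef k G t) *
      (slope (coef k G) (sol k 1 G) t * fst (sol k 1 H t) + fst (sol k 1 G t) * slope (coef k H) (sol k 1 H) t)) =
     integral {0..l} (\<lambda>t. k * of_real ((H t - G t) * w' t))"
    by (rule integral_cong) (simp only: E, simp add: w'_def algebra_simps)
  also have "\<dots> = k * of_real (integral {0..l} (\<lambda>t. (H t - G t) * w' t))"
  proof (rule integral_unique, intro has_integral_mult_right has_integral_of_real integrable_integral)
    show "(\<lambda>t. (H t - G t) * w' t) integrable_on {0..l}"
      unfolding w'_def
      by (intro integrable_continuous_real continuous_on_mult continuous_on_add continuous_on_diff
          profile_continuous G H cont)
  qed
  finally have wr: "of_real (y l) * of_real (x1 l) - of_real (x l) * of_real (y1 l) =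
      k * of_real ((H l - G l) * w l - integral {0..l} (\<lambda>t. (H t - G t) * w' t))"
    unfolding E[OF ll] by (simp add: w_def algebra_simps)
  have bcH: "bc z H = \<i> * z * of_real \<kappa> * of_real (x1 l) - of_real (y1 l)"
    unfolding bc_def k_def[symmetric] E[OF ll] ..
  have "of_real (x l) * bc z H = (\<i> * z * of_real \<kappa> * of_real (x l)) * of_real (x1 l) - of_real (x l) * of_real (y1 l)"
    unfolding bcH by (simp add: algebra_simps)
  also have "\<i> * z * of_real \<kappa> * of_real (x l) = of_real (y l)"
    using resonance_end_nonzero(2)[OF res, folded k_def] unfolding E[OF ll] by simp
  finally have eq: "of_real (x l) * bc z H = k * of_real ((H l - G l) * w l - integral {0..l} (\<lambda>t. (H t - G t) * w' t))"
    unfolding wr .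
  have "x l * Re (bc z H) = Re k * ((H l - G l) * w l - integral {0..l} (\<lambda>t. (H t - G t) * w' t))"
    using arg_cong[OF eq, of Re] by (simp only: Re_complex_of_real times_complex.sel Im_complex_of_real)
  then have "x l * (\<sigma> * Re (bc z H)) = Re k * (\<sigma> * ((H l - G l) * w l - integral {0..l} (\<lambda>t. (H t - G t) * w' t)))"
    by (metis mult.left_commute)
  also have "\<sigma> * ((H l - G l) * w l - integral {0..l} (\<lambda>t. (H t - G t) * w' t)) =
      N l * w l - integral {0..l} (\<lambda>t. N t * w' t)"
    unfolding N_def mult.assoc integral_mult_right by (rule right_diff_distrib)
  also have "Re k * (N l * w l - integral {0..l} (\<lambda>t. N t * w' t)) < 0"
    by (rule mult_neg_pos[OF k(2) pos])
  finally have "x l * (\<sigma> * Re (bc z H)) < 0" .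
  moreover have "0 < x l" unfolding x_def using k l by (intro real_solution_positive G) auto
  ultimately show ?thesis by (simp add: mult_less_0_iff)
qed

lemma bc_real:
  assumes "H \<in> profiles"
  shows "Im (bc (Complex 0 b) H) = 0"
proof -
  have k: "Im (wavenum (Complex 0 b)) = 0"
    by (simp add: wavenum_def power2_eq_square flip: of_real_mult)
  have ll: "l \<in> {0..l}" using l by simp
  note r = real_solution[OF assms k ll]
  have "Im (\<i> * Complex 0 b * of_real \<kappa> * of_real x - of_real y) = 0" for x y by simp
  then show ?thesis unfolding bc_def by (subst r(1), subst r(2))
qed

text \<open>If G(l) were strictly between e1 l and e2 l, the two extreme constant cavities would
  have mismatches of opposite signs. The signs persist at a slightly smaller decay rate, where an
  intermediate constant cavity then resonates, against minimality. So G has constant slope e1 or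
  e2.\<close>

lemma optimal_bang_real:
  assumes res: "resonance (Complex \<alpha> (- \<beta>)) G" and k: "Im (wavenum (Complex \<alpha> (- \<beta>))) = 0"
    and opt: "\<And>\<beta>' G'. resonance (Complex \<alpha> (- \<beta>')) G' \<Longrightarrow> \<beta> \<le> \<beta>'"
  shows "\<exists>q u. norm q = 1 \<and> bang (wavenum (Complex \<alpha> (- \<beta>))) q G u"
proof -
  define z where "z = Complex \<alpha> (- \<beta>)"
  have \<beta>: "0 < \<beta>" using resonance_Im_neg[OF res] by simp
  have wn: "wavenum (Complex a b) = Complex ((a\<^sup>2 - b\<^sup>2) / c\<^sup>2) (2 * a * b / c\<^sup>2)" for a b
  proof -
    have "wavenum (Complex a b) = (Complex a b)\<^sup>2 / of_real (c\<^sup>2)" by (simp add: wavenum_def)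
    then show ?thesis
      by (simp only: complex_eq_iff Re_divide_of_real Im_divide_of_real) (simp add: power2_eq_square)
  qed
  \<comment> \<open>Im k is - 2 \<alpha> \<beta> / c^2 with \<beta> > 0, so a real k means \<alpha>
    = 0 and k = - \<beta>^2 / c^2.\<close>
  have \<alpha>: "\<alpha> = 0" using k \<beta> c by (simp add: wn)
  have kk: "Im (wavenum z) = 0" "Re (wavenum z) < 0"
    using \<beta> c by (simp_all add: z_def wn \<alpha>)
  have G: "G \<in> profiles" using res by (simp add: resonance_def)
  have lin: "(\<lambda>t. e * t) \<in> profiles" if "e1 \<le> e" "e \<le> e2" for e by (rule profile_linear[OF that])
  define f where "f = (\<lambda>b e. Re (bc (Complex 0 (- b)) (\<lambda>t. e * t)))"
  have "G l = e1 * l \<or> G l = e2 * l"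
  proof (rule ccontr)
    assume "\<not> (G l = e1 * l \<or> G l = e2 * l)"
    then have Gl: "e1 * l < G l" "G l < e2 * l"
      using profile_slope[OF G, of 0 l] profile_0[OF G] l by auto
    have "-1 * Re (bc z (\<lambda>t. e1 * t)) < 0"
    proof (rule bc_real_compare[OF res[folded z_def] lin kk])
      show "mono_on {0..l} (\<lambda>t. - 1 * (e1 * t - G t))"
      proof (rule mono_onI)
        fix s t assume "s \<in> {0..l}" "t \<in> {0..l}" "s \<le> t"
        then show "- 1 * (e1 * s - G s) \<le> - 1 * (e1 * t - G t)"
          using profile_slope(1)[OF G, of s t] by (simp add: right_diff_distrib)
      qed
    qed (use Gl e12 in \<open>auto simp: z_def \<alpha>\<close>)
    then have f1: "0 < f \<beta> e1" by (simp add: f_def z_def \<alpha>)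
    have "1 * Re (bc z (\<lambda>t. e2 * t)) < 0"
    proof (rule bc_real_compare[OF res[folded z_def] lin kk])
      show "mono_on {0..l} (\<lambda>t. 1 * (e2 * t - G t))"
      proof (rule mono_onI)
        fix s t assume "s \<in> {0..l}" "t \<in> {0..l}" "s \<le> t"
        then show "1 * (e2 * s - G s) \<le> 1 * (e2 * t - G t)"
          using profile_slope(2)[OF G, of s t] by (simp add: right_diff_distrib)
      qed
    qed (use Gl e12 in \<open>auto simp: z_def \<alpha>\<close>)
    then have f2: "f \<beta> e2 < 0" by (simp add: f_def z_def \<alpha>)
    have flim: "(\<lambda>n. f (b n) (e n)) \<longlonglongrightarrow> f b0 e0"
      if lim: "b \<longlonglongrightarrow> b0" "e \<longlonglongrightarrow> e0" and e: "\<And>n. e n \<in> {e1..e2}" "e0 \<in> {e1..e2}" for b b0 e e0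
    proof -
      have "uniform_limit {0..l} (\<lambda>n t. e n * t) (\<lambda>t. e0 * t) sequentially"
        by (intro uniform_lim_mult uniform_limit_const)
          (use lim(2) in \<open>auto simp: uniform_limit_iff tendsto_iff image_constant_conv bounded_closed_interval\<close>)
      then show ?thesis unfolding f_def
        by (intro tendsto_Re bc_tendsto tendsto_Complex tendsto_intros lim lin) (use e in auto)
    qed
    \<comment> \<open>Rates strictly below \<open>\<beta>\<close> that converge to it; a resonance
      at any of them contradicts \<open>opt\<close>.\<close>
    define b where "b = (\<lambda>n::nat. \<beta> - 1 / real (Suc n))"
    have b: "b \<longlonglongrightarrow> \<beta>"
      using tendsto_diff[OF tendsto_const[of \<beta>] LIMSEQ_Suc[OF lim_1_over_n]] by (simp add: b_def)
    have "\<forall>\<^sub>F n in sequentially. 0 < f (b n) e1 \<and> f (b n) e2 < 0"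
      using order_tendstoD(1)[OF flim[OF b tendsto_const[of e1]] f1]
        order_tendstoD(2)[OF flim[OF b tendsto_const[of e2]] f2] e12
      by (auto intro: eventually_conj)
    then obtain n where n: "0 < f (b n) e1" "f (b n) e2 < 0"
      unfolding eventually_sequentially by blast
    have "continuous_on {e1..e2} (f (b n))"
      unfolding continuous_on_sequentially comp_def
      using flim[OF tendsto_const[of "b n"]] by blast
    then obtain e where e: "e1 \<le> e" "e \<le> e2" "f (b n) e = 0"
      using IVT2'[of "f (b n)" e2 0 e1] n e12 by auto
    then have "bc (Complex 0 (- b n)) (\<lambda>t. e * t) = 0"
      using bc_real[OF lin[OF e(1,2)], of "- b n"] by (simp add: f_def complex_eq_iff)
    then have "resonance (Complex \<alpha> (- b n)) (\<lambda>t. e * t)"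
      using lin[OF e(1,2)] by (simp add: resonance_def \<alpha>)
    from opt[OF this] show False by (simp add: b_def)
  qed
  then obtain e where e: "e = e1 \<or> e = e2" "G l = e * l" by blast
  \<comment> \<open>An extreme value at l leaves no room in the slope bounds on [0, t] and
    [t, l].\<close>
  have Ge: "G t = e * t" if "t \<in> {0..l}" for t
    using e profile_slope[OF G, of 0 t] profile_slope[OF G, of t l] that profile_0[OF G]
    by (auto simp: right_diff_distrib)
  \<comment> \<open>The square is i or 1, so that the switching law, constant for real k, selects e2
    or e1: Im 1 = 0 counts as the lower value.\<close>
  define q where "q = (if e = e2 then cis (pi / 4) else 1)"
  have q: "norm q = 1" "q \<noteq> 0" by (auto simp: q_def)
  have "(cis (pi / 4))\<^sup>2 = cis (pi / 2)"
    by (simp only: power2_eq_square cis_mult) simp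
  then have "q\<^sup>2 = (if e = e2 then \<i> else 1)"
    by (simp add: q_def)
  then have qe: "(if Im (q\<^sup>2) > 0 then e2 else e1) = e" using e e12 by auto
  obtain H u where b: "bang (wavenum z) q H u" using bang_exists[OF q(2)] by blast
  then obtain X where X: "finite X" "\<And>s. s \<in> {0<..<l} - X \<Longrightarrow> (H has_vector_derivative sw (fst (u s))) (at s)"
    and H: "H \<in> profiles" and u: "quasi_sol l (coef (wavenum z) H) u" "u 0 = (0, q)"
    unfolding bang_def by blast
  have HG: "H t = G t" if "t \<in> {0..l}" for t
    using bang_unique_real[OF b q(2) kk(1) that] Ge[OF that] unfolding qe by simp
  have "quasi_sol l (coef (wavenum z) G) u"
    using u(1) HG by (simp add: quasi_sol_def)
  moreover have "(G has_vector_derivative sw (fst (u s))) (at s)" if s: "s \<in> {0<..<l} - X" for s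
    by (rule has_vector_derivative_transform_within_open[OF X(2)[OF s], where S = "{0<..<l}"])
      (use s HG in auto)
  ultimately have "bang (wavenum z) q G u" unfolding bang_def using G u X(1) by blast
  with q(1) show ?thesis by (auto simp: z_def)
qed

lemma optimal_bang:
  assumes res: "resonance (Complex \<alpha> (- \<beta>)) G"
    and opt: "\<And>\<beta>' G'. resonance (Complex \<alpha> (- \<beta>')) G' \<Longrightarrow> \<beta> \<le> \<beta>'"
  shows "\<exists>q u. norm q = 1 \<and> bang (wavenum (Complex \<alpha> (- \<beta>))) q G u"
proof (cases "Im (wavenum (Complex \<alpha> (- \<beta>))) = 0")
  case True
  then show ?thesis by (rule optimal_bang_real[OF res _ opt])
next
  case False
  then show ?thesis
  proof (rule optimal_bang_nonreal[OF res])
    fix \<delta> :: real assume \<delta>: "0 < \<delta>"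
    \<comment> \<open>Moving up by \<open>\<delta> / 2\<close> lowers the decay rate below the
      minimal one.\<close>
    have "norm (Complex \<alpha> (- (\<beta> - \<delta> / 2)) - Complex \<alpha> (- \<beta>)) < \<delta>"
      using \<delta> by (simp add: cmod_def)
    moreover have "\<not> resonance (Complex \<alpha> (- (\<beta> - \<delta> / 2))) G'" for G'
      using opt[of "\<beta> - \<delta> / 2" G'] \<delta> by auto
    ultimately show "\<exists>z'. norm (z' - Complex \<alpha> (- \<beta>)) < \<delta> \<and> (\<forall>G'. \<not> resonance z' G')" by blast
  qed
qed

end

section \<open>Optimal cavities\<close>

lemma wave_solution_AE_cong:
  assumes "wave_solution l c \<omega> \<epsilon> E" "AE s in lebesgue_on {0<..<l}. \<epsilon> s = \<epsilon>' s"
  shows "wave_solution l c \<omega> \<epsilon>' E"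
  using assms unfolding wave_solution_def by (auto elim: eventually_elim2)

lemma wave_solution_continuous:
  assumes "wave_solution l c \<omega> \<epsilon> E"
  shows "continuous_on {0..l} E"
  using assms unfolding wave_solution_def continuous_on_eq_continuous_within
  by (auto intro: differentiable_imp_continuous_within)

context cavity_range
begin

text \<open>For real k the set where Im (E^2) = 0 may be the whole interval, so
  \<open>sw_tendsto\<close> does not apply; there the switching law is constant off the zeros of
  E.\<close>

lemma sw_piecewise_continuous:
  assumes G: "G \<in> profiles" and u: "quasi_sol l (coef k G) u" "u 0 = (0, q)" "q \<noteq> 0"
  shows "\<exists>X. finite X \<and> (\<forall>s\<in>{0..l} - X. continuous (at s within {0..l}) (\<lambda>r. sw (fst (u r))))"
proof -
  have lim: "((\<lambda>r. fst (u r)) \<longlongrightarrow> fst (u s)) (at s within {0..l})" if "s \<in> {0..l}" for s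
    using quasi_sol_continuous(2)[OF u(1)] that by (auto simp: continuous_on_def)
  show ?thesis
  proof (cases "Im k = 0")
    case False
    have "continuous (at s within {0..l}) (\<lambda>r. sw (fst (u r)))"
      if s: "s \<in> {0..l} - {t \<in> {0..l}. Im ((fst (u t))\<^sup>2) = 0}" for s
      unfolding continuous_within by (rule sw_tendsto[OF lim]) (use s in blast)+
    then show ?thesis using Im_square_zeros_finite[OF G u False] by blast
  next
    case True
    have "continuous (at s within {0..l}) (\<lambda>r. sw (fst (u r)))"
      if s: "s \<in> {0..l} - {t \<in> {0..l}. fst (u t) = 0}" for s
    proof -
      have "\<forall>\<^sub>F r in at s within {0..l}. fst (u r) \<noteq> 0"
        using tendsto_imp_eventually_ne[OF lim, of s 0] s by auto
      moreover have "\<forall>\<^sub>F r in at s within {0..l}. r \<in> {0..l}"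
        by (auto simp: eventually_at_filter)
      ultimately have "\<forall>\<^sub>F r in at s within {0..l}. sw (fst (u r)) = sw (fst (u s))"
      proof eventually_elim
        case (elim r)
        then show ?case
          using sw_real_coefficient[OF G u True, of r] sw_real_coefficient[OF G u True, of s] s by auto
      qed
      then show ?thesis unfolding continuous_within by (rule tendsto_eventually)
    qed
    then show ?thesis using zeros_finite[OF G u] by blast
  qed
qed

lemma switched_cavity_admissible:
  assumes "continuous_on {0..l} P"
  shows "admissible_cavity l e1 e2 (switched_cavity e1 e2 P)"
    and "switched_cavity e1 e2 P \<in> borel_measurable (lebesgue_on {0<..<l})"
proof -
  have "continuous_on {0<..<l} P" using assms by (rule continuous_on_subset) auto
  then have "P \<in> borel_measurable (lebesgue_on {0<..<l})"
    by (rule continuous_imp_measurable_on_sets_lebesgue) simp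
  from measurable_compose[OF this sw_measurable]
  show m: "switched_cavity e1 e2 P \<in> borel_measurable (lebesgue_on {0<..<l})"
    unfolding switched_cavity_sw[abs_def] .
  show "admissible_cavity l e1 e2 (switched_cavity e1 e2 P)"
    unfolding admissible_cavity_def switched_cavity_sw using m sw_bounds
    by (simp add: switched_cavity_sw[abs_def])
qed

end

context resonator
begin

section \<open>The functions Psi and W, and the return to cavities\<close>

text \<open>The equation holds almost everywhere only, but the switched coefficient is continuous
  off a finite set, and there its integral G has it as derivative.\<close>

lemma wave_solution_imp_bang:
  assumes w: "wave_solution l c z (switched_cavity e1 e2 P) P" "P 0 = 0" and q: "deriv_on l P 0 = q" "q \<noteq> 0"
  shows "\<exists>G u. bang (wavenum z) q G u \<and> (\<forall>t. fst (u t) = P t)"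
proof -
  have contP: "continuous_on {0..l} P" using w(1) by (rule wave_solution_continuous)
  define G where "G = (\<lambda>t. integral {0..t} (switched_cavity e1 e2 P))"
  define u where "u = (\<lambda>t. (P t, deriv_on l P t + z\<^sup>2 / (of_real c)\<^sup>2 * of_real (integral {0..t} (switched_cavity e1 e2 P)) * P t))"
  have bounds: "e1 \<le> switched_cavity e1 e2 P s" "switched_cavity e1 e2 P s \<le> e2" for s
    unfolding switched_cavity_sw by (rule sw_bounds)+
  note qs = wave_solution_imp_quasi_sol[OF w switched_cavity_admissible(2)[OF contP] bounds]
  have G: "G \<in> profiles" and u: "quasi_sol l (coef (wavenum z) G) u" "u 0 = (0, q)"
    using qs(1,2,3) q by (simp_all add: G_def u_def wavenum_def)
  have uP: "fst (u t) = P t" for t by (simp add: u_def)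
  have Gsw: "G = (\<lambda>t. integral {0..t} (\<lambda>r. sw (fst (u r))))"
    by (simp add: G_def uP switched_cavity_sw[abs_def])
  obtain X where X: "finite X" "\<And>s. s \<in> {0..l} - X \<Longrightarrow> continuous (at s within {0..l}) (\<lambda>r. sw (fst (u r)))"
    using sw_piecewise_continuous[OF G u q(2)] by blast
  have int: "(\<lambda>r. sw (fst (u r))) integrable_on {0..l}"
    by (rule sw_integrable[OF quasi_sol_continuous(2)[OF u(1)]])
  have "(G has_vector_derivative sw (fst (u s))) (at s)" if s: "s \<in> {0<..<l} - X" for s
    unfolding Gsw by (rule sw_integral_deriv[OF int _ X(2)]) (use s in auto)
  then have "bang (wavenum z) q G u" unfolding bang_def using G u X(1) by blast
  then show ?thesis using uP by blast
qed

lemma bang_imp_wave_solution: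
  assumes b: "bang (wavenum z) q G u" and t: "t \<in> {0..l}"
  defines "P \<equiv> restrict (\<lambda>t. fst (u t)) {0..l}"
  shows "wave_solution l c z (switched_cavity e1 e2 P) P" "P 0 = 0"
    "deriv_on l P t = slope (coef (wavenum z) G) u t"
proof -
  from b obtain X where G: "G \<in> profiles" and u: "quasi_sol l (coef (wavenum z) G) u" "u 0 = (0, q)"
    and X: "finite X" "\<And>s. s \<in> {0<..<l} - X \<Longrightarrow> (G has_vector_derivative sw (fst (u s))) (at s)"
    unfolding bang_def by blast
  have P: "P t = fst (u t)" if "t \<in> {0..l}" for t using that by (simp add: P_def)
  show "wave_solution l c z (switched_cavity e1 e2 P) P"
  proof (rule wave_solutionI[OF G u(1)[unfolded wavenum_def] P X(1)])
    show "(G has_vector_derivative switched_cavity e1 e2 P s) (at s)" if "s \<in> {0<..<l} - X" for s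
      using X(2)[OF that] that by (simp add: switched_cavity_sw P)
  qed
  show "P 0 = 0" using l u(2) by (simp add: P)
  show "deriv_on l P t = slope (coef (wavenum z) G) u t"
    by (rule deriv_on_eq(2)[OF u(1) P t])
qed

text \<open>This legitimates the definite description: \<open>bang\<close> gives a solution, any
  competitor is turned into a \<open>bang\<close> solution, and \<open>bang_unique\<close>
  identifies the two. \<open>restrict\<close> accounts for extensionality.\<close>

lemma Psi_eq:
  assumes b: "bang (wavenum z) (exp (\<i> * of_real \<theta>)) G u"
  shows "Psi l c e1 e2 z \<theta> = restrict (\<lambda>t. fst (u t)) {0..l}"
  unfolding Psi_def
proof (rule the_equality)
  have l0: "0 \<in> {0..l}" using l by simp
  have "slope (coef (wavenum z) G) u 0 = exp (\<i> * of_real \<theta>)"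
    using b by (simp add: bang_def slope_0)
  then show "restrict (\<lambda>t. fst (u t)) {0..l} \<in> extensional {0..l} \<and>
      wave_solution l c z (switched_cavity e1 e2 (restrict (\<lambda>t. fst (u t)) {0..l})) (restrict (\<lambda>t. fst (u t)) {0..l}) \<and>
      restrict (\<lambda>t. fst (u t)) {0..l} 0 = 0 \<and> deriv_on l (restrict (\<lambda>t. fst (u t)) {0..l}) 0 = exp (\<i> * of_real \<theta>)"
    using bang_imp_wave_solution[OF b l0] by simp
  fix P assume P: "P \<in> extensional {0..l} \<and> wave_solution l c z (switched_cavity e1 e2 P) P \<and>
    P 0 = 0 \<and> deriv_on l P 0 = exp (\<i> * of_real \<theta>)"
  then obtain H v where H: "bang (wavenum z) (exp (\<i> * of_real \<theta>)) H v" "\<And>t. fst (v t) = P t"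
    using wave_solution_imp_bang[of z P] by auto
  show "P = restrict (\<lambda>t. fst (u t)) {0..l}"
  proof (rule extensionalityI)
    show "P x = restrict (\<lambda>t. fst (u t)) {0..l} x" if "x \<in> {0..l}" for x
      using bang_unique(2)[OF H(1) b _ that] H(2)[of x] that by simp
  qed (use P in auto)
qed

lemma W_eq:
  assumes b: "bang (wavenum z) (exp (\<i> * of_real \<theta>)) G u" and \<kappa>: "\<kappa> = sqrt \<epsilon>inf / c"
  shows "W l c \<epsilon>inf e1 e2 z \<theta> = exp (\<i> * of_real \<theta>) * bc z G"
proof -
  have G: "G \<in> profiles" and u: "quasi_sol l (coef (wavenum z) G) u" "u 0 = (0, exp (\<i> * of_real \<theta>))"
    using b by (auto simp: bang_def)
  have ll: "l \<in> {0..l}" using l by simp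
  show ?thesis
    unfolding W_def Psi_eq[OF b] bang_imp_wave_solution(3)[OF b ll] bc_scale[OF G u, symmetric] \<kappa>[symmetric]
    using l by simp
qed

lemma W_zero_imp_pair:
  assumes W: "W l c \<epsilon>inf e1 e2 z \<theta> = 0" and \<kappa>: "\<kappa> = sqrt \<epsilon>inf / c"
  shows "admissible_pair l c \<epsilon>inf e1 e2 z (switched_cavity e1 e2 (Psi l c e1 e2 z \<theta>))"
proof -
  define P where "P = Psi l c e1 e2 z \<theta>"
  obtain G u where b: "bang (wavenum z) (exp (\<i> * of_real \<theta>)) G u"
    using bang_exists[of "exp (\<i> * of_real \<theta>)" "wavenum z"] by auto
  have l0: "0 \<in> {0..l}" using l by simp
  have P: "wave_solution l c z (switched_cavity e1 e2 P) P" "P 0 = 0"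
    using bang_imp_wave_solution(1,2)[OF b l0] by (simp_all add: P_def Psi_eq[OF b])
  have G: "G \<in> profiles" and u: "quasi_sol l (coef (wavenum z) G) u" "u 0 = (0, exp (\<i> * of_real \<theta>))"
    using b by (auto simp: bang_def)
  obtain \<delta> where \<delta>: "0 < \<delta>" "\<delta> \<le> l" "\<And>s. 0 < s \<Longrightarrow> s < \<delta> \<Longrightarrow> fst (u s) \<noteq> 0"
    by (rule nonzero_near_0[OF G u exp_not_eq_zero]) (rule that)
  have "P (\<delta> / 2) \<noteq> 0" using \<delta>(3)[of "\<delta> / 2"] \<delta>(1,2) by (simp add: P_def Psi_eq[OF b])
  then have "\<exists>s\<in>{0..l}. P s \<noteq> 0" using \<delta> by (intro bexI[of _ "\<delta> / 2"]) auto
  moreover have "\<i> * z * of_real (sqrt \<epsilon>inf / c) * P l = deriv_on l P l"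
    using W unfolding W_def P_def by simp
  ultimately have "qn_eigenvalue l c \<epsilon>inf (switched_cavity e1 e2 P) z"
    unfolding qn_eigenvalue_def using P by blast
  then show ?thesis
    unfolding admissible_pair_def P_def[symmetric]
    using switched_cavity_admissible(1)[OF wave_solution_continuous[OF P(1)]] by blast
qed

text \<open>The last conclusion keeps the given cavity itself, since the profile remembers it only
  up to null sets; \<open>switched_AE\<close> recovers the cavity from it.\<close>

lemma pair_imp_resonance:
  assumes pair: "admissible_pair l c \<epsilon>inf e1 e2 z \<epsilon>" and \<kappa>: "\<kappa> = sqrt \<epsilon>inf / c"
  obtains G u where "resonance z G" "quasi_sol l (coef (wavenum z) G) u" "fst (u 0) = 0" "snd (u 0) \<noteq> 0"
    "AE s in lebesgue_on {0<..<l}.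
      (slope (coef (wavenum z) G) u has_vector_derivative - wavenum z * of_real (\<epsilon> s) * fst (u s)) (at s)"
proof -
  obtain E where E: "wave_solution l c z \<epsilon> E" "E 0 = 0" "\<i> * z * of_real \<kappa> * E l = deriv_on l E l"
      and ne: "\<exists>s\<in>{0..l}. E s \<noteq> 0"
    and \<epsilon>: "\<epsilon> \<in> borel_measurable (lebesgue_on {0<..<l})"
      "AE s in lebesgue_on {0<..<l}. e1 \<le> \<epsilon> s \<and> \<epsilon> s \<le> e2"
    using pair unfolding admissible_pair_def admissible_cavity_def qn_eigenvalue_def \<kappa> by blast
  \<comment> \<open>The bounds on the cavity hold almost everywhere. Clamping changes it on a null
    set and makes them hold everywhere, as the passage to profiles requires.\<close>
  define \<eta> where "\<eta> = (\<lambda>s. max e1 (min e2 (\<epsilon> s)))"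
  have eq: "AE s in lebesgue_on {0<..<l}. \<epsilon> s = \<eta> s"
    using \<epsilon>(2) by eventually_elim (auto simp: \<eta>_def)
  have w: "wave_solution l c z \<eta> E" by (rule wave_solution_AE_cong[OF E(1) eq])
  have \<eta>: "\<eta> \<in> borel_measurable (lebesgue_on {0<..<l})" "\<And>s. e1 \<le> \<eta> s" "\<And>s. \<eta> s \<le> e2"
    unfolding \<eta>_def using \<epsilon>(1) e12 by auto
  define G where "G = (\<lambda>t. integral {0..t} \<eta>)"
  define u where "u = (\<lambda>t. (E t, deriv_on l E t + z\<^sup>2 / (of_real c)\<^sup>2 * of_real (integral {0..t} \<eta>) * E t))"
  note qs = wave_solution_imp_quasi_sol[OF w E(2) \<eta>, folded wavenum_def]
  have G: "G \<in> profiles" and u: "quasi_sol l (coef (wavenum z) G) u" "u 0 = (0, deriv_on l E 0)"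
    and sl: "slope (coef (wavenum z) G) u t = deriv_on l E t" for t
    using qs by (simp_all add: G_def u_def wavenum_def)
  have uE: "fst (u t) = E t" for t by (simp add: u_def)
  have q0: "deriv_on l E 0 \<noteq> 0"
  proof
    assume "deriv_on l E 0 = 0"
    moreover obtain s where "s \<in> {0..l}" "E s \<noteq> 0" using ne by blast
    ultimately show False using sol_unique(1)[OF G u, of s] uE by simp
  qed
  have "deriv_on l E 0 * bc z G = 0"
    using bc_scale[OF G u] E(3) by (simp add: uE sl)
  then have res: "resonance z G" using q0 G by (simp add: resonance_def)
  have "AE s in lebesgue_on {0<..<l}.
      (slope (coef (wavenum z) G) u has_vector_derivative - wavenum z * of_real (\<epsilon> s) * fst (u s)) (at s)"
  proof -
    have "slope (coef (wavenum z) G) u = deriv_on l E" using sl by blast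
    then show ?thesis using E(1) by (simp add: wave_solution_def wavenum_def uE)
  qed
  with res u q0 show ?thesis by (intro that) auto
qed

text \<open>The unimodular q of \<open>optimal_bang\<close> is exp (i \<theta>) with \<theta> = Arg
  q. The \<open>bang\<close> solution keeps the given profile G, on which the converse part of the
  theorem relies.\<close>

lemma optimal_W_zero:
  assumes res: "resonance (Complex \<alpha> (- \<beta>)) G"
    and opt: "\<And>\<beta>' G'. resonance (Complex \<alpha> (- \<beta>')) G' \<Longrightarrow> \<beta> \<le> \<beta>'"
    and \<kappa>: "\<kappa> = sqrt \<epsilon>inf / c"
  obtains \<theta> u where "\<theta> \<in> {-pi<..pi}" "bang (wavenum (Complex \<alpha> (- \<beta>))) (exp (\<i> * of_real \<theta>)) G u"
    "W l c \<epsilon>inf e1 e2 (Complex \<alpha> (- \<beta>)) \<theta> = 0"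
proof -
  obtain q u where q: "norm q = 1" and b: "bang (wavenum (Complex \<alpha> (- \<beta>))) q G u"
    using optimal_bang[OF res] opt by blast
  have "exp (\<i> * of_real (Arg q)) = q"
    using q Arg_eq[of q] by (cases "q = 0") auto
  with b have b: "bang (wavenum (Complex \<alpha> (- \<beta>))) (exp (\<i> * of_real (Arg q))) G u" by simp
  show ?thesis
    by (rule that[OF _ b]) (use W_eq[OF b \<kappa>] res mpi_less_Arg Arg_le_pi in \<open>auto simp: resonance_def\<close>)
qed

text \<open>At almost every s the slope of u has derivative - k eps(s) E(s) by the wave equation and
  - k sw E(s) by the derivative of G. As k and E(s) are nonzero, the coefficients agree; G is never
  differentiated as an integral of eps.\<close>

lemma switched_AE:
  assumes u: "quasi_sol l (coef (wavenum z) G) u" "fst (u 0) = 0" "snd (u 0) \<noteq> 0"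
    and res: "resonance z G"
    and \<epsilon>: "AE s in lebesgue_on {0<..<l}.
      (slope (coef (wavenum z) G) u has_vector_derivative - wavenum z * of_real (\<epsilon> s) * fst (u s)) (at s)"
    and b: "bang (wavenum z) (exp (\<i> * of_real \<theta>)) G v"
  shows "AE s in lebesgue_on {0<..<l}. \<epsilon> s = switched_cavity e1 e2 (Psi l c e1 e2 z \<theta>) s"
proof -
  have G: "G \<in> profiles" using b by (simp add: bang_def)
  obtain X where X: "finite X" "\<And>s. s \<in> {0<..<l} - X \<Longrightarrow> (G has_vector_derivative sw (fst (v s))) (at s)"
    using b by (auto simp: bang_def)
  have k: "wavenum z \<noteq> 0" using resonance_Im_neg[OF res] c by (auto simp: wavenum_def)
  define Y where "Y = X \<union> {t \<in> {0..l}. fst (u t) = 0}"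
  have "u 0 = (0, snd (u 0))" using u(2) by (metis prod.collapse)
  then have "finite Y" using zeros_finite[OF G u(1) _ u(3)] X(1) by (simp add: Y_def)
  then have "Y \<in> null_sets lebesgue" using negligible_finite negligible_iff_null_sets by blast
  then have "AE s in lebesgue. s \<notin> Y" by (rule AE_not_in)
  then have "AE s in lebesgue_on {0<..<l}. s \<notin> Y" by (subst AE_restrict_space_iff) auto
  moreover have "AE s in lebesgue_on {0<..<l}. s \<in> {0<..<l}" by (rule AE_I2) simp
  ultimately show ?thesis
    using \<epsilon>
  proof eventually_elim
    case (elim s)
    then have s: "s \<in> {0<..<l} - X" "fst (u s) \<noteq> 0" by (auto simp: Y_def)
    have "(slope (coef (wavenum z) G) u has_vector_derivative - wavenum z * of_real (sw (fst (v s))) * fst (u s)) (at s)"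
      by (rule slope_deriv[OF u(1) _ X(2)[OF s(1)]]) (use s in simp)
    from vector_derivative_unique_at[OF elim(3) this]
    have "\<epsilon> s = sw (fst (v s))" using k s(2) by simp
    then show ?case using s by (simp add: switched_cavity_sw Psi_eq[OF b])
  qed
qed

end

theorem theorem6:
  fixes l c \<epsilon>inf \<epsilon>1 \<epsilon>2 \<alpha> :: real
  assumes "l > 0" and "c > 0" and "\<epsilon>inf \<ge> 1" and "1 \<le> \<epsilon>1" and "\<epsilon>1 < \<epsilon>2"
    and "admissible_frequency l c \<epsilon>inf \<epsilon>1 \<epsilon>2 \<alpha>"
  shows "let \<beta>m = beta_min l c \<epsilon>inf \<epsilon>1 \<epsilon>2 \<alpha>; \<omega> = Complex \<alpha> (- \<beta>m) in
    is_minimal_decay_rate l c \<epsilon>inf \<epsilon>1 \<epsilon>2 \<alpha> \<beta>m \<and>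
    (\<exists>\<theta>\<in>{-pi<..pi}. W l c \<epsilon>inf \<epsilon>1 \<epsilon>2 (Complex \<alpha> (- \<beta>m)) \<theta> = 0) \<and>
    (\<forall>\<beta>::real. (\<exists>\<theta>\<in>{-pi<..pi}. W l c \<epsilon>inf \<epsilon>1 \<epsilon>2 (Complex \<alpha> (- \<beta>)) \<theta> = 0) \<longrightarrow> \<beta>m \<le> \<beta>) \<and>
    (\<forall>\<theta>\<in>{-pi<..pi}. W l c \<epsilon>inf \<epsilon>1 \<epsilon>2 \<omega> \<theta> = 0 \<longrightarrow>
       optimal_cavity l c \<epsilon>inf \<epsilon>1 \<epsilon>2 \<alpha> (switched_cavity \<epsilon>1 \<epsilon>2 (Psi l c \<epsilon>1 \<epsilon>2 \<omega> \<theta>))) \<and>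
    (\<forall>\<epsilon>. optimal_cavity l c \<epsilon>inf \<epsilon>1 \<epsilon>2 \<alpha> \<epsilon> \<longrightarrow>
       (\<exists>\<theta>\<in>{-pi<..pi}. AE s in lebesgue_on {0<..<l}.
          \<epsilon> s = switched_cavity \<epsilon>1 \<epsilon>2 (Psi l c \<epsilon>1 \<epsilon>2 \<omega> \<theta>) s))"
proof -
  interpret resonator l \<epsilon>1 \<epsilon>2 c "sqrt \<epsilon>inf / c"
    using assms by unfold_locales auto
  obtain \<omega>0 \<epsilon>0 where pair0: "admissible_pair l c \<epsilon>inf \<epsilon>1 \<epsilon>2 \<omega>0 \<epsilon>0" "\<alpha> = Re \<omega>0"
    using assms(6) by (auto simp: admissible_frequency_def)
  obtain G0 where "resonance \<omega>0 G0" by (rule pair_imp_resonance[OF pair0(1) refl]) (rule that)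
  moreover have "\<omega>0 = Complex \<alpha> (- (- Im \<omega>0))" using \<open>\<alpha> = Re \<omega>0\<close> by simp
  ultimately have "\<exists>\<beta> G. resonance (Complex \<alpha> (- \<beta>)) G" by metis
  then obtain \<beta>m G where res: "resonance (Complex \<alpha> (- \<beta>m)) G"
    and opt: "\<And>\<beta> G. resonance (Complex \<alpha> (- \<beta>)) G \<Longrightarrow> \<beta>m \<le> \<beta>"
    by (rule minimal_resonance_exists) (rule that)
  define \<omega> where "\<omega> = Complex \<alpha> (- \<beta>m)"
  have lower: "\<beta>m \<le> decay_rate \<omega>' \<epsilon>'"
    if pair: "admissible_pair l c \<epsilon>inf \<epsilon>1 \<epsilon>2 \<omega>' \<epsilon>'" "Re \<omega>' = \<alpha>" for \<omega>' \<epsilon>'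
  proof -
    obtain G' where "resonance \<omega>' G'" by (rule pair_imp_resonance[OF pair(1) refl]) (rule that)
    moreover have "\<omega>' = Complex \<alpha> (- (- Im \<omega>'))" using pair(2) by auto
    ultimately show ?thesis using opt unfolding decay_rate_def by metis
  qed
  obtain \<theta>0 where \<theta>0: "\<theta>0 \<in> {-pi<..pi}" "W l c \<epsilon>inf \<epsilon>1 \<epsilon>2 \<omega> \<theta>0 = 0"
    by (rule optimal_W_zero[OF res _ refl, folded \<omega>_def], erule opt, rule that)
  have optimal: "optimal_for l c \<epsilon>inf \<epsilon>1 \<epsilon>2 \<alpha> \<beta>m (switched_cavity \<epsilon>1 \<epsilon>2 (Psi l c \<epsilon>1 \<epsilon>2 \<omega> \<theta>))"
    if "W l c \<epsilon>inf \<epsilon>1 \<epsilon>2 \<omega> \<theta> = 0" for \<theta>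
    using W_zero_imp_pair[OF that refl] lower by (simp add: optimal_for_def \<omega>_def)
  \<comment> \<open>Two minimal rates bound each other, which justifies the definite description in
    \<open>beta_min\<close>.\<close>
  have unique: "\<beta> = \<beta>m" if "optimal_for l c \<epsilon>inf \<epsilon>1 \<epsilon>2 \<alpha> \<beta> \<epsilon>" for \<beta> \<epsilon>
    using that optimal[OF \<theta>0(2)] unfolding optimal_for_def decay_rate_def
    by (metis complex.sel minus_minus order_antisym)
  have min: "is_minimal_decay_rate l c \<epsilon>inf \<epsilon>1 \<epsilon>2 \<alpha> \<beta>m"
    using optimal[OF \<theta>0(2)] by (auto simp: is_minimal_decay_rate_def)
  have \<beta>m: "beta_min l c \<epsilon>inf \<epsilon>1 \<epsilon>2 \<alpha> = \<beta>m"
    unfolding beta_min_def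
    by (rule the_equality, rule min) (use unique in \<open>auto simp: is_minimal_decay_rate_def\<close>)
  have "\<beta>m \<le> \<beta>" if "W l c \<epsilon>inf \<epsilon>1 \<epsilon>2 (Complex \<alpha> (- \<beta>)) \<theta> = 0" for \<beta> \<theta>
    using lower[OF W_zero_imp_pair[OF that refl]] by (simp add: decay_rate_def)
  moreover have "\<exists>\<theta>\<in>{-pi<..pi}. AE s in lebesgue_on {0<..<l}.
      \<epsilon> s = switched_cavity \<epsilon>1 \<epsilon>2 (Psi l c \<epsilon>1 \<epsilon>2 \<omega> \<theta>) s"
    if "optimal_cavity l c \<epsilon>inf \<epsilon>1 \<epsilon>2 \<alpha> \<epsilon>" for \<epsilon>
  proof -
    have pair: "admissible_pair l c \<epsilon>inf \<epsilon>1 \<epsilon>2 \<omega> \<epsilon>"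
      using that unique unfolding optimal_cavity_def \<omega>_def by (metis optimal_for_def)
    obtain H u where H: "resonance \<omega> H" "quasi_sol l (coef (wavenum \<omega>) H) u" "fst (u 0) = 0" "snd (u 0) \<noteq> 0"
      "AE s in lebesgue_on {0<..<l}.
        (slope (coef (wavenum \<omega>) H) u has_vector_derivative - wavenum \<omega> * of_real (\<epsilon> s) * fst (u s)) (at s)"
      by (rule pair_imp_resonance[OF pair refl]) (rule that)
    \<comment> \<open>The angle comes from the profile \<open>H\<close> of the cavity at hand, which
      is again a minimal resonance and may differ from \<open>G\<close>.\<close>
    obtain \<theta> v where \<theta>: "\<theta> \<in> {-pi<..pi}" "bang (wavenum \<omega>) (exp (\<i> * of_real \<theta>)) H v"
      by (rule optimal_W_zero[OF H(1)[unfolded \<omega>_def] _ refl, folded \<omega>_def], erule opt, rule that)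
    show ?thesis
      using switched_AE[OF H(2-4) H(1) H(5) \<theta>(2)] \<theta>(1) by blast
  qed
  ultimately show ?thesis
    unfolding \<beta>m Let_def \<omega>_def[symmetric] optimal_cavity_def
    using min \<theta>0 optimal by blast
qed

end
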